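(* Let $X_{\alpha,n}$ be a countable Stone space ($\alpha$ a countable ordinal, $n\ge 1$ an integer). The asymptotic dimension of the group $\mathrm{Homeo}(X_{\alpha,n})$ equipped with the compact-open topology is infinite if $\alpha$ is a successor ordinal and $n>1$, and is $0$ otherwise. Furthermore, when $\alpha$ is a successor ordinal and $n>1$, the group $\mathrm{Homeo}(X_{\alpha,n})$ has infinite coarse rank.
   Context: A Stone space is a compact, Hausdorff, totally disconnected space. The Cantor--Bendixson derivative $X'$ of $X$ is $X$ minus its isolated points; $X^{(0)}=X$, $X^{(\beta+1)}=(X^{(\beta)})'$, and $X^{(\lambda)}=\bigcap_{\beta<\lambda}X^{(\beta)}$ for $\lambda$ a limit ordinal. For a nonempty countable Stone space $X$ there are a countable ordinal $\alpha$ and an integer $n\ge1$ such that $X^{(\alpha)}$ has exactly $n$ points; the pair $(\alpha,n)$ determines $X$ up to homeomorphism, and $X_{\alpha,n}$ denotes this space (a model is $\omega^\alpha\cdot n+1$ with the order topology). Every topological group $G$ has a canonical (left-)coarse structure: $E\subset G\times G$ is an entourage iff $\sup_{(g,h)\in E}d(g,h)<\infty$ for every continuous left-invariant pseudometric $d$ on $G$. Asymptotic dimension of $G$ means that of this coarse structure. A continuous left-invariant pseudometric $d$ on $G$ is maximal if for every continuous left-invariant pseudometric $d'$ there are constants $K,C$ with $d'\le Kd+C$; it is unique up to quasi-isometry when it exists, and it exists for $\mathrm{Homeo}(X_{\alpha,n})$ when $\alpha$ is a successor ordinal. Such a group has infinite coarse rank if for every $m\geq 1$ there is a quasi-isometric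 embedding of $\mathbb{Z}^m$ into $(G,d)$, $d$ a maximal continuous left-invariant pseudometric. *)

theory Defs
  imports "HOL-Analysis.Analysis" "HOL-Algebra.Group" "HOL-Library.Extended_Nat"
begin

section \<open>Countable Stone spaces and the Cantor--Bendixson derivative\<close>

definition Stone_space :: "'a topology \<Rightarrow> bool" where
  "Stone_space X \<longleftrightarrow> compact_space X \<and> Hausdorff_space X \<and>
     (\<forall>S. connectedin X S \<longrightarrow> (\<exists>x. S \<subseteq> {x}))"

definition derived_subset :: "'a topology \<Rightarrow> 'a set \<Rightarrow> 'a set" where
  "derived_subset X S = {x \<in> S. \<not> openin (subtopology X S) {x}}"

text \<open>
  An ordinal is an element \<open>\<alpha>\<close> of an arbitrary well-ordered type and stands for the
  order type of \<open>{..<\<alpha>}\<close>. The least element of the type is the ordinal 0.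
\<close>

definition is_succ_of :: "'o::wellorder \<Rightarrow> 'o \<Rightarrow> bool" where
  "is_succ_of \<beta> \<alpha> \<longleftrightarrow> \<beta> < \<alpha> \<and> (\<forall>\<gamma><\<alpha>. \<gamma> \<le> \<beta>)"

definition successor_ordinal :: "'o::wellorder \<Rightarrow> bool" where
  "successor_ordinal \<alpha> \<longleftrightarrow> (\<exists>\<beta>. is_succ_of \<beta> \<alpha>)"

lemma is_succ_of_the:
  assumes "is_succ_of \<beta> \<alpha>"
  shows "(THE \<beta>. is_succ_of \<beta> \<alpha>) = \<beta>"
  using assms by (intro the_equality) (auto simp: is_succ_of_def intro: antisym)

function cb_derivative :: "'a topology \<Rightarrow> 'o::wellorder \<Rightarrow> 'a set" where
  "cb_derivative X \<alpha> =
     (if \<forall>\<beta>. \<alpha> \<le> \<beta> then topspace X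
      else if successor_ordinal \<alpha>
        then derived_subset X (cb_derivative X (THE \<beta>. is_succ_of \<beta> \<alpha>))
      else (\<Inter>\<beta>\<in>{..<\<alpha>}. cb_derivative X \<beta>))"
  by auto
termination
proof (relation "inv_image {(x, y). x < y} snd", goal_cases)
  case 1
  show ?case by (intro wf_inv_image wellorder_class.wf)
next
  case (2 X \<alpha>)
  then show ?case by (auto simp: successor_ordinal_def is_succ_of_the) (simp add: is_succ_of_def)
next
  case (3 X \<alpha> \<beta>)
  then show ?case by simp
qed

declare cb_derivative.simps [simp del]

lemma cb_derivative_zero:
  "(\<And>\<beta>. \<alpha> \<le> \<beta>) \<Longrightarrow> cb_derivative X \<alpha> = topspace X"
  by (simp add: cb_derivative.simps)

lemma cb_derivative_succ:
  assumes "is_succ_of \<beta> \<alpha>"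
  shows "cb_derivative X \<alpha> = derived_subset X (cb_derivative X \<beta>)"
proof -
  have "\<not> (\<forall>\<beta>. \<alpha> \<le> \<beta>)" "successor_ordinal \<alpha>"
    using assms by (auto simp: is_succ_of_def successor_ordinal_def not_le)
  then show ?thesis
    by (simp only: cb_derivative.simps [of X \<alpha>] if_False if_True is_succ_of_the [OF assms])
qed

lemma cb_derivative_limit:
  assumes "\<beta> < \<alpha>" "\<not> successor_ordinal \<alpha>"
  shows "cb_derivative X \<alpha> = (\<Inter>\<beta>\<in>{..<\<alpha>}. cb_derivative X \<beta>)"
proof -
  have "\<not> (\<forall>\<beta>. \<alpha> \<le> \<beta>)"
    using assms by (auto simp: not_le)
  then show ?thesis
    using assms by (simp only: cb_derivative.simps [of X \<alpha>] if_False)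
qed

text \<open>
  The spaces \<open>X\<^sub>\<alpha>\<^sub>,\<^sub>n\<close> are treated up to homeomorphism: \<open>X\<close> is one of them if it is a
  countable Stone space whose \<open>\<alpha>\<close>-th derivative has exactly \<open>n\<close> points.
\<close>

definition countable_Stone_space_type :: "'a topology \<Rightarrow> 'o::wellorder \<Rightarrow> nat \<Rightarrow> bool" where
  "countable_Stone_space_type X \<alpha> n \<longleftrightarrow>
     Stone_space X \<and> countable (topspace X) \<and>
     finite (cb_derivative X \<alpha>) \<and> card (cb_derivative X \<alpha>) = n"


section \<open>The homeomorphism group with the compact-open topology\<close>

text \<open>
  Homeomorphisms are taken to be \<open>undefined\<close> outside \<open>topspace X\<close>, so that each self-homeomorphism
  of the space is represented by exactly one function on the type.
\<close>

definition Homeo :: "'a topology \<Rightarrow> ('a \<Rightarrow> 'a) monoid" where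
  "Homeo X = \<lparr>carrier = {f \<in> extensional (topspace X). homeomorphic_map X X f},
              mult = (\<lambda>f g. compose (topspace X) f g),
              one = (\<lambda>x\<in>topspace X. x)\<rparr>"

definition compact_open_topology ::
    "'a topology \<Rightarrow> 'b topology \<Rightarrow> ('a \<Rightarrow> 'b) set \<Rightarrow> ('a \<Rightarrow> 'b) topology" where
  "compact_open_topology X Y F =
     topology_generated_by {{f \<in> F. f ` K \<subseteq> U} | K U. compactin X K \<and> openin Y U}"

abbreviation Homeo_topology :: "'a topology \<Rightarrow> ('a \<Rightarrow> 'a) topology" where
  "Homeo_topology X \<equiv> compact_open_topology X X (carrier (Homeo X))"


section \<open>The left-coarse structure of a topological group\<close>

text \<open>A topological group is given by a group \<open>G\<close> and a topology \<open>T\<close> on its carrier.\<close>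

definition cont_left_inv_pseudometric ::
    "('g, 'r) monoid_scheme \<Rightarrow> 'g topology \<Rightarrow> ('g \<Rightarrow> 'g \<Rightarrow> real) \<Rightarrow> bool" where
  "cont_left_inv_pseudometric G T d \<longleftrightarrow>
     (\<forall>x\<in>carrier G. \<forall>y\<in>carrier G. 0 \<le> d x y) \<and>
     (\<forall>x\<in>carrier G. d x x = 0) \<and>
     (\<forall>x\<in>carrier G. \<forall>y\<in>carrier G. d x y = d y x) \<and>
     (\<forall>x\<in>carrier G. \<forall>y\<in>carrier G. \<forall>z\<in>carrier G. d x z \<le> d x y + d y z) \<and>
     (\<forall>g\<in>carrier G. \<forall>x\<in>carrier G. \<forall>y\<in>carrier G. d (g \<otimes>\<^bsub>G\<^esub> x) (g \<otimes>\<^bsub>G\<^esub> y) = d x y) \<and>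
     continuous_map (prod_topology T T) euclideanreal (\<lambda>(x, y). d x y)"

definition group_entourages ::
    "('g, 'r) monoid_scheme \<Rightarrow> 'g topology \<Rightarrow> ('g \<times> 'g) set set" where
  "group_entourages G T =
     {E. E \<subseteq> carrier G \<times> carrier G \<and>
         (\<forall>d. cont_left_inv_pseudometric G T d \<longrightarrow> bdd_above ((\<lambda>(g, h). d g h) ` E))}"


section \<open>Asymptotic dimension of a coarse space\<close>

text \<open>
  For every entourage \<open>E\<close> there is a uniformly bounded cover that splits into \<open>n + 1\<close>
  families \<open>\<U> 0, \<dots>, \<U> n\<close>, each of which consists of pairwise \<open>E\<close>-disjoint sets.
\<close>

definition asdim_le :: "'g set \<Rightarrow> ('g \<times> 'g) set set \<Rightarrow> nat \<Rightarrow> bool" where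
  "asdim_le Z \<E> n \<longleftrightarrow>
     (\<forall>E\<in>\<E>. \<exists>\<U> :: nat \<Rightarrow> 'g set set.
        (\<Union>i\<le>n. \<Union>(\<U> i)) = Z \<and>
        (\<Union>i\<le>n. \<Union>U\<in>\<U> i. U \<times> U) \<in> \<E> \<and>
        (\<forall>i\<le>n. \<forall>U\<in>\<U> i. \<forall>V\<in>\<U> i. U \<noteq> V \<longrightarrow> (U \<times> V) \<inter> E = {}))"

text \<open>The infimum of the empty set is \<open>\<infinity>\<close>.\<close>

definition asdim :: "'g set \<Rightarrow> ('g \<times> 'g) set set \<Rightarrow> enat" where
  "asdim Z \<E> = Inf {enat n | n. asdim_le Z \<E> n}"

definition group_asdim :: "('g, 'r) monoid_scheme \<Rightarrow> 'g topology \<Rightarrow> enat" where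
  "group_asdim G T = asdim (carrier G) (group_entourages G T)"


section \<open>Coarse rank\<close>

definition maximal_pseudometric ::
    "('g, 'r) monoid_scheme \<Rightarrow> 'g topology \<Rightarrow> ('g \<Rightarrow> 'g \<Rightarrow> real) \<Rightarrow> bool" where
  "maximal_pseudometric G T d \<longleftrightarrow>
     cont_left_inv_pseudometric G T d \<and>
     (\<forall>d'. cont_left_inv_pseudometric G T d' \<longrightarrow>
        (\<exists>K C. \<forall>x\<in>carrier G. \<forall>y\<in>carrier G. d' x y \<le> K * d x y + C))"

definition quasi_isometric_embedding ::
    "'a set \<Rightarrow> ('a \<Rightarrow> 'a \<Rightarrow> real) \<Rightarrow> 'b set \<Rightarrow> ('b \<Rightarrow> 'b \<Rightarrow> real) \<Rightarrow> ('a \<Rightarrow> 'b) \<Rightarrow> bool" where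
  "quasi_isometric_embedding A dA B dB \<phi> \<longleftrightarrow>
     \<phi> \<in> A \<rightarrow> B \<and>
     (\<exists>K\<ge>1. \<exists>C\<ge>0. \<forall>x\<in>A. \<forall>y\<in>A.
        dA x y / K - C \<le> dB (\<phi> x) (\<phi> y) \<and> dB (\<phi> x) (\<phi> y) \<le> K * dA x y + C)"

text \<open>
  The group \<open>\<int>\<^sup>m\<close>, as functions supported on the index set \<open>{..<m}\<close>, with its word metric for
  the standard basis.
\<close>

definition int_lattice :: "nat \<Rightarrow> (nat \<Rightarrow> int) set" where
  "int_lattice m = {x. \<forall>i\<ge>m. x i = 0}"

definition int_lattice_dist :: "nat \<Rightarrow> (nat \<Rightarrow> int) \<Rightarrow> (nat \<Rightarrow> int) \<Rightarrow> real" where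
  "int_lattice_dist m x y = real_of_int (\<Sum>i<m. \<bar>x i - y i\<bar>)"

text \<open>
  Maximal pseudometrics on \<open>G\<close> are pairwise quasi-isometric via the identity, so it does not
  matter which one is chosen. The existence of one is part of this definition.
\<close>

definition infinite_coarse_rank :: "('g, 'r) monoid_scheme \<Rightarrow> 'g topology \<Rightarrow> bool" where
  "infinite_coarse_rank G T \<longleftrightarrow>
     (\<exists>d. maximal_pseudometric G T d \<and>
        (\<forall>m\<ge>1. \<exists>\<phi>. quasi_isometric_embedding
           (int_lattice m) (int_lattice_dist m) (carrier G) d \<phi>))"

end

theory Submission
  imports Defs
begin

text \<open>
  Write \<open>T\<close> for the finite set of points of maximal Cantor--Bendixson rank \<open>\<alpha>\<close> and consider the locally
  constant retractions \<open>X \<rightarrow> T\<close>. Two clopen sets with a unique point of maximal rank are homeomorphic if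
  these ranks agree, so the group acts transitively on retractions, and the stabiliser of
  a fixed one, \<open>base\<close>, is bounded for every continuous length function. Hence the group looks coarsely like
  the set of retractions. Moving a clopen set with a unique point of maximal rank \<open>\<gamma>\<close> from one
  fibre to another has a cost that depends only on \<open>\<gamma>\<close> and the fibres; a clopen set of smaller rank
  is moved by moving its union with such a set and then moving the latter back.

  If \<open>\<alpha> = \<beta> + 1\<close>, the distance of two retractions is therefore the number of points of rank \<open>\<beta>\<close> at which
  they differ, up to affine bounds. With at least two points in \<open>T\<close> this is a Hamming metric on an infinite cube,
  which contains every \<open>\<int>\<^sup>m\<close>. If \<open>\<alpha>\<close> is a limit, the retractions that differ
  from \<open>base\<close> only in rank below a fixed \<open>\<gamma> < \<alpha>\<close> correspond to a bounded open subgroup, and the group is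
  an increasing union of these subgroups.
\<close>

subsection \<open>Clopen subsets of countable compact Hausdorff spaces\<close>

text \<open>A retraction amounts to a partition of X into clopen fibres with one point of T in each,
  and \<open>g\<close> acts on it by conjugation. The obstacle is that continuity controls a length
  function only near the identity, namely on fibre-preserving homeomorphisms that fix some clopen
  set disjoint from T; all other bounds must come from homogeneity. Its source is that a cone, a
  clopen neighbourhood of a point in which all other points have smaller rank, is determined up to
  homeomorphism by the rank of its apex. So fibres are interchangeable, remain so after small sets
  are removed, and the moves of cones of one rank form finitely many orbits. Sets of rank below
  \<gamma> have no such normal form, and there can be infinitely many types of them; but the union
  of such a set with a disjoint cone of rank \<gamma> is again a cone of rank \<gamma>, so one
  constant pays for all of them. Lower bounds need no further estimate: the number of points of rank
  \<beta> where \<open>base\<close> and its conjugate differ is itself a continuous length function,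
  hence coarsely the largest one.\<close>

locale countable_compact_space =
  fixes X :: "'a topology"
  assumes compact: "compact_space X" and hausdorff: "Hausdorff_space X"
    and countable: "countable (topspace X)"
begin

definition clopen :: "'a set \<Rightarrow> bool" where
  "clopen A \<longleftrightarrow> openin X A \<and> closedin X A"

lemma clopen_empty [simp]: "clopen {}"
  and clopen_topspace [simp]: "clopen (topspace X)"
  by (auto simp: clopen_def)

lemma clopen_Un [intro]: "clopen A \<Longrightarrow> clopen B \<Longrightarrow> clopen (A \<union> B)"
  and clopen_Int [intro]: "clopen A \<Longrightarrow> clopen B \<Longrightarrow> clopen (A \<inter> B)"
  and clopen_Diff [intro]: "clopen A \<Longrightarrow> clopen B \<Longrightarrow> clopen (A - B)"
  by (auto simp: clopen_def)

lemma clopen_UN: "finite I \<Longrightarrow> (\<And>i. i \<in> I \<Longrightarrow> clopen (A i)) \<Longrightarrow> clopen (\<Union>i\<in>I. A i)"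
  by (induction I rule: finite_induct) auto

lemma clopen_subset: "clopen A \<Longrightarrow> A \<subseteq> topspace X"
  by (simp add: clopen_def openin_subset)

lemma clopen_openin: "clopen A \<Longrightarrow> openin X A"
  and clopen_closedin: "clopen A \<Longrightarrow> closedin X A"
  and clopen_compactin: "clopen A \<Longrightarrow> compactin X A"
  using compact by (auto simp: clopen_def intro: closedin_compact_space)

text \<open>A real function on a countable space misses values arbitrarily close to 0.\<close>

lemma clopen_nbhd:
  assumes "openin X U" "x \<in> U"
  obtains C where "clopen C" "x \<in> C" "C \<subseteq> U"
proof -
  have "completely_regular_space X"
    using compact hausdorff
    by (simp add: compact_Hausdorff_or_regular_imp_normal_space normal_imp_completely_regular_space)
  moreover have "closedin X (topspace X - U)" "x \<in> topspace X - (topspace X - U)"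
    using assms openin_subset by fastforce+
  ultimately obtain f where f: "continuous_map X (top_of_set {0..1::real}) f" "f x = 0"
    "f ` (topspace X - U) \<subseteq> {1}"
    unfolding completely_regular_space_def by (metis image_subset_iff_funcset)
  have "\<not> {0<..<1} \<subseteq> f ` topspace X"
    using countable_subset[OF _ countable_image[OF countable, of f]] uncountable_open_interval[of 0 "1::real"]
    by auto
  then obtain t where t: "0 < t" "t < 1" "t \<notin> f ` topspace X"
    unfolding subset_iff greaterThanLessThan_iff by blast
  have cf: "continuous_map X euclideanreal f"
    using f(1) continuous_map_in_subtopology by blast
  have "openin X {y \<in> topspace X. f y \<in> {..<t}}" "closedin X {y \<in> topspace X. f y \<in> {..t}}"
    by (rule openin_continuous_map_preimage[OF cf] closedin_continuous_map_preimage[OF cf], simp)+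
  moreover have "{y \<in> topspace X. f y \<in> {..t}} = {y \<in> topspace X. f y \<in> {..<t}}"
    using t(3) by force
  ultimately have "clopen {y \<in> topspace X. f y \<in> {..<t}}"
    by (simp add: clopen_def)
  moreover have "x \<in> {y \<in> topspace X. f y \<in> {..<t}}"
    using assms f(2) t(1) openin_subset by fastforce
  moreover have "{y \<in> topspace X. f y \<in> {..<t}} \<subseteq> U"
    using f(3) t(2) by force
  ultimately show thesis
    using that by blast
qed

section \<open>Homeomorphisms between clopen subsets\<close>

text \<open>Only the values on \<open>A\<close> matter, which lets pieces be glued as total
  functions without passing to subtopologies. Continuity of the inverse is not recorded because
  compactness supplies it.\<close>

definition clopen_homeo :: "'a set \<Rightarrow> 'a set \<Rightarrow> ('a \<Rightarrow> 'a) \<Rightarrow> bool" where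
  "clopen_homeo A B h \<longleftrightarrow> clopen A \<and> clopen B \<and> bij_betw h A B \<and>
     (\<forall>U. openin X U \<longrightarrow> openin X {x \<in> A. h x \<in> U})"

lemma clopen_homeoD:
  assumes "clopen_homeo A B h"
  shows "clopen A" "clopen B" "bij_betw h A B" "inj_on h A" "h ` A = B"
    "openin X U \<Longrightarrow> openin X {x \<in> A. h x \<in> U}" "x \<in> A \<Longrightarrow> h x \<in> B"
  using assms by (auto simp: clopen_homeo_def bij_betw_def)

lemma clopen_homeo_cong:
  "clopen_homeo A B h \<Longrightarrow> (\<And>x. x \<in> A \<Longrightarrow> h x = k x) \<Longrightarrow> clopen_homeo A B k"
  unfolding clopen_homeo_def by (simp add: bij_betw_cong[of A h k] cong: conj_cong)

lemma clopen_homeo_ident: "clopen A \<Longrightarrow> clopen_homeo A A (\<lambda>x. x)"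
proof -
  assume A: "clopen A"
  have "openin X {x \<in> A. x \<in> U}" if "openin X U" for U
    using openin_Int[OF clopen_openin[OF A] that] by (simp add: Int_def)
  then show ?thesis
    using A by (auto simp: clopen_homeo_def bij_betw_def)
qed

lemma clopen_homeo_empty: "clopen_homeo {} {} h"
  by (auto simp: clopen_homeo_def bij_betw_def)

text \<open>Images of compact sets are compact, hence closed; from this the inverse is continuous
  and images of clopen sets are clopen.\<close>

lemma clopen_homeo_closed_image:
  assumes h: "clopen_homeo A B h" and C: "closedin X C" "C \<subseteq> A"
  shows "closedin X (h ` C)"
proof -
  note A = clopen_homeoD[OF h]
  have "continuous_map (subtopology X A) X h"
    unfolding continuous_map_def
  proof (intro conjI allI impI)
    show "h \<in> topspace (subtopology X A) \<rightarrow> topspace X"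
      using A(5) clopen_subset[OF A(2)] by auto
    fix U assume "openin X U"
    then have "openin X {x \<in> A. h x \<in> U}" by (rule A(6))
    moreover have "{x \<in> topspace (subtopology X A). h x \<in> U} = {x \<in> A. h x \<in> U}"
      using clopen_subset[OF A(1)] by auto
    ultimately show "openin (subtopology X A) {x \<in> topspace (subtopology X A). h x \<in> U}"
      by (simp add: clopen_openin[OF A(1)] openin_open_subtopology)
  qed
  moreover have "compactin (subtopology X A) C"
    using C compact by (simp add: closedin_compact_space compactin_subtopology)
  ultimately have "compactin X (h ` C)"
    by (rule image_compactin[rotated])
  then show ?thesis
    using hausdorff compactin_imp_closedin by blast
qed

lemma clopen_homeo_image:
  assumes h: "clopen_homeo A B h" and C: "clopen C" "C \<subseteq> A"
  shows "clopen (h ` C)"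
proof -
  note A = clopen_homeoD[OF h]
  have "h ` C = B - h ` (A - C)"
    using A(5) C(2) inj_on_image_set_diff[OF A(4), of A C] inj_on_image_set_diff[OF A(4), of A "A - C"]
    by (simp add: double_diff)
  moreover have "closedin X (h ` (A - C))"
    using clopen_homeo_closed_image[OF h] clopen_Diff[OF A(1) C(1)] clopen_closedin by blast
  ultimately have "openin X (h ` C)"
    using clopen_openin[OF A(2)] by auto
  then show ?thesis
    using clopen_homeo_closed_image[OF h] C clopen_closedin clopen_def by blast
qed

lemma clopen_homeo_inv:
  assumes h: "clopen_homeo A B h"
  shows "clopen_homeo B A (inv_into A h)"
proof -
  note A = clopen_homeoD[OF h]
  have "openin X {y \<in> B. inv_into A h y \<in> U}" if U: "openin X U" for U
  proof -
    have "A - U = A \<inter> (topspace X - U)"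
      using clopen_subset[OF A(1)] by auto
    then have "closedin X (A - U)"
      using U clopen_closedin[OF A(1)] by auto
    then have "closedin X (h ` (A - U))"
      using clopen_homeo_closed_image[OF h] by blast
    moreover have "{y \<in> B. inv_into A h y \<in> U} = B - h ` (A - U)"
      using A(5) inv_into_f_f[OF A(4)] by (auto simp: image_iff)
    ultimately show ?thesis
      using clopen_openin[OF A(2)] by auto
  qed
  then show ?thesis
    using A bij_betw_inv_into[OF A(3)] by (auto simp: clopen_homeo_def)
qed

lemma clopen_homeo_comp:
  assumes h: "clopen_homeo A B h" and k: "clopen_homeo B C k"
  shows "clopen_homeo A C (\<lambda>x. k (h x))"
proof -
  have "openin X {x \<in> A. k (h x) \<in> U}" if U: "openin X U" for U
  proof -
    have "openin X {x \<in> A. h x \<in> {y \<in> B. k y \<in> U}}"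
      using U clopen_homeoD(6)[OF h] clopen_homeoD(6)[OF k] by blast
    moreover have "{x \<in> A. h x \<in> {y \<in> B. k y \<in> U}} = {x \<in> A. k (h x) \<in> U}"
      using clopen_homeoD(7)[OF h] by auto
    ultimately show ?thesis by simp
  qed
  moreover have "bij_betw (\<lambda>x. k (h x)) A C"
    using bij_betw_trans[OF clopen_homeoD(3)[OF h] clopen_homeoD(3)[OF k]] by (simp add: o_def)
  ultimately show ?thesis
    using h k by (auto simp: clopen_homeo_def)
qed

lemma clopen_homeo_restrict:
  assumes h: "clopen_homeo A B h" and C: "clopen C" "C \<subseteq> A"
  shows "clopen_homeo C (h ` C) h"
proof -
  have "openin X {x \<in> C. h x \<in> U}" if U: "openin X U" for U
  proof -
    have "openin X (C \<inter> {x \<in> A. h x \<in> U})"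
      using U clopen_homeoD(6)[OF h] clopen_openin[OF C(1)] by blast
    moreover have "C \<inter> {x \<in> A. h x \<in> U} = {x \<in> C. h x \<in> U}"
      using C(2) by auto
    ultimately show ?thesis by simp
  qed
  then show ?thesis
    using clopen_homeo_image[OF h C] C clopen_homeoD(4)[OF h]
    by (auto simp: clopen_homeo_def bij_betw_def intro: inj_on_subset)
qed

lemma clopen_homeo_Un:
  assumes h: "clopen_homeo A B h" "clopen_homeo C D h" and "A \<inter> C = {}" "B \<inter> D = {}"
  shows "clopen_homeo (A \<union> C) (B \<union> D) h"
proof -
  have "openin X {x \<in> A \<union> C. h x \<in> U}" if U: "openin X U" for U
  proof -
    have "{x \<in> A \<union> C. h x \<in> U} = {x \<in> A. h x \<in> U} \<union> {x \<in> C. h x \<in> U}" by auto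
    then show ?thesis
      using U clopen_homeoD(6)[OF h(1)] clopen_homeoD(6)[OF h(2)] by auto
  qed
  then show ?thesis
    using h bij_betw_combine[OF clopen_homeoD(3)[OF h(1)] clopen_homeoD(3)[OF h(2)]] assms(4)
    by (auto simp: clopen_homeo_def)
qed

lemma clopen_homeo_Un':
  assumes h: "clopen_homeo A B h" "clopen_homeo C D k" and "A \<inter> C = {}" "B \<inter> D = {}"
  shows "clopen_homeo (A \<union> C) (B \<union> D) (\<lambda>x. if x \<in> C then k x else h x)"
proof (rule clopen_homeo_Un)
  show "clopen_homeo A B (\<lambda>x. if x \<in> C then k x else h x)"
    by (rule clopen_homeo_cong[OF h(1)]) (use assms(3) in auto)
  show "clopen_homeo C D (\<lambda>x. if x \<in> C then k x else h x)"
    by (rule clopen_homeo_cong[OF h(2)]) auto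
qed (use assms in auto)

text \<open>The label of \<open>g x\<close> tells from which piece \<open>x\<close> comes, so
  bijections of the level sets fit together; an open preimage is the union of its traces on the
  pieces. Labels in a product type match several partitions at once.\<close>

lemma clopen_homeo_glue:
  assumes "\<And>l. \<exists>h. clopen_homeo {x \<in> topspace X. f1 x = l} {x \<in> topspace X. f2 x = l} h"
  obtains g where "clopen_homeo (topspace X) (topspace X) g"
    "\<And>x. x \<in> topspace X \<Longrightarrow> f2 (g x) = f1 x"
proof -
  obtain h where h:
    "\<And>l. clopen_homeo {x \<in> topspace X. f1 x = l} {x \<in> topspace X. f2 x = l} (h l)"
    using assms by metis
  define g where "g x = h (f1 x) x" for x
  have g: "clopen_homeo {x \<in> topspace X. f1 x = l} {x \<in> topspace X. f2 x = l} g" for l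
    by (rule clopen_homeo_cong[OF h]) (auto simp: g_def)
  have f: "g x \<in> topspace X" "f2 (g x) = f1 x" if "x \<in> topspace X" for x
    using clopen_homeoD(7)[OF g[of "f1 x"]] that by auto
  have "inj_on g (topspace X)"
  proof
    fix x y assume xy: "x \<in> topspace X" "y \<in> topspace X" "g x = g y"
    then have "f1 x = f1 y" using f by metis
    then show "x = y"
      using inj_onD[OF clopen_homeoD(4)[OF g[of "f1 x"]]] xy by auto
  qed
  moreover have "topspace X \<subseteq> g ` topspace X"
    using clopen_homeoD(5)[OF g] by blast
  ultimately have "bij_betw g (topspace X) (topspace X)"
    using f by (auto simp: bij_betw_def)
  moreover have "openin X {x \<in> topspace X. g x \<in> U}" if "openin X U" for U
  proof -
    have "{x \<in> topspace X. g x \<in> U} = (\<Union>l. {x \<in> {x \<in> topspace X. f1 x = l}. g x \<in> U})"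
      by auto
    then show ?thesis
      using clopen_homeoD(6)[OF g that] by auto
  qed
  ultimately have "clopen_homeo (topspace X) (topspace X) g"
    by (auto simp: clopen_homeo_def)
  then show thesis using f that by blast
qed

end

subsection \<open>Ranked spaces\<close>

text \<open>
  The rank of a point is the largest \<open>\<gamma> \<le> \<alpha>\<close> such that the point lies in the \<open>\<gamma>\<close>-th derivative.
\<close>

locale ranked_space = countable_compact_space X
  for X :: "'a topology" +
  fixes rk :: "'a \<Rightarrow> 'o::wellorder" and \<alpha> :: 'o
  assumes rk_le: "x \<in> topspace X \<Longrightarrow> rk x \<le> \<alpha>"
    and rk_nbhd: "x \<in> topspace X \<Longrightarrow> \<exists>U. openin X U \<and> x \<in> U \<and> (\<forall>y\<in>U - {x}. rk y < rk x)"
    and rk_attained: "openin X U \<Longrightarrow> x \<in> U \<Longrightarrow> \<gamma> < rk x \<Longrightarrow> \<exists>y\<in>U. rk y = \<gamma>"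
    and top_ex: "\<exists>x\<in>topspace X. rk x = \<alpha>"
begin

text \<open>Up to homeomorphism this is the ordinal space \<open>\<omega>\<^sup>\<gamma> + 1\<close>
  with last point \<open>c\<close>, where \<gamma> is the rank of \<open>c\<close>.\<close>

definition cone :: "'a set \<Rightarrow> 'a \<Rightarrow> bool" where
  "cone C c \<longleftrightarrow> clopen C \<and> c \<in> C \<and> (\<forall>y\<in>C - {c}. rk y < rk c)"

lemma coneD:
  assumes "cone C c"
  shows "clopen C" "c \<in> C" "y \<in> C \<Longrightarrow> y \<noteq> c \<Longrightarrow> rk y < rk c" "y \<in> C \<Longrightarrow> rk y \<le> rk c"
  using assms by (auto simp: cone_def le_less)

lemma cone_subset: "cone C c \<Longrightarrow> clopen D \<Longrightarrow> c \<in> D \<Longrightarrow> D \<subseteq> C \<Longrightarrow> cone D c"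
  by (auto simp: cone_def)

lemma cone_ex:
  assumes "openin X U" "x \<in> U"
  obtains C where "cone C x" "C \<subseteq> U"
proof -
  have "x \<in> topspace X"
    using assms openin_subset by blast
  then obtain V where V: "openin X V" "x \<in> V" "\<forall>y\<in>V - {x}. rk y < rk x"
    using rk_nbhd by blast
  obtain C where "clopen C" "x \<in> C" "C \<subseteq> U \<inter> V"
    by (rule clopen_nbhd[of "U \<inter> V" x]) (use assms V in auto)
  then show thesis
    using that[of C] V(3) by (auto simp: cone_def)
qed

text \<open>\<open>F\<close> consists of the apexes of a finite subcover by cones. Since every other
  point lies strictly below some apex, the maximal rank is attained, and only at points of
  \<open>F\<close>.\<close>

lemma finite_cone_cover:
  assumes A: "clopen A"
  obtains F where "finite F" "F \<subseteq> A" "\<And>y. y \<in> A \<Longrightarrow> y \<in> F \<or> (\<exists>x\<in>F. rk y < rk x)"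
proof -
  have "\<exists>C. cone C x" if "x \<in> A" for x
    using cone_ex[OF clopen_openin[OF A] that] by blast
  then obtain C where C: "\<And>x. x \<in> A \<Longrightarrow> cone (C x) x"
    by metis
  have "\<exists>\<F>. finite \<F> \<and> \<F> \<subseteq> C ` A \<and> A \<subseteq> \<Union>\<F>"
  proof (rule compactinD[OF clopen_compactin[OF A]])
    show "openin X U" if "U \<in> C ` A" for U
      using that C clopen_openin coneD(1) by blast
    show "A \<subseteq> \<Union>(C ` A)"
      using C coneD(2) by blast
  qed
  then obtain F where "finite F" "F \<subseteq> A" "A \<subseteq> \<Union>(C ` F)"
    by (metis finite_subset_image)
  moreover have "y \<in> F \<or> (\<exists>x\<in>F. rk y < rk x)" if "y \<in> A" for y
    using calculation that C coneD(3) by (metis UN_E subsetD)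
  ultimately show thesis
    using that by blast
qed

lemma max_rank_ex:
  assumes "clopen A" "A \<noteq> {}"
  obtains a where "a \<in> A" "\<And>y. y \<in> A \<Longrightarrow> rk y \<le> rk a"
proof -
  obtain F where F: "finite F" "F \<subseteq> A" "\<And>y. y \<in> A \<Longrightarrow> y \<in> F \<or> (\<exists>x\<in>F. rk y < rk x)"
    using finite_cone_cover[OF assms(1)] by blast
  have "F \<noteq> {}"
    using assms(2) F(3) by blast
  then have "Max (rk ` F) \<in> rk ` F"
    using F(1) by simp
  then obtain a where a: "a \<in> F" "rk a = Max (rk ` F)"
    by force
  then have "rk x \<le> rk a" if "x \<in> F" for x
    using F(1) that by simp
  then show thesis
    using that[of a] a(1) F(2,3) by (meson less_imp_le order_trans subsetD)
qed

lemma finite_max_rank: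
  assumes "clopen A" "\<And>y. y \<in> A \<Longrightarrow> rk y \<le> \<gamma>"
  shows "finite {y \<in> A. rk y = \<gamma>}"
proof -
  obtain F where F: "finite F" "F \<subseteq> A" "\<And>y. y \<in> A \<Longrightarrow> y \<in> F \<or> (\<exists>x\<in>F. rk y < rk x)"
    using finite_cone_cover[OF assms(1)] by blast
  have "{y \<in> A. rk y = \<gamma>} \<subseteq> F"
    using F(2,3) assms(2) by (force simp: subset_iff leD)
  then show ?thesis
    using F(1) finite_subset by blast
qed

text \<open>
  Induction on the pair consisting of the maximal rank and the number of points of that rank.
\<close>

lemma clopen_induct [consumes 1, case_names step]:
  assumes A: "clopen A"
    and step: "\<And>A. clopen A \<Longrightarrow>
      (\<And>C a. cone C a \<Longrightarrow> C \<subseteq> A \<Longrightarrow> (\<forall>y\<in>A. rk y \<le> rk a) \<Longrightarrow> P (A - C)) \<Longrightarrow> P A"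
  shows "P A"
proof -
  have "\<forall>A. clopen A \<longrightarrow> (\<forall>y\<in>A. rk y \<le> \<gamma>) \<longrightarrow> P A" for \<gamma>
  proof (induction \<gamma> rule: less_induct)
    case (less \<gamma>)
    have "P A" if "clopen A" "\<forall>y\<in>A. rk y \<le> \<gamma>" for A
      using that
    proof (induction "card {y \<in> A. rk y = \<gamma>}" arbitrary: A rule: less_induct)
      case (less A)
      show ?case
      proof (rule step[OF less.prems(1)])
        fix C a
        assume C: "cone C a" "C \<subseteq> A" and m: "\<forall>y\<in>A. rk y \<le> rk a"
        have a: "a \<in> A" using C coneD by blast
        have AC: "clopen (A - C)" using less.prems(1) C coneD by blast
        show "P (A - C)"
        proof (cases "rk a = \<gamma>")
          case True
          have "{y \<in> A - C. rk y = \<gamma>} \<subset> {y \<in> A. rk y = \<gamma>}"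
            using True a coneD(2)[OF C(1)] by auto
          then have "card {y \<in> A - C. rk y = \<gamma>} < card {y \<in> A. rk y = \<gamma>}"
            using finite_max_rank less.prems psubset_card_mono by metis
          then show ?thesis
            using less.hyps AC less.prems(2) by blast
        next
          case False
          then have "rk a < \<gamma>"
            using less.prems(2) a by fastforce
          then show ?thesis
            using \<open>\<And>y. y < \<gamma> \<Longrightarrow> \<forall>A. clopen A \<longrightarrow> (\<forall>z\<in>A. rk z \<le> y) \<longrightarrow> P A\<close> AC m by blast
        qed
      qed
    qed
    then show ?case by blast
  qed
  then show ?thesis
    using A rk_le clopen_subset by blast
qed

section \<open>Classification of cones by the rank of the apex\<close>

text \<open>The induction hypothesis of \<open>cone_homeo\<close>, isolated so that the embedding
  and extension steps can be stated on their own.\<close>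

definition cones_homeo_below :: "'o \<Rightarrow> bool" where
  "cones_homeo_below \<gamma> \<longleftrightarrow> (\<forall>C c D d. cone C c \<longrightarrow> cone D d \<longrightarrow> rk c = rk d \<longrightarrow> rk c < \<gamma> \<longrightarrow>
     (\<exists>h. clopen_homeo C D h))"

text \<open>\<open>A\<close> is cut into cones, which are placed one after another. There is always
  room: the part of \<open>B\<close> already used is clopen and misses \<open>b\<close>, so the rest
  is an open neighbourhood of \<open>b\<close> and contains points of every rank below
  \<gamma>.\<close>

lemma clopen_embed:
  assumes IH: "cones_homeo_below \<gamma>"
    and A: "clopen A" "\<forall>y\<in>A. rk y < \<gamma>"
    and B: "openin X B" "b \<in> B" "rk b = \<gamma>"
  shows "\<exists>A' h. A' \<subseteq> B - {b} \<and> clopen_homeo A A' h"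
  using A
proof (induction A rule: clopen_induct)
  case (step A)
  show ?case
  proof (cases "A = {}")
    case True
    then show ?thesis using clopen_homeo_empty by blast
  next
    case False
    then obtain a where a: "a \<in> A" "\<And>y. y \<in> A \<Longrightarrow> rk y \<le> rk a"
      using max_rank_ex step(1) by metis
    obtain C where C: "cone C a" "C \<subseteq> A"
      using cone_ex a(1) clopen_openin step(1) by metis
    obtain A1 h1 where h1: "A1 \<subseteq> B - {b}" "clopen_homeo (A - C) A1 h1"
      using step(2)[OF C] a(2) step(3) by blast
    have op: "openin X (B - A1)"
      using B(1) clopen_homeoD(2)[OF h1(2)] clopen_closedin by auto
    obtain y where y: "y \<in> B - A1" "rk y = rk a"
      using rk_attained[OF op, of b "rk a"] B(2,3) bspec[OF step(3) a(1)] h1(1) by auto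
    have "closedin X {b}"
      using hausdorff B(1,2) openin_subset[OF B(1)] by (auto simp: closedin_Hausdorff_singleton)
    then have op': "openin X (B - A1 - {b})"
      using op by blast
    have "y \<in> B - A1 - {b}"
      using y bspec[OF step(3) a(1)] B(3) by auto
    then obtain D where D: "cone D y" "D \<subseteq> B - A1 - {b}"
      using cone_ex[OF op'] by blast
    obtain h2 where h2: "clopen_homeo C D h2"
      using IH C(1) D(1) y(2) bspec[OF step(3) a(1)] unfolding cones_homeo_below_def by metis
    have "clopen_homeo ((A - C) \<union> C) (A1 \<union> D) (\<lambda>x. if x \<in> C then h2 x else h1 x)"
      by (rule clopen_homeo_Un'[OF h1(2) h2]) (use D in auto)
    moreover have "(A - C) \<union> C = A"
      using C(2) by auto
    moreover have "A1 \<union> D \<subseteq> B - {b}"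
      using h1(1) D(2) by auto
    ultimately show ?thesis by metis
  qed
qed

text \<open>
  Back and forth: finite stages are homeomorphisms between clopen sets that miss the apexes, and they
  are extended alternately on both sides.
\<close>

lemma cone_homeo_step:
  assumes IH: "cones_homeo_below \<gamma>"
    and AB: "cone A a" "cone B b" "rk a = \<gamma>" "rk b = \<gamma>"
    and h: "clopen_homeo A1 B1 h" "A1 \<subseteq> A - {a}" "B1 \<subseteq> B - {b}" and x: "x \<in> A - {a}"
  shows "\<exists>A2 B2 k. clopen_homeo A2 B2 k \<and> A2 \<subseteq> A - {a} \<and> B2 \<subseteq> B - {b} \<and> x \<in> A2 \<and>
    A1 \<subseteq> A2 \<and> B1 \<subseteq> B2 \<and> (\<forall>y\<in>A1. k y = h y)"
proof -
  have "rk x < \<gamma>"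
    using AB coneD(3)[OF AB(1)] x by auto
  obtain C where C: "cone C x" "C \<subseteq> A"
    using cone_ex clopen_openin[OF coneD(1)[OF AB(1)]] x by (metis DiffD1)
  have rC: "rk y < \<gamma>" if "y \<in> C" for y
    using coneD(4)[OF C(1) that] \<open>rk x < \<gamma>\<close> by simp
  then have rC': "\<forall>y\<in>C - A1. rk y < \<gamma>" by simp
  have aC: "a \<notin> C" using rC AB(3) by auto
  have cC: "clopen (C - A1)"
    using coneD(1)[OF C(1)] clopen_homeoD(1)[OF h(1)] by blast
  have op: "openin X (B - B1)"
    using coneD(1)[OF AB(2)] clopen_homeoD(2)[OF h(1)] clopen_openin by blast
  have b: "b \<in> B - B1"
    using coneD(2)[OF AB(2)] h(3) by auto
  obtain D k where D: "D \<subseteq> B - B1 - {b}" "clopen_homeo (C - A1) D k"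
    using clopen_embed[OF IH cC rC' op b AB(4)] by blast
  have "clopen_homeo (A1 \<union> (C - A1)) (B1 \<union> D) (\<lambda>x. if x \<in> C - A1 then k x else h x)"
    by (rule clopen_homeo_Un'[OF h(1) D(2)]) (use D in auto)
  moreover have "A1 \<union> (C - A1) \<subseteq> A - {a}" "B1 \<union> D \<subseteq> B - {b}" "x \<in> A1 \<union> (C - A1)"
    using h C(2) aC D(1) coneD(2)[OF C(1)] by auto
  ultimately show ?thesis
    by (intro exI[of _ "A1 \<union> (C - A1)"] exI[of _ "B1 \<union> D"]
        exI[of _ "\<lambda>x. if x \<in> C - A1 then k x else h x"]) auto
qed

text \<open>The backward half, by applying the forward half to the inverse.\<close>

lemma cone_homeo_step':
  assumes IH: "cones_homeo_below \<gamma>"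
    and AB: "cone A a" "cone B b" "rk a = \<gamma>" "rk b = \<gamma>"
    and h: "clopen_homeo A1 B1 h" "A1 \<subseteq> A - {a}" "B1 \<subseteq> B - {b}" and x: "x \<in> B - {b}"
  shows "\<exists>A2 B2 k. clopen_homeo A2 B2 k \<and> A2 \<subseteq> A - {a} \<and> B2 \<subseteq> B - {b} \<and> x \<in> B2 \<and>
    A1 \<subseteq> A2 \<and> B1 \<subseteq> B2 \<and> (\<forall>y\<in>A1. k y = h y)"
proof -
  obtain A2 B2 k where k: "clopen_homeo B2 A2 k" "A2 \<subseteq> A - {a}" "B2 \<subseteq> B - {b}" "x \<in> B2"
    "A1 \<subseteq> A2" "B1 \<subseteq> B2" "\<forall>y\<in>B1. k y = inv_into A1 h y"
    using cone_homeo_step[OF IH AB(2,1,4,3) clopen_homeo_inv[OF h(1)] h(3,2) x] by blast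
  have "inv_into B2 k y = h y" if y: "y \<in> A1" for y
  proof -
    have hy: "h y \<in> B1" using clopen_homeoD(7)[OF h(1) y] .
    then have "k (h y) = y"
      using k(7) y clopen_homeoD(4)[OF h(1)] by auto
    then show ?thesis
      using clopen_homeoD(4)[OF k(1)] hy k(6) by (metis inv_into_f_f subsetD)
  qed
  then show ?thesis
    using clopen_homeo_inv[OF k(1)] k by blast
qed

text \<open>The stages cover everything except the apexes, and sending \<open>a\<close> to
  \<open>b\<close> completes their union. Only continuity at \<open>a\<close> needs an argument: the
  complement in \<open>B\<close> of a neighbourhood \<open>U\<close> of \<open>b\<close> is compact,
  so a single stage \<open>Bs N\<close> contains it, and all points of \<open>A\<close> outside
  \<open>As N\<close> are sent into \<open>U\<close>.\<close>

lemma cone_homeo_limit: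
  assumes AB: "cone A a" "cone B b"
    and h: "\<And>n. clopen_homeo (As n) (Bs n) (h n)" "\<And>n. As n \<subseteq> A - {a}" "\<And>n. Bs n \<subseteq> B - {b}"
      "\<And>n. As n \<subseteq> As (Suc n)" "\<And>n. Bs n \<subseteq> Bs (Suc n)" "\<And>n x. x \<in> As n \<Longrightarrow> h (Suc n) x = h n x"
    and exh: "A - {a} \<subseteq> (\<Union>n. As n)" "B - {b} \<subseteq> (\<Union>n. Bs n)"
  shows "\<exists>h. clopen_homeo A B h"
proof -
  have monoA: "As m \<subseteq> As n" and monoB: "Bs m \<subseteq> Bs n" if "m \<le> n" for m n
    using that lift_Suc_mono_le[of As, OF h(4)] lift_Suc_mono_le[of Bs, OF h(5)] by simp_all
  have hh: "h n x = h m x" if "m \<le> n" "x \<in> As m" for m n x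
    using that
  proof (induction n rule: dec_induct)
    case (step n)
    then have "x \<in> As n" using monoA by blast
    then show ?case using h(6) step by simp
  qed simp
  define k where "k x = (if x = a then b else h (LEAST n. x \<in> As n) x)" for x
  have k: "k x = h n x" if "x \<in> As n" for n x
  proof -
    have "x \<noteq> a" using that h(2) by auto
    moreover have "x \<in> As (LEAST n. x \<in> As n)" using that by (rule LeastI)
    moreover have "(LEAST n. x \<in> As n) \<le> n" using that by (rule Least_le)
    ultimately show ?thesis using hh by (auto simp: k_def)
  qed
  have ka: "k a = b" by (simp add: k_def)
  have kA: "k x \<in> B - {b}" if x: "x \<in> A - {a}" for x
  proof -
    obtain n where "x \<in> As n" using x exh(1) by blast
    then show ?thesis using k[of x n] clopen_homeoD(7)[OF h(1), of x n] h(3)[of n] by auto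
  qed
  have "inj_on k (A - {a})"
  proof
    fix x y assume xy: "x \<in> A - {a}" "y \<in> A - {a}" "k x = k y"
    obtain m n where "x \<in> As m" "y \<in> As n"
      using xy exh(1) by (metis UN_E subsetD)
    then have "x \<in> As (max m n)" "y \<in> As (max m n)"
      using monoA[of m "max m n"] monoA[of n "max m n"] by auto
    then show "x = y"
      using xy(3) k clopen_homeoD(4)[OF h(1)] by (metis inj_onD)
  qed
  moreover have "k a \<notin> k ` (A - {a})"
    using kA ka by force
  ultimately have inj: "inj_on k A"
    using coneD(2)[OF AB(1)] inj_on_insert[of k a "A - {a}"] by (simp add: insert_absorb)
  have "B - {b} \<subseteq> k ` A"
  proof
    fix y assume "y \<in> B - {b}"
    then obtain n where "y \<in> Bs n" using exh(2) by blast
    then obtain x where x: "x \<in> As n" "h n x = y"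
      unfolding clopen_homeoD(5)[OF h(1)[of n], symmetric] by auto
    then have "k x = y" "x \<in> A"
      using k[OF x(1)] h(2)[of n] by auto
    then show "y \<in> k ` A" by blast
  qed
  then have bij: "bij_betw k A B"
    unfolding bij_betw_def
  proof (intro conjI equalityI subsetI)
    show "y \<in> B" if "y \<in> k ` A" for y
      using that kA ka coneD(2)[OF AB(2)] by (metis Diff_iff imageE singletonD)
    show "y \<in> k ` A" if "y \<in> B" for y
      using that \<open>B - {b} \<subseteq> k ` A\<close> ka coneD(2)[OF AB(1)] by (cases "y = b") auto
  qed (rule inj)
  have "openin X {x \<in> A. k x \<in> U}" if U: "openin X U" for U
  proof (cases "b \<in> U")
    case False
    have "{x \<in> A. k x \<in> U} = (\<Union>n. {x \<in> As n. h n x \<in> U})"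
    proof (intro equalityI subsetI)
      fix x assume x: "x \<in> {x \<in> A. k x \<in> U}"
      then have "x \<in> A - {a}"
        using False ka by auto
      then obtain n where "x \<in> As n"
        using exh(1) by blast
      then show "x \<in> (\<Union>n. {x \<in> As n. h n x \<in> U})"
        using x k[of x n] by auto
    next
      fix x assume "x \<in> (\<Union>n. {x \<in> As n. h n x \<in> U})"
      then obtain n where "x \<in> As n" "h n x \<in> U" by blast
      then show "x \<in> {x \<in> A. k x \<in> U}"
        using k[of x n] h(2)[of n] by auto
    qed
    then show ?thesis
      using clopen_homeoD(6)[OF h(1) U] by auto
  next
    case True
    have "B - U = B \<inter> (topspace X - U)"
      using clopen_subset[OF coneD(1)[OF AB(2)]] by auto
    then have cl: "closedin X (B - U)"
      using U clopen_closedin[OF coneD(1)[OF AB(2)]] by auto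
    have "\<exists>\<F>. finite \<F> \<and> \<F> \<subseteq> range Bs \<and> B - U \<subseteq> \<Union>\<F>"
    proof (rule compactinD[OF closedin_compact_space[OF compact cl]])
      show "openin X V" if "V \<in> range Bs" for V
        using that clopen_homeoD(2)[OF h(1)] clopen_openin by blast
      show "B - U \<subseteq> \<Union>(range Bs)"
        using exh(2) True by auto
    qed
    then obtain F where F: "finite F" "B - U \<subseteq> \<Union>(Bs ` F)"
      by (metis finite_subset_image)
    obtain N where N: "\<And>n. n \<in> F \<Longrightarrow> n \<le> N"
      using F(1) finite_nat_set_iff_bounded_le by auto
    then have sub: "B - U \<subseteq> Bs N"
      using F(2) monoB by blast
    have "{x \<in> A. k x \<in> U} = (A - As N) \<union> {x \<in> As N. h N x \<in> U}"
    proof -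
      have "k x \<in> U" if "x \<in> A - As N" for x
      proof (rule ccontr)
        assume "k x \<notin> U"
        then have "x \<in> A - {a}" "k x \<in> B - U"
          using that True ka kA by auto
        then have "k x \<in> Bs N" using sub by blast
        then obtain y where y: "y \<in> As N" "k y = k x"
          unfolding clopen_homeoD(5)[OF h(1)[of N], symmetric] using k by (metis imageE)
        then have "y = x"
          using inj_onD[OF inj y(2)] that h(2)[of N] by blast
        then show False
          using y(1) that by blast
      qed
      then show ?thesis
        using k[of _ N] h(2)[of N] by auto
    qed
    moreover have "openin X (A - As N)"
      using coneD(1)[OF AB(1)] clopen_homeoD(1)[OF h(1)] clopen_openin by blast
    ultimately show ?thesis
      using clopen_homeoD(6)[OF h(1) U] by auto
  qed
  then show ?thesis
    using bij coneD(1)[OF AB(1)] coneD(1)[OF AB(2)] unfolding clopen_homeo_def by blast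
qed

text \<open>This is the local form of the theorem of Mazurkiewicz and Sierpinski on countable
  compact spaces. The induction on the rank makes all pieces of lower rank available to the
  back-and-forth argument.\<close>

lemma cone_homeo:
  assumes "cone A a" "cone B b" "rk a = rk b"
  shows "\<exists>h. clopen_homeo A B h"
proof -
  have "\<forall>A a B b. cone A a \<longrightarrow> cone B b \<longrightarrow> rk a = \<gamma> \<longrightarrow> rk b = \<gamma> \<longrightarrow> (\<exists>h. clopen_homeo A B h)" for \<gamma>
  proof (induction \<gamma> rule: less_induct)
    case (less \<gamma>)
    have IH: "cones_homeo_below \<gamma>"
      using less unfolding cones_homeo_below_def by metis
    have "\<exists>h. clopen_homeo A B h" if AB: "cone A a" "cone B b" "rk a = \<gamma>" "rk b = \<gamma>" for A a B b
    proof -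
      define e where "e = from_nat_into (topspace X)"
      have e: "\<exists>n. e n = x" if "x \<in> topspace X" for x
        using that countable from_nat_into_surj by (metis e_def)
      define st where "st s \<longleftrightarrow> (case s of (A1, B1, h) \<Rightarrow>
        clopen_homeo A1 B1 h \<and> A1 \<subseteq> A - {a} \<and> B1 \<subseteq> B - {b})" for s
      \<comment> \<open>Stage \<open>n\<close> absorbs the point \<open>e n\<close> on whichever
        side it lies; as \<open>e\<close> enumerates the whole space, one enumeration exhausts both
        cones.\<close>
      define nx where "nx n s t \<longleftrightarrow> (case s of (A1, B1, h) \<Rightarrow> case t of (A2, B2, k) \<Rightarrow>
        (e n \<in> A - {a} \<longrightarrow> e n \<in> A2) \<and> (e n \<in> B - {b} \<longrightarrow> e n \<in> B2) \<and>
        A1 \<subseteq> A2 \<and> B1 \<subseteq> B2 \<and> (\<forall>y\<in>A1. k y = h y))" for n and s t :: "'a set \<times> 'a set \<times> ('a \<Rightarrow> 'a)"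
      have "st ({}, {}, id)"
        by (simp add: st_def clopen_homeo_empty)
      moreover have "\<exists>t. st t \<and> nx n s t" if s: "st s" for s n
      proof -
        obtain A1 B1 h where s1: "s = (A1, B1, h)" by (cases s) auto
        have h: "clopen_homeo A1 B1 h" "A1 \<subseteq> A - {a}" "B1 \<subseteq> B - {b}"
          using s by (auto simp: st_def s1)
        obtain A2 B2 k where k: "clopen_homeo A2 B2 k" "A2 \<subseteq> A - {a}" "B2 \<subseteq> B - {b}"
          "e n \<in> A - {a} \<longrightarrow> e n \<in> A2" "A1 \<subseteq> A2" "B1 \<subseteq> B2" "\<forall>y\<in>A1. k y = h y"
        proof (cases "e n \<in> A - {a}")
          case True
          then show thesis
            using cone_homeo_step[OF IH AB h True] that by blast
        next
          case False
          then show thesis using h that by blast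
        qed
        obtain A3 B3 l where l: "clopen_homeo A3 B3 l" "A3 \<subseteq> A - {a}" "B3 \<subseteq> B - {b}"
          "e n \<in> B - {b} \<longrightarrow> e n \<in> B3" "A2 \<subseteq> A3" "B2 \<subseteq> B3" "\<forall>y\<in>A2. l y = k y"
        proof (cases "e n \<in> B - {b}")
          case True
          then show thesis
            using cone_homeo_step'[OF IH AB k(1-3) True] that by blast
        next
          case False
          then show thesis using k that by blast
        qed
        have "st (A3, B3, l)" using l by (simp add: st_def)
        moreover have "nx n s (A3, B3, l)"
          using k l by (auto simp: nx_def s1)
        ultimately show ?thesis by blast
      qed
      ultimately obtain f where f: "\<And>n. st (f n)" "\<And>n. nx n (f n) (f (Suc n))"
        using dependent_nat_choice[of "\<lambda>_. st" nx] by metis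
      define As Bs h where "As n = fst (f n)" and "Bs n = fst (snd (f n))" and "h n = snd (snd (f n))" for n
      have 1: "clopen_homeo (As n) (Bs n) (h n)" "As n \<subseteq> A - {a}" "Bs n \<subseteq> B - {b}" for n
        using f(1)[of n] by (auto simp: st_def As_def Bs_def h_def split: prod.splits)
      have 2: "As n \<subseteq> As (Suc n)" "Bs n \<subseteq> Bs (Suc n)" "x \<in> As n \<Longrightarrow> h (Suc n) x = h n x"
        "e n \<in> A - {a} \<Longrightarrow> e n \<in> As (Suc n)" "e n \<in> B - {b} \<Longrightarrow> e n \<in> Bs (Suc n)" for n x
        using f(2)[of n] by (auto simp: nx_def As_def Bs_def h_def split: prod.splits)
      have "A - {a} \<subseteq> (\<Union>n. As n)"
      proof
        fix x assume x: "x \<in> A - {a}"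
        then obtain n where "e n = x"
          using e clopen_subset[OF coneD(1)[OF AB(1)]] by blast
        then show "x \<in> (\<Union>n. As n)" using 2(4)[of n] x by blast
      qed
      moreover have "B - {b} \<subseteq> (\<Union>n. Bs n)"
      proof
        fix x assume x: "x \<in> B - {b}"
        then obtain n where "e n = x"
          using e clopen_subset[OF coneD(1)[OF AB(2)]] by blast
        then show "x \<in> (\<Union>n. Bs n)" using 2(5)[of n] x by blast
      qed
      ultimately show ?thesis
        by (intro cone_homeo_limit[where As = As and Bs = Bs and h = h, OF AB(1,2)]) (use 1 2 in auto)
    qed
    then show ?case by blast
  qed
  then show ?thesis using assms by metis
qed

lemma clopen_copy:
  assumes "clopen A" "openin X B" "b \<in> B" "\<And>y. y \<in> A \<Longrightarrow> rk y < rk b"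
  obtains A' h where "A' \<subseteq> B - {b}" "clopen_homeo A A' h"
proof -
  have "cones_homeo_below (rk b)"
    using cone_homeo by (auto simp: cones_homeo_below_def)
  then show thesis
    using clopen_embed[OF _ assms(1) _ assms(2,3) refl] assms(4) that by blast
qed

end

subsection \<open>The homeomorphism group\<close>

context countable_compact_space
begin

lemma carrier_Homeo:
  "g \<in> carrier (Homeo X) \<longleftrightarrow> g \<in> extensional (topspace X) \<and> clopen_homeo (topspace X) (topspace X) g"
proof -
  have "clopen_homeo (topspace X) (topspace X) g" if g: "homeomorphic_map X X g"
  proof -
    have "continuous_map X X g" "g ` topspace X = topspace X" "inj_on g (topspace X)"
      using g by (auto simp: homeomorphic_imp_continuous_map homeomorphic_imp_surjective_map
          homeomorphic_imp_injective_map)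
    then show ?thesis
      by (auto simp: clopen_homeo_def bij_betw_def openin_continuous_map_preimage)
  qed
  moreover have "homeomorphic_map X X g" if g: "clopen_homeo (topspace X) (topspace X) g"
  proof (rule continuous_imp_homeomorphic_map[OF _ compact hausdorff])
    show "continuous_map X X g"
      using clopen_homeoD[OF g] by (auto simp: continuous_map_def)
  qed (use clopen_homeoD[OF g] in auto)
  ultimately show ?thesis
    by (auto simp: Homeo_def)
qed

lemma restrict_in_Homeo:
  "clopen_homeo (topspace X) (topspace X) g \<Longrightarrow> restrict g (topspace X) \<in> carrier (Homeo X)"
  using clopen_homeo_cong[of _ _ g "restrict g (topspace X)"] by (simp add: carrier_Homeo)

lemma Homeo_clopen_homeo:
  "g \<in> carrier (Homeo X) \<Longrightarrow> clopen_homeo (topspace X) (topspace X) g"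
  by (simp add: carrier_Homeo)

lemma Homeo_mem [simp]: "g \<in> carrier (Homeo X) \<Longrightarrow> x \<in> topspace X \<Longrightarrow> g x \<in> topspace X"
  using clopen_homeoD(7)[OF Homeo_clopen_homeo] .

lemma Homeo_inj: "g \<in> carrier (Homeo X) \<Longrightarrow> x \<in> topspace X \<Longrightarrow> y \<in> topspace X \<Longrightarrow> g x = g y \<Longrightarrow> x = y"
  using clopen_homeoD(4)[OF Homeo_clopen_homeo] by (auto dest: inj_onD)

lemma Homeo_mult [simp]: "x \<in> topspace X \<Longrightarrow> (g \<otimes>\<^bsub>Homeo X\<^esub> h) x = g (h x)"
  and Homeo_one [simp]: "x \<in> topspace X \<Longrightarrow> \<one>\<^bsub>Homeo X\<^esub> x = x"
  by (simp_all add: Homeo_def compose_def)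

lemma group_Homeo: "group (Homeo X)"
proof (rule groupI)
  show "x \<otimes>\<^bsub>Homeo X\<^esub> y \<in> carrier (Homeo X)" if "x \<in> carrier (Homeo X)" "y \<in> carrier (Homeo X)" for x y
    using restrict_in_Homeo[OF clopen_homeo_comp[OF Homeo_clopen_homeo[OF that(2)] Homeo_clopen_homeo[OF that(1)]]]
    by (simp add: Homeo_def compose_def)
  show "\<one>\<^bsub>Homeo X\<^esub> \<in> carrier (Homeo X)"
    using restrict_in_Homeo[OF clopen_homeo_ident] by (simp add: Homeo_def)
next
  fix x y z assume "x \<in> carrier (Homeo X)" "y \<in> carrier (Homeo X)" "z \<in> carrier (Homeo X)"
  then show "x \<otimes>\<^bsub>Homeo X\<^esub> y \<otimes>\<^bsub>Homeo X\<^esub> z = x \<otimes>\<^bsub>Homeo X\<^esub> (y \<otimes>\<^bsub>Homeo X\<^esub> z)"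
    using Homeo_mem[of z] by (auto simp: Homeo_def compose_def fun_eq_iff)
next
  fix x assume x: "x \<in> carrier (Homeo X)"
  then show "\<one>\<^bsub>Homeo X\<^esub> \<otimes>\<^bsub>Homeo X\<^esub> x = x"
    using Homeo_mem[of x] by (auto simp: carrier_Homeo Homeo_def compose_def extensional_def)
  have "restrict (inv_into (topspace X) x) (topspace X) \<in> carrier (Homeo X)"
    using x by (simp add: Homeo_clopen_homeo clopen_homeo_inv restrict_in_Homeo)
  moreover have "restrict (inv_into (topspace X) x) (topspace X) \<otimes>\<^bsub>Homeo X\<^esub> x = \<one>\<^bsub>Homeo X\<^esub>"
    using Homeo_mem[OF x] clopen_homeoD(4)[OF Homeo_clopen_homeo[OF x]]
    by (auto simp: Homeo_def compose_def fun_eq_iff)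
  ultimately show "\<exists>y\<in>carrier (Homeo X). y \<otimes>\<^bsub>Homeo X\<^esub> x = \<one>\<^bsub>Homeo X\<^esub>"
    by blast
qed

sublocale Homeo: group "Homeo X"
  by (rule group_Homeo)

lemma Homeo_inv1 [simp]: "g \<in> carrier (Homeo X) \<Longrightarrow> x \<in> topspace X \<Longrightarrow> (inv\<^bsub>Homeo X\<^esub> g) (g x) = x"
  using Homeo.l_inv[of g] Homeo_mult[of x "inv\<^bsub>Homeo X\<^esub> g" g] by simp

lemma Homeo_inv2 [simp]: "g \<in> carrier (Homeo X) \<Longrightarrow> x \<in> topspace X \<Longrightarrow> g ((inv\<^bsub>Homeo X\<^esub> g) x) = x"
  using Homeo.r_inv[of g] Homeo_mult[of x g "inv\<^bsub>Homeo X\<^esub> g"] by simp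

lemma Homeo_image_clopen: "g \<in> carrier (Homeo X) \<Longrightarrow> clopen A \<Longrightarrow> clopen (g ` A)"
  using clopen_homeo_image[OF Homeo_clopen_homeo] clopen_subset by blast

end

context ranked_space
begin

text \<open>Induction on \<open>rk x\<close>. If \<open>h x\<close> has larger rank, the image of a
  cone at \<open>x\<close> contains a point of rank \<open>rk x\<close>; it comes from a point of
  smaller rank, whose rank \<open>h\<close> preserves. If \<open>h x\<close> has smaller rank, the
  preimage of a cone at \<open>h x\<close> contains a point of rank \<open>rk (h x)\<close>; its
  image has the rank of the apex, so the point is \<open>x\<close>.\<close>

lemma rank_homeo:
  assumes h: "clopen_homeo A B h" and "x \<in> A"
  shows "rk (h x) = rk x"
  using assms(2)
proof (induction "rk x" arbitrary: x rule: less_induct)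
  case (less x)
  have "\<not> rk x < rk (h x)"
  proof
    assume lt: "rk x < rk (h x)"
    obtain C where C: "cone C x" "C \<subseteq> A"
      using cone_ex[OF clopen_openin[OF clopen_homeoD(1)[OF h]]] less.prems by blast
    have "openin X (h ` C)" "h x \<in> h ` C"
      using clopen_homeo_image[OF h coneD(1)[OF C(1)] C(2)] clopen_openin coneD(2)[OF C(1)] by auto
    then obtain z where z: "z \<in> C" "rk (h z) = rk x"
      using rk_attained[OF _ _ lt] by auto
    then have "rk z < rk x"
      using coneD(3)[OF C(1) z(1)] lt by (cases "z = x") auto
    then show False
      using less.hyps[of z] z C(2) by auto
  qed
  moreover have "\<not> rk (h x) < rk x"
  proof
    assume lt: "rk (h x) < rk x"
    obtain D where D: "cone D (h x)" "D \<subseteq> B"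
      using cone_ex[OF clopen_openin[OF clopen_homeoD(2)[OF h]]] clopen_homeoD(7)[OF h less.prems]
      by blast
    have "openin X {z \<in> A. h z \<in> D}" "x \<in> {z \<in> A. h z \<in> D}"
      using clopen_homeoD(6)[OF h clopen_openin[OF coneD(1)[OF D(1)]]] less.prems coneD(2)[OF D(1)]
      by auto
    then obtain z where z: "z \<in> A" "h z \<in> D" "rk z = rk (h x)"
      using rk_attained[OF _ _ lt] by blast
    then have "rk (h z) = rk (h x)"
      using less.hyps[of z] lt by simp
    then have "h z = h x"
      using coneD(3)[OF D(1) z(2)] by auto
    then show False
      using inj_onD[OF clopen_homeoD(4)[OF h] _ z(1) less.prems] z(3) lt by auto
  qed
  ultimately show ?case by simp
qed

lemma rank_Homeo [simp]: "g \<in> carrier (Homeo X) \<Longrightarrow> x \<in> topspace X \<Longrightarrow> rk (g x) = rk x"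
  using rank_homeo[OF Homeo_clopen_homeo] .

subsection \<open>Locally constant retractions onto the points of maximal rank\<close>

definition top_points :: "'a set" where
  "top_points = {x \<in> topspace X. rk x = \<alpha>}"

lemma top_points_subset: "t \<in> top_points \<Longrightarrow> t \<in> topspace X"
  and rank_top_points: "t \<in> top_points \<Longrightarrow> rk t = \<alpha>"
  unfolding top_points_def by simp_all

lemma finite_top_points: "finite top_points"
  unfolding top_points_def by (rule finite_max_rank[OF clopen_topspace rk_le])

lemma top_points_nonempty: "top_points \<noteq> {}"
  using top_ex by (auto simp: top_points_def)

lemma rank_less: "x \<in> topspace X \<Longrightarrow> x \<notin> top_points \<Longrightarrow> rk x < \<alpha>"
  using rk_le[of x] unfolding top_points_def by (simp add: le_less)

lemma Homeo_top_points [simp]: "g \<in> carrier (Homeo X) \<Longrightarrow> t \<in> top_points \<Longrightarrow> g t \<in> top_points"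
  by (simp add: top_points_def)

definition retr :: "('a \<Rightarrow> 'a) \<Rightarrow> bool" where
  "retr r \<longleftrightarrow> (\<forall>x\<in>topspace X. r x \<in> top_points) \<and> (\<forall>t\<in>top_points. r t = t) \<and>
     (\<forall>t. openin X {x \<in> topspace X. r x = t})"

lemma retrD:
  assumes "retr r"
  shows "x \<in> topspace X \<Longrightarrow> r x \<in> top_points" "t \<in> top_points \<Longrightarrow> r t = t"
    "openin X {x \<in> topspace X. r x = t}"
  using assms by (auto simp: retr_def)

lemma retr_clopen:
  assumes "retr r"
  shows "clopen {x \<in> topspace X. r x = t}"
proof -
  have eq: "{x \<in> topspace X. r x = t} = topspace X - (\<Union>s\<in>-{t}. {x \<in> topspace X. r x = s})"
    by auto
  have "openin X (\<Union>s\<in>-{t}. {x \<in> topspace X. r x = s})"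
    using retrD(3)[OF assms] by auto
  then have "closedin X {x \<in> topspace X. r x = t}"
    by (subst eq) (rule closedin_diff[OF closedin_topspace])
  then show ?thesis
    using retrD(3)[OF assms] by (simp add: clopen_def)
qed

lemma retr_clopen2:
  assumes "retr r1" "retr r2"
  shows "clopen {x \<in> topspace X. r1 x = s \<and> r2 x = t}"
proof -
  have "{x \<in> topspace X. r1 x = s \<and> r2 x = t} = {x \<in> topspace X. r1 x = s} \<inter> {x \<in> topspace X. r2 x = t}"
    by auto
  then show ?thesis
    using assms retr_clopen by auto
qed

text \<open>A fibre contains exactly one point of rank \<alpha>. By \<open>cone_homeo\<close>, all
  fibres of all retractions are therefore homeomorphic.\<close>

lemma retr_cone:
  assumes r: "retr r" and t: "t \<in> top_points"
  shows "cone {x \<in> topspace X. r x = t} t"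
  unfolding cone_def
proof (intro conjI ballI)
  show "t \<in> {x \<in> topspace X. r x = t}"
    using retrD(2)[OF r t] top_points_subset[OF t] by simp
  fix y assume y: "y \<in> {x \<in> topspace X. r x = t} - {t}"
  then have "y \<notin> top_points"
    using retrD(2)[OF r] by auto
  then show "rk y < rk t"
    using y rank_less rank_top_points[OF t] by simp
qed (rule retr_clopen[OF r])

text \<open>The elementary move; the estimates below assign a price to it.\<close>

lemma retr_update:
  assumes r: "retr r" and D: "clopen D" "D \<inter> top_points = {}" and q: "q \<in> top_points"
  shows "retr (\<lambda>x. if x \<in> D then q else r x)"
  unfolding retr_def
proof (intro conjI ballI allI)
  fix t
  have "{x \<in> topspace X. (if x \<in> D then q else r x) = t} =
    (if t = q then D \<union> {x \<in> topspace X. r x = t} else {x \<in> topspace X. r x = t} - D)"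
    using clopen_subset[OF D(1)] by auto
  moreover have "clopen \<dots>"
    using retr_clopen[OF r] D(1) by auto
  ultimately show "openin X {x \<in> topspace X. (if x \<in> D then q else r x) = t}"
    using clopen_openin by simp
qed (use assms retrD[OF r] in auto)

text \<open>The top points are treated one at a time: a cone around the new point contains no other
  top point and may be cut out of the fibres found so far.\<close>

lemma retr_ex: "\<exists>r. retr r"
proof -
  have "\<exists>r. (\<forall>x\<in>topspace X. r x \<in> S) \<and> (\<forall>t\<in>S. r t = t) \<and> (\<forall>t. clopen {x \<in> topspace X. r x = t})"
    if "finite S" "S \<noteq> {}" "S \<subseteq> top_points" for S
    using that
  proof (induction S rule: finite_ne_induct)
    case (singleton t)
    have "clopen {x \<in> topspace X. t = s}" for s by (cases "t = s") auto
    then show ?case by (intro exI[of _ "\<lambda>_. t"]) simp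
  next
    case (insert t S)
    then obtain r where r: "\<forall>x\<in>topspace X. r x \<in> S" "\<forall>t\<in>S. r t = t"
      "\<forall>t. clopen {x \<in> topspace X. r x = t}"
      by auto
    have "t \<in> topspace X"
      using insert.prems top_points_subset by blast
    then obtain C where C: "cone C t"
      using cone_ex[OF openin_topspace] by metis
    have CS: "s \<notin> C" if "s \<in> S" for s
      using coneD(3)[OF C, of s] that insert rank_top_points by (metis insert_subset less_irrefl subsetD)
    have "clopen {x \<in> topspace X. (if x \<in> C then t else r x) = s}" for s
    proof -
      have "{x \<in> topspace X. (if x \<in> C then t else r x) = s} =
        (if s = t then C \<union> {x \<in> topspace X. r x = s} else {x \<in> topspace X. r x = s} - C)"
        using clopen_subset[OF coneD(1)[OF C]] by auto
      moreover have "clopen \<dots>"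
        using r(3) coneD(1)[OF C] by auto
      ultimately show ?thesis by simp
    qed
    then show ?case
      using r CS coneD(2)[OF C] by (intro exI[of _ "\<lambda>x. if x \<in> C then t else r x"]) auto
  qed
  then show ?thesis
    using finite_top_points top_points_nonempty clopen_openin unfolding retr_def by (metis order_refl)
qed

text \<open>That is, \<open>r2 = g \<circ> r1 \<circ> g\<^sup>-\<^sup>1\<close>.\<close>

definition intertwines :: "('a \<Rightarrow> 'a) \<Rightarrow> ('a \<Rightarrow> 'a) \<Rightarrow> ('a \<Rightarrow> 'a) \<Rightarrow> bool" where
  "intertwines g r1 r2 \<longleftrightarrow> (\<forall>x\<in>topspace X. r2 (g x) = g (r1 x))"

lemma retr_in_topspace: "retr r \<Longrightarrow> x \<in> topspace X \<Longrightarrow> r x \<in> topspace X"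
  using retrD(1) top_points_subset by blast

lemma intertwines_comp:
  assumes "h \<in> carrier (Homeo X)" "retr r1" "intertwines h r1 r2" "intertwines g r2 r3"
  shows "intertwines (g \<otimes>\<^bsub>Homeo X\<^esub> h) r1 r3"
  using assms by (simp add: intertwines_def retr_in_topspace)

lemma intertwines_inv:
  assumes g: "g \<in> carrier (Homeo X)" and r: "retr r1" "intertwines g r1 r2"
  shows "intertwines (inv\<^bsub>Homeo X\<^esub> g) r2 r1"
  unfolding intertwines_def
proof
  fix x assume x: "x \<in> topspace X"
  define y where "y = (inv\<^bsub>Homeo X\<^esub> g) x"
  have y: "y \<in> topspace X" "g y = x"
    using g x by (auto simp: y_def)
  then have "r2 x = g (r1 y)"
    using r(2) by (auto simp: intertwines_def)
  then show "r1 ((inv\<^bsub>Homeo X\<^esub> g) x) = (inv\<^bsub>Homeo X\<^esub> g) (r2 x)"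
    using g r(1) y by (simp add: retr_in_topspace flip: y_def)
qed

lemma intertwines_one: "retr r \<Longrightarrow> intertwines \<one>\<^bsub>Homeo X\<^esub> r r"
  by (simp add: intertwines_def retr_in_topspace)

lemma intertwines_retr_ex:
  assumes g: "g \<in> carrier (Homeo X)" and r: "retr r"
  obtains r' where "retr r'" "intertwines g r r'"
proof -
  let ?i = "inv\<^bsub>Homeo X\<^esub> g"
  have i: "?i \<in> carrier (Homeo X)" using g by simp
  define r' where "r' x = g (r (?i x))" for x
  have "{x \<in> topspace X. r' x = t} = {x \<in> topspace X. ?i x \<in> {y \<in> topspace X. r y = ?i t}}"
    if "t \<in> topspace X" for t
    using that g r i by (auto simp: r'_def retr_in_topspace)
  moreover have "{x \<in> topspace X. r' x = t} = {}" if "t \<notin> topspace X" for t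
    using that g r i by (auto simp: r'_def retr_in_topspace)
  ultimately have "openin X {x \<in> topspace X. r' x = t}" for t
    using clopen_homeoD(6)[OF Homeo_clopen_homeo[OF i] retrD(3)[OF r, of "?i t"]]
    by (cases "t \<in> topspace X") (metis (no_types, lifting), metis (no_types, lifting) openin_empty)
  then have "retr r'"
    using g i r retrD(1,2)[OF r] top_points_subset by (simp add: retr_def r'_def)
  moreover have "intertwines g r r'"
    using g by (simp add: intertwines_def r'_def)
  ultimately show thesis using that by blast
qed

text \<open>Each point is labelled by its fibre and by whether it lies in the marked set. A fibre
  from which a clopen set missing its top point has been removed is still a cone with the same apex,
  so pieces with equal labels are homeomorphic and can be glued.\<close>

lemma retr_pair_homeo:
  assumes r: "retr r1" "retr r2" and p: "p \<in> top_points"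
    and D: "D1 \<subseteq> {x \<in> topspace X. r1 x = p} - {p}" "D2 \<subseteq> {x \<in> topspace X. r2 x = p} - {p}"
    and cD: "clopen_homeo D1 D2 k"
  obtains g where "g \<in> carrier (Homeo X)" "intertwines g r1 r2"
    "\<And>x. x \<in> topspace X \<Longrightarrow> g x \<in> D2 \<longleftrightarrow> x \<in> D1" "\<And>x. x \<in> topspace X \<Longrightarrow> r2 (g x) = r1 x"
proof -
  have cl: "clopen D1" "clopen D2" using clopen_homeoD[OF cD] by auto
  have ex: "\<exists>h. clopen_homeo {x \<in> topspace X. (r1 x, x \<in> D1) = (t, b)}
      {x \<in> topspace X. (r2 x, x \<in> D2) = (t, b)} h" for t b
  proof (cases "b")
    case True
    have "{x \<in> topspace X. (r1 x, x \<in> D1) = (t, b)} = (if t = p then D1 else {})"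
      "{x \<in> topspace X. (r2 x, x \<in> D2) = (t, b)} = (if t = p then D2 else {})"
      using True D by auto
    then show ?thesis
      using cD clopen_homeo_empty by simp blast
  next
    case False
    have e: "{x \<in> topspace X. (r1 x, x \<in> D1) = (t, b)} = {x \<in> topspace X. r1 x = t} - D1"
      "{x \<in> topspace X. (r2 x, x \<in> D2) = (t, b)} = {x \<in> topspace X. r2 x = t} - D2"
      using False by auto
    show ?thesis
    proof (cases "t \<in> top_points")
      case True
      have "t \<notin> D1" "t \<notin> D2"
        using D retrD(2)[OF r(1) True] retrD(2)[OF r(2) True] by auto
      then have "cone ({x \<in> topspace X. r1 x = t} - D1) t" "cone ({x \<in> topspace X. r2 x = t} - D2) t"
        by (intro cone_subset[OF retr_cone[OF r(1) True]] cone_subset[OF retr_cone[OF r(2) True]]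
            clopen_Diff cl retr_clopen r;
            simp add: retrD(2)[OF r(1) True] retrD(2)[OF r(2) True] top_points_subset[OF True])+
      then show ?thesis
        unfolding e using cone_homeo by blast
    next
      case False
      then have "{x \<in> topspace X. r1 x = t} - D1 = {}" "{x \<in> topspace X. r2 x = t} - D2 = {}"
        using r retrD(1) by blast+
      then show ?thesis
        unfolding e using clopen_homeo_empty by metis
    qed
  qed
  obtain g where g: "clopen_homeo (topspace X) (topspace X) g"
    "\<And>x. x \<in> topspace X \<Longrightarrow> (r2 (g x), g x \<in> D2) = (r1 x, x \<in> D1)"
    by (rule clopen_homeo_glue[of "\<lambda>x. (r1 x, x \<in> D1)" "\<lambda>x. (r2 x, x \<in> D2)"]) (use ex in \<open>auto simp: split_paired_all\<close>)
  define g' where "g' = restrict g (topspace X)"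
  have g': "g' \<in> carrier (Homeo X)" "\<And>x. x \<in> topspace X \<Longrightarrow> r2 (g' x) = r1 x"
    "\<And>x. x \<in> topspace X \<Longrightarrow> g' x \<in> D2 \<longleftrightarrow> x \<in> D1"
    using restrict_in_Homeo[OF g(1)] g(2) by (auto simp: g'_def)
  \<comment> \<open>A top point is its own value under both retractions, so preserving values fixes
    it.\<close>
  have "g' t = t" if "t \<in> top_points" for t
    using g'(2)[of t] retrD(2)[OF r(1) that] retrD(2)[OF r(2), of "g' t"] that g'(1) top_points_subset
    by simp
  then have "intertwines g' r1 r2"
    using g'(2) retrD(1)[OF r(1)] by (simp add: intertwines_def)
  then show thesis
    using that g' by blast
qed

lemma intertwines_ex:
  assumes "retr r1" "retr r2"
  obtains g where "g \<in> carrier (Homeo X)" "intertwines g r1 r2"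
proof -
  obtain p where p: "p \<in> top_points" using top_points_nonempty by blast
  \<comment> \<open>The marked sets are empty here, so that only the fibres are matched.\<close>
  show thesis
    by (rule retr_pair_homeo[OF assms p _ _ clopen_homeo_empty]) (use that in auto)
qed

end

subsection \<open>Continuous length functions\<close>

lemma (in countable_compact_space) Homeo_cancel:
  assumes "g \<in> carrier (Homeo X)" "h \<in> carrier (Homeo X)"
  shows "g \<otimes>\<^bsub>Homeo X\<^esub> (inv\<^bsub>Homeo X\<^esub> g \<otimes>\<^bsub>Homeo X\<^esub> h) = h"
    "inv\<^bsub>Homeo X\<^esub> g \<otimes>\<^bsub>Homeo X\<^esub> (g \<otimes>\<^bsub>Homeo X\<^esub> h) = h"
  using assms by (simp_all flip: Homeo.m_assoc)

context ranked_space
begin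

definition base :: "'a \<Rightarrow> 'a" where
  "base = (SOME r. retr r)"

lemma retr_base: "retr base"
  unfolding base_def by (rule someI_ex[OF retr_ex])

lemmas baseD = retrD[OF retr_base]

text \<open>In effect the product of the homeomorphism groups of the fibres of \<open>base\<close>.
  It fixes the top points, is open, and has finite index in the stabiliser of
  \<open>base\<close>.\<close>

definition pure :: "('a \<Rightarrow> 'a) set" where
  "pure = {g \<in> carrier (Homeo X). \<forall>x\<in>topspace X. base (g x) = base x}"

lemma pureI: "g \<in> carrier (Homeo X) \<Longrightarrow> (\<And>x. x \<in> topspace X \<Longrightarrow> base (g x) = base x) \<Longrightarrow> g \<in> pure"
  and pure_carrier [simp]: "g \<in> pure \<Longrightarrow> g \<in> carrier (Homeo X)"
  and pure_base: "g \<in> pure \<Longrightarrow> x \<in> topspace X \<Longrightarrow> base (g x) = base x"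
  unfolding pure_def by blast+

lemma pure_mult [simp]: "g \<in> pure \<Longrightarrow> h \<in> pure \<Longrightarrow> g \<otimes>\<^bsub>Homeo X\<^esub> h \<in> pure"
  by (rule pureI) (simp_all add: pure_base)

lemma pure_inv [simp]:
  assumes g: "g \<in> pure"
  shows "inv\<^bsub>Homeo X\<^esub> g \<in> pure"
proof (rule pureI)
  fix x assume "x \<in> topspace X"
  then show "base ((inv\<^bsub>Homeo X\<^esub> g) x) = base x"
    using pure_base[OF g, of "(inv\<^bsub>Homeo X\<^esub> g) x"] g by simp
qed (use g in simp)

lemma pure_top_points: "g \<in> pure \<Longrightarrow> t \<in> top_points \<Longrightarrow> g t = t"
  using pure_base[of g t] baseD(2)[of t] baseD(2)[of "g t"] top_points_subset[of t] by simp

lemma Homeo_image_top_points: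
  assumes "g \<in> carrier (Homeo X)" "A \<subseteq> topspace X" "A \<inter> top_points = {}"
  shows "g ` A \<inter> top_points = {}"
proof -
  have "g x \<notin> top_points" if "x \<in> A" for x
  proof -
    have x: "x \<in> topspace X" "x \<notin> top_points"
      using assms(2,3) that by auto
    then show ?thesis
      using rank_Homeo[OF assms(1) x(1)] by (simp add: top_points_def)
  qed
  then show ?thesis by auto
qed

text \<open>Intended for the distance to the identity in a continuous left-invariant pseudometric.
  The last clause is all that is kept of continuity: each neighbourhood of the identity contains the
  pure homeomorphisms that fix a suitable \<open>A\<close> pointwise. The bound 1 stands for an
  arbitrary radius.\<close>

definition length_fun :: "(('a \<Rightarrow> 'a) \<Rightarrow> real) \<Rightarrow> bool" where
  "length_fun L \<longleftrightarrow>
     (\<forall>g\<in>carrier (Homeo X). \<forall>h\<in>carrier (Homeo X). L (g \<otimes>\<^bsub>Homeo X\<^esub> h) \<le> L g + L h) \<and>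
     (\<forall>g\<in>carrier (Homeo X). 0 \<le> L g \<and> L (inv\<^bsub>Homeo X\<^esub> g) = L g) \<and>
     (\<exists>A. clopen A \<and> A \<inter> top_points = {} \<and> (\<forall>s\<in>pure. (\<forall>x\<in>A. s x = x) \<longrightarrow> L s \<le> 1))"

lemma length_funD:
  assumes "length_fun L" "g \<in> carrier (Homeo X)" "h \<in> carrier (Homeo X)"
  shows "L (g \<otimes>\<^bsub>Homeo X\<^esub> h) \<le> L g + L h" "0 \<le> L g" "L (inv\<^bsub>Homeo X\<^esub> g) = L g"
    "L h \<le> L g + L (g \<otimes>\<^bsub>Homeo X\<^esub> h)" "L h \<le> L g + L (inv\<^bsub>Homeo X\<^esub> g \<otimes>\<^bsub>Homeo X\<^esub> h)"
proof -
  have sub: "L (a \<otimes>\<^bsub>Homeo X\<^esub> b) \<le> L a + L b" if "a \<in> carrier (Homeo X)" "b \<in> carrier (Homeo X)" for a b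
    using assms that by (simp add: length_fun_def)
  show i: "L (inv\<^bsub>Homeo X\<^esub> g) = L g"
    using assms by (simp add: length_fun_def)
  show "L (g \<otimes>\<^bsub>Homeo X\<^esub> h) \<le> L g + L h" "0 \<le> L g"
    using assms by (simp_all add: length_fun_def)
  have "inv\<^bsub>Homeo X\<^esub> g \<otimes>\<^bsub>Homeo X\<^esub> (g \<otimes>\<^bsub>Homeo X\<^esub> h) = h" "g \<otimes>\<^bsub>Homeo X\<^esub> (inv\<^bsub>Homeo X\<^esub> g \<otimes>\<^bsub>Homeo X\<^esub> h) = h"
    using assms by (simp_all add: Homeo_cancel)
  then show "L h \<le> L g + L (g \<otimes>\<^bsub>Homeo X\<^esub> h)" "L h \<le> L g + L (inv\<^bsub>Homeo X\<^esub> g \<otimes>\<^bsub>Homeo X\<^esub> h)"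
    using sub[of "inv\<^bsub>Homeo X\<^esub> g" "g \<otimes>\<^bsub>Homeo X\<^esub> h"] sub[of g "inv\<^bsub>Homeo X\<^esub> g \<otimes>\<^bsub>Homeo X\<^esub> h"] assms i by simp_all
qed

text \<open>Within a fibre, the complement of \<open>D\<close> is a neighbourhood of the top point
  and has room for a copy of the part of \<open>A\<close> in that fibre, all of whose ranks are
  below \<alpha>. Copying fibre by fibre displaces \<open>A\<close> from any given
  \<open>D\<close>.\<close>

lemma pure_copy:
  assumes A: "clopen A" "A \<inter> top_points = {}" and D: "clopen D" "D \<inter> top_points = {}"
  obtains A' k where "clopen_homeo A A' k" "A' \<inter> D = {}" "A' \<inter> top_points = {}"
    "\<And>x. x \<in> A \<Longrightarrow> base (k x) = base x"
proof -
  define At where "At t = A \<inter> {x \<in> topspace X. base x = t}" for t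
  have cAt: "clopen (At t)" for t
    using A(1) retr_clopen[OF retr_base] by (auto simp: At_def)
  have "\<exists>B h. B \<subseteq> ({x \<in> topspace X. base x = t} - D) - {t} \<and> clopen_homeo (At t) B h"
    if t: "t \<in> top_points" for t
  proof -
    have o: "openin X ({x \<in> topspace X. base x = t} - D)"
      using retr_clopen[OF retr_base] D(1) clopen_openin by blast
    have t': "t \<in> {x \<in> topspace X. base x = t} - D"
      using t D(2) baseD(2) top_points_subset by auto
    have "rk y < rk t" if "y \<in> At t" for y
      using that rank_less A(2) rank_top_points[OF t] by (auto simp: At_def)
    then obtain B h where "B \<subseteq> ({x \<in> topspace X. base x = t} - D) - {t}" "clopen_homeo (At t) B h"
      using clopen_copy[OF cAt[of t] o t'] by blast
    then show ?thesis by blast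
  qed
  then obtain B h where Bh: "\<And>t. t \<in> top_points \<Longrightarrow> B t \<subseteq> ({x \<in> topspace X. base x = t} - D) - {t}"
    "\<And>t. t \<in> top_points \<Longrightarrow> clopen_homeo (At t) (B t) (h t)"
    by metis
  define k where "k x = h (base x) x" for x
  have k: "clopen_homeo (At t) (B t) k" if "t \<in> top_points" for t
    by (rule clopen_homeo_cong[OF Bh(2)[OF that]]) (simp add: k_def At_def)
  have "clopen_homeo (\<Union>t\<in>S. At t) (\<Union>t\<in>S. B t) k" if "finite S" "S \<subseteq> top_points" for S
    using that
  proof (induction S rule: finite_induct)
    case empty
    then show ?case by (simp add: clopen_homeo_empty)
  next
    case (insert t S)
    have "At t \<inter> (\<Union>t\<in>S. At t) = {}"
      using insert.hyps(2) by (auto simp: At_def)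
    moreover have "B t \<inter> B s = {}" if "s \<in> S" for s
    proof -
      have "B t \<subseteq> {x \<in> topspace X. base x = t}" "B s \<subseteq> {x \<in> topspace X. base x = s}" "s \<noteq> t"
        using Bh(1)[of t] Bh(1)[of s] insert that by auto
      then show ?thesis by auto
    qed
    then have "B t \<inter> (\<Union>t\<in>S. B t) = {}"
      by auto
    ultimately show ?case
      using clopen_homeo_Un[OF k[of t], of "\<Union>t\<in>S. At t" "\<Union>t\<in>S. B t"] insert by simp
  qed
  from this[OF finite_top_points order_refl]
  have 1: "clopen_homeo (\<Union>t\<in>top_points. At t) (\<Union>t\<in>top_points. B t) k" .
  have eA: "(\<Union>t\<in>top_points. At t) = A"
    using baseD(1) clopen_subset[OF A(1)] by (auto simp: At_def)
  show thesis
  proof (rule that)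
    show "clopen_homeo A (\<Union>t\<in>top_points. B t) k"
      using 1 by (simp only: eA)
    show "(\<Union>t\<in>top_points. B t) \<inter> D = {}"
      using Bh(1) by blast
    show "(\<Union>t\<in>top_points. B t) \<inter> top_points = {}"
    proof -
      have "B t \<inter> top_points = {}" if "t \<in> top_points" for t
        using Bh(1)[OF that] baseD(2) by auto
      then show ?thesis by auto
    qed
    show "base (k x) = base x" if x: "x \<in> A" for x
    proof -
      have x': "x \<in> topspace X" "base x \<in> top_points"
        using x clopen_subset[OF A(1)] baseD(1) by auto
      then have "k x \<in> B (base x)"
        using clopen_homeoD(7)[OF k[OF x'(2)], of x] x by (simp add: At_def)
      then show ?thesis
        using Bh(1)[OF x'(2)] by auto
    qed
  qed
qed

text \<open>An exchange supported on \<open>A\<close> and \<open>A'\<close>. It fixes every set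
  disjoint from both, and this is what bounds its length.\<close>

lemma pure_swap:
  assumes k: "clopen_homeo A A' k" and disj: "A \<inter> A' = {}"
    and base: "\<And>x. x \<in> A \<Longrightarrow> base (k x) = base x"
  obtains \<tau> where "\<tau> \<in> pure" "\<And>x. x \<in> A \<Longrightarrow> \<tau> x = k x" "\<And>x. x \<in> A \<Longrightarrow> \<tau> (k x) = x"
    "\<And>x. x \<in> topspace X \<Longrightarrow> x \<notin> A \<Longrightarrow> x \<notin> A' \<Longrightarrow> \<tau> x = x"
proof -
  note kD = clopen_homeoD[OF k]
  have sub: "A \<subseteq> topspace X" "A' \<subseteq> topspace X"
    using kD(1,2) clopen_subset by auto
  let ?R = "topspace X - (A \<union> A')"
  define \<tau> where "\<tau> = (\<lambda>x. if x \<in> ?R then x else if x \<in> A' then inv_into A k x else k x)"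
  have "clopen_homeo ((A \<union> A') \<union> ?R) ((A' \<union> A) \<union> ?R) \<tau>"
    unfolding \<tau>_def
  proof (rule clopen_homeo_Un'[OF clopen_homeo_Un'[OF k clopen_homeo_inv[OF k]]])
    show "clopen_homeo ?R ?R (\<lambda>x. x)"
      using kD(1,2) by (intro clopen_homeo_ident) auto
  qed (use disj in auto)
  moreover have "(A \<union> A') \<union> ?R = topspace X" "(A' \<union> A) \<union> ?R = topspace X"
    using sub by auto
  ultimately have t: "clopen_homeo (topspace X) (topspace X) \<tau>"
    by simp
  have tA: "\<tau> x = k x" "\<tau> (k x) = x" if "x \<in> A" for x
    using that disj kD(4) kD(7)[OF that] by (auto simp: \<tau>_def)
  have tR: "\<tau> x = x" if "x \<in> topspace X" "x \<notin> A" "x \<notin> A'" for x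
    using that by (simp add: \<tau>_def)
  have "base (\<tau> x) = base x" if x: "x \<in> topspace X" for x
  proof -
    consider "x \<in> A" | y where "y \<in> A" "x = k y" | "x \<notin> A" "x \<notin> A'"
      using kD(5) by blast
    then show ?thesis
      by cases (use tA tR base x in auto)
  qed
  then have "restrict \<tau> (topspace X) \<in> pure"
    by (intro pureI restrict_in_Homeo[OF t]) simp
  then show thesis
  proof (rule that)
    show "restrict \<tau> (topspace X) x = k x" if "x \<in> A" for x
      using that tA(1)[OF that] sub by auto
    show "restrict \<tau> (topspace X) (k x) = x" if "x \<in> A" for x
      using tA(2)[OF that] kD(7)[OF that] sub by auto
  qed (use tR in auto)
qed

text \<open>
  If \<open>L \<le> 1\<close> on the pure homeomorphisms fixing \<open>A\<close>, then a conjugate of that subgroup by an element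
  \<open>\<tau>\<close> of bounded length fixes \<open>B = \<tau> A\<close>, where \<open>B\<close> misses \<open>A\<close> and \<open>g A\<close>. Two elements of it suffice
  to carry \<open>g A\<close> back to \<open>A\<close>.
\<close>

lemma length_bounded_pure:
  assumes L: "length_fun L"
  obtains c where "\<And>g. g \<in> pure \<Longrightarrow> L g \<le> c"
proof -
  note LD = length_funD[OF L]
  obtain A where A: "clopen A" "A \<inter> top_points = {}"
    and LA': "\<forall>s\<in>pure. (\<forall>x\<in>A. s x = x) \<longrightarrow> L s \<le> 1"
    using L unfolding length_fun_def by (elim conjE exE)
  have LA: "L s \<le> 1" if "s \<in> pure" "\<And>x. x \<in> A \<Longrightarrow> s x = x" for s
    using LA' that by simp
  have As: "x \<in> topspace X" if "x \<in> A" for x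
    using clopen_subset[OF A(1)] that by auto
  obtain A1 k where k: "clopen_homeo A A1 k" "A1 \<inter> A = {}" "A1 \<inter> top_points = {}"
    "\<And>x. x \<in> A \<Longrightarrow> base (k x) = base x"
    using pure_copy[OF A A] by blast
  \<comment> \<open>\<open>f\<close> moves \<open>A\<close> off itself and is chosen before
    \<open>g\<close>, so \<open>L f\<close> may enter the bound.\<close>
  obtain f where f: "f \<in> pure" "\<And>x. x \<in> A \<Longrightarrow> f x = k x"
    by (rule pure_swap[OF k(1) _ k(4)]) (use k(2) in auto)
  note cA1 = clopen_homeoD(2)[OF k(1)]
  \<comment> \<open>Two elements that fix the displaced copy \<open>B\<close> contribute
    \<open>1 + 2 * (1 + L f)\<close> each, an element that fixes \<open>A\<close> contributes
    1.\<close>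
  have "L g \<le> 2 * (1 + 2 * (1 + L f)) + 1" if g: "g \<in> pure" for g
  proof -
    note gc = pure_carrier[OF g]
    have gA: "clopen (g ` A)" "g ` A \<inter> top_points = {}"
      using Homeo_image_clopen[OF gc A(1)] Homeo_image_top_points[OF gc clopen_subset[OF A(1)] A(2)]
      by auto
    obtain B l where l: "clopen_homeo A1 B l" "B \<inter> (A \<union> A1 \<union> g ` A) = {}" "B \<inter> top_points = {}"
      "\<And>x. x \<in> A1 \<Longrightarrow> base (l x) = base x"
      by (rule pure_copy[OF cA1 k(3), of "A \<union> A1 \<union> g ` A"]) (use A cA1 k(3) gA in auto)
    obtain h where h: "h \<in> pure" "\<And>x. x \<in> A1 \<Longrightarrow> h x = l x"
      "\<And>x. x \<in> topspace X \<Longrightarrow> x \<notin> A1 \<Longrightarrow> x \<notin> B \<Longrightarrow> h x = x"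
      by (rule pure_swap[OF l(1) _ l(4)]) (use l(2) in auto)
    \<comment> \<open>The set \<open>B\<close> depends on \<open>g\<close>, but \<open>h\<close>
      moves only points of \<open>A1\<close> and \<open>B\<close>, which miss \<open>A\<close>; so
      its length is at most 1 whatever \<open>g\<close> is.\<close>
    have "L h \<le> 1"
      by (rule LA[OF h(1)]) (use h(3) k(2) l(2) As in blast)
    define \<tau> where "\<tau> = h \<otimes>\<^bsub>Homeo X\<^esub> f"
    have \<tau>: "\<tau> \<in> pure" "L \<tau> \<le> 1 + L f"
      using LD(1)[of h f] h(1) f(1) \<open>L h \<le> 1\<close> by (auto simp: \<tau>_def)
    have \<tau>A: "\<tau> x \<in> B" if "x \<in> A" for x
      using that f(2) h(2) clopen_homeoD(7)[OF k(1)] clopen_homeoD(7)[OF l(1)] As by (simp add: \<tau>_def)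
    have LB: "L u \<le> 1 + 2 * (1 + L f)" if u: "u \<in> pure" "\<And>x. x \<in> B \<Longrightarrow> u x = x" for u
    proof -
      let ?s = "inv\<^bsub>Homeo X\<^esub> \<tau> \<otimes>\<^bsub>Homeo X\<^esub> (u \<otimes>\<^bsub>Homeo X\<^esub> \<tau>)"
      have "?s x = x" if "x \<in> A" for x
        using \<tau>A[OF that] u(2) \<tau>(1) As[OF that] by simp
      then have "L ?s \<le> 1"
        using LA \<tau>(1) u(1) by simp
      then have "L (u \<otimes>\<^bsub>Homeo X\<^esub> \<tau>) \<le> 1 + L \<tau>"
        using LD(5)[of \<tau> "u \<otimes>\<^bsub>Homeo X\<^esub> \<tau>"] \<tau>(1) u(1) by simp
      moreover have "L u \<le> L (u \<otimes>\<^bsub>Homeo X\<^esub> \<tau>) + L \<tau>"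
      proof -
        have "u = (u \<otimes>\<^bsub>Homeo X\<^esub> \<tau>) \<otimes>\<^bsub>Homeo X\<^esub> inv\<^bsub>Homeo X\<^esub> \<tau>"
          using u(1) \<tau>(1) by (simp add: Homeo.m_assoc)
        then show ?thesis
          using LD(1)[of "u \<otimes>\<^bsub>Homeo X\<^esub> \<tau>" "inv\<^bsub>Homeo X\<^esub> \<tau>"] LD(3)[of \<tau> \<tau>] u(1) \<tau>(1) by simp
      qed
      ultimately show ?thesis using \<tau>(2) by simp
    qed
    have cB: "clopen B" using clopen_homeoD(2)[OF l(1)] .
    have Bs: "x \<in> topspace X" if "x \<in> B" for x
      using clopen_subset[OF cB] that by auto
    \<comment> \<open>The image of \<open>A\<close> under \<open>g\<close> may overlap
      \<open>A\<close>, so the two are not exchanged directly but through a third set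
      \<open>C\<close>. Both exchanges fix \<open>B\<close> pointwise.\<close>
    obtain C m where m: "clopen_homeo (g ` A) C m" "C \<inter> (g ` A \<union> A \<union> B) = {}"
      "\<And>x. x \<in> g ` A \<Longrightarrow> base (m x) = base x"
      by (rule pure_copy[OF gA, of "g ` A \<union> A \<union> B"]) (use A gA cB l(3) in auto)
    obtain u1 where u1: "u1 \<in> pure" "\<And>x. x \<in> g ` A \<Longrightarrow> u1 x = m x"
      "\<And>x. x \<in> topspace X \<Longrightarrow> x \<notin> g ` A \<Longrightarrow> x \<notin> C \<Longrightarrow> u1 x = x"
      by (rule pure_swap[OF m(1) _ m(3)]) (use m(2) in auto)
    have w: "clopen_homeo A C (\<lambda>x. m (g x))"
      using clopen_homeo_comp[OF clopen_homeo_restrict[OF Homeo_clopen_homeo[OF gc] A(1) clopen_subset[OF A(1)]] m(1)] .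
    obtain u2 where u2: "u2 \<in> pure" "\<And>x. x \<in> A \<Longrightarrow> u2 (m (g x)) = x"
      "\<And>x. x \<in> topspace X \<Longrightarrow> x \<notin> A \<Longrightarrow> x \<notin> C \<Longrightarrow> u2 x = x"
    proof (rule pure_swap[OF w])
      show "A \<inter> C = {}" using m(2) by auto
      show "base (m (g x)) = base x" if "x \<in> A" for x
        using m(3)[of "g x"] that pure_base[OF g] As by simp
    qed (rule that)
    have "L u1 \<le> 1 + 2 * (1 + L f)"
      by (rule LB[OF u1(1)]) (use u1(3) Bs l(2) m(2) in blast)
    moreover have "L u2 \<le> 1 + 2 * (1 + L f)"
      by (rule LB[OF u2(1)]) (use u2(3) Bs l(2) m(2) in blast)
    moreover have "L (u2 \<otimes>\<^bsub>Homeo X\<^esub> (u1 \<otimes>\<^bsub>Homeo X\<^esub> g)) \<le> 1"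
      by (rule LA) (use u1(1,2) u2(1,2) g As in simp_all)
    moreover have "L g \<le> L u1 + L (u1 \<otimes>\<^bsub>Homeo X\<^esub> g)"
      "L (u1 \<otimes>\<^bsub>Homeo X\<^esub> g) \<le> L u2 + L (u2 \<otimes>\<^bsub>Homeo X\<^esub> (u1 \<otimes>\<^bsub>Homeo X\<^esub> g))"
      using LD(4)[of u1 g] LD(4)[of u2 "u1 \<otimes>\<^bsub>Homeo X\<^esub> g"] u1(1) u2(1) g by simp_all
    ultimately show ?thesis by simp
  qed
  then show thesis using that by blast
qed

text \<open>The stabiliser of \<open>base\<close> is a finite union of cosets of \<open>pure\<close>.\<close>

lemma length_bounded_stab:
  assumes L: "length_fun L"
  obtains c where "\<And>g. g \<in> carrier (Homeo X) \<Longrightarrow> intertwines g base base \<Longrightarrow> L g \<le> c"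
proof -
  note LD = length_funD[OF L]
  obtain c where c: "\<And>g. g \<in> pure \<Longrightarrow> L g \<le> c"
    using length_bounded_pure[OF L] by blast
  define S where "S = {g \<in> carrier (Homeo X). intertwines g base base}"
  let ?R = "\<lambda>g. restrict g top_points"
  have "?R ` S \<subseteq> top_points \<rightarrow>\<^sub>E top_points"
    by (auto simp: S_def)
  then have "finite (?R ` S)"
    using finite_PiE[OF finite_top_points finite_top_points] finite_subset by blast
  then obtain F where F: "F \<subseteq> S" "finite F" "?R ` S = ?R ` F"
    using finite_subset_image[of "?R ` S" ?R S] by blast
  \<comment> \<open>Lengths are nonnegative, so the sum dominates that of each coset representative
    in \<open>F\<close>.\<close>
  have "L g \<le> (\<Sum>v\<in>F. L v) + c" if g: "g \<in> S" for g
  proof -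
    have "?R g \<in> ?R ` F"
      using g F(3) by blast
    then obtain v where v: "v \<in> F" "?R g = ?R v"
      by auto
    have gv: "g \<in> carrier (Homeo X)" "v \<in> carrier (Homeo X)" "intertwines g base base" "intertwines v base base"
      using g v(1) F(1) by (auto simp: S_def)
    define w where "w = inv\<^bsub>Homeo X\<^esub> v \<otimes>\<^bsub>Homeo X\<^esub> g"
    have w: "w \<in> carrier (Homeo X)" "intertwines w base base"
      using gv intertwines_comp[OF gv(1) retr_base gv(3) intertwines_inv[OF gv(2) retr_base gv(4)]]
      by (auto simp: w_def)
    have "w t = t" if "t \<in> top_points" for t
      using fun_cong[OF v(2), of t] that gv top_points_subset by (simp add: w_def)
    then have "w \<in> pure"
      using w baseD(1) by (intro pureI) (simp_all add: intertwines_def)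
    then have "L w \<le> c" using c by blast
    moreover have "L v \<le> (\<Sum>v\<in>F. L v)"
      using F(1,2) v(1) LD(2) by (intro member_le_sum) (auto simp: S_def)
    ultimately show ?thesis
      using LD(5)[OF gv(2,1)] by (simp add: w_def)
  qed
  then show thesis
    using that[of "(\<Sum>v\<in>F. L v) + c"] unfolding S_def by blast
qed

subsection \<open>Distances between retractions\<close>

text \<open>Retractions correspond to the cosets of the stabiliser of \<open>base\<close>, and
  \<open>c\<close> bounds the distance between arbitrary representatives of two cosets. A bound for
  all choices, instead of a distance between chosen representatives, is invariant under the group
  and additive along chains.\<close>

definition cost :: "(('a \<Rightarrow> 'a) \<Rightarrow> real) \<Rightarrow> ('a \<Rightarrow> 'a) \<Rightarrow> ('a \<Rightarrow> 'a) \<Rightarrow> real \<Rightarrow> bool" where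
  "cost L r1 r2 c \<longleftrightarrow> (\<forall>g\<in>carrier (Homeo X). \<forall>h\<in>carrier (Homeo X).
     intertwines g base r1 \<longrightarrow> intertwines h base r2 \<longrightarrow> L (inv\<^bsub>Homeo X\<^esub> g \<otimes>\<^bsub>Homeo X\<^esub> h) \<le> c)"

lemma costD:
  "cost L r1 r2 c \<Longrightarrow> g \<in> carrier (Homeo X) \<Longrightarrow> h \<in> carrier (Homeo X) \<Longrightarrow> intertwines g base r1 \<Longrightarrow>
    intertwines h base r2 \<Longrightarrow> L (inv\<^bsub>Homeo X\<^esub> g \<otimes>\<^bsub>Homeo X\<^esub> h) \<le> c"
  by (simp add: cost_def)

lemma cost_mono: "cost L r1 r2 c \<Longrightarrow> c \<le> d \<Longrightarrow> cost L r1 r2 d"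
  by (force simp: cost_def)

lemma cost_cong:
  assumes "cost L r1 r2 c" "\<And>x. x \<in> topspace X \<Longrightarrow> r2 x = r3 x"
  shows "cost L r1 r3 c"
  using assms by (auto simp: cost_def intertwines_def)

lemma cost_trans:
  assumes L: "length_fun L" and "cost L r1 r2 c" "cost L r2 r3 d" "retr r2"
  shows "cost L r1 r3 (c + d)"
  unfolding cost_def
proof (intro ballI impI)
  fix g h assume gh: "g \<in> carrier (Homeo X)" "h \<in> carrier (Homeo X)" "intertwines g base r1"
    "intertwines h base r3"
  obtain k where k: "k \<in> carrier (Homeo X)" "intertwines k base r2"
    using intertwines_ex[OF retr_base \<open>retr r2\<close>] by blast
  have "inv\<^bsub>Homeo X\<^esub> g \<otimes>\<^bsub>Homeo X\<^esub> h =
    (inv\<^bsub>Homeo X\<^esub> g \<otimes>\<^bsub>Homeo X\<^esub> k) \<otimes>\<^bsub>Homeo X\<^esub> (inv\<^bsub>Homeo X\<^esub> k \<otimes>\<^bsub>Homeo X\<^esub> h)"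
    using gh k by (simp add: Homeo.m_assoc Homeo_cancel)
  then show "L (inv\<^bsub>Homeo X\<^esub> g \<otimes>\<^bsub>Homeo X\<^esub> h) \<le> c + d"
    using length_funD(1)[OF L, of "inv\<^bsub>Homeo X\<^esub> g \<otimes>\<^bsub>Homeo X\<^esub> k" "inv\<^bsub>Homeo X\<^esub> k \<otimes>\<^bsub>Homeo X\<^esub> h"]
      costD[OF assms(2) gh(1) k(1) gh(3) k(2)] costD[OF assms(3) k(1) gh(2) k(2) gh(4)] gh k
    by simp
qed

lemma cost_invariant:
  assumes "cost L r1 r2 c" and k: "k \<in> carrier (Homeo X)" "intertwines k r1 s1" "intertwines k r2 s2"
    and r: "retr r1" "retr r2"
  shows "cost L s1 s2 c"
  unfolding cost_def
proof (intro ballI impI)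
  fix g h assume gh: "g \<in> carrier (Homeo X)" "h \<in> carrier (Homeo X)" "intertwines g base s1"
    "intertwines h base s2"
  let ?g = "inv\<^bsub>Homeo X\<^esub> k \<otimes>\<^bsub>Homeo X\<^esub> g" and ?h = "inv\<^bsub>Homeo X\<^esub> k \<otimes>\<^bsub>Homeo X\<^esub> h"
  have "intertwines ?g base r1" "intertwines ?h base r2"
    using intertwines_comp[OF gh(1) retr_base gh(3) intertwines_inv[OF k(1) r(1) k(2)]]
      intertwines_comp[OF gh(2) retr_base gh(4) intertwines_inv[OF k(1) r(2) k(3)]] .
  then have "L (inv\<^bsub>Homeo X\<^esub> ?g \<otimes>\<^bsub>Homeo X\<^esub> ?h) \<le> c"
    using costD[OF assms(1)] gh k by simp
  moreover have "inv\<^bsub>Homeo X\<^esub> ?g \<otimes>\<^bsub>Homeo X\<^esub> ?h = inv\<^bsub>Homeo X\<^esub> g \<otimes>\<^bsub>Homeo X\<^esub> h"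
    using gh k by (simp add: Homeo.inv_mult_group Homeo.m_assoc Homeo_cancel)
  ultimately show "L (inv\<^bsub>Homeo X\<^esub> g \<otimes>\<^bsub>Homeo X\<^esub> h) \<le> c"
    by simp
qed

text \<open>Any other representatives of the two cosets differ from the fixed \<open>g\<close> and
  \<open>h\<close> by elements of the stabiliser, each of length at most \<open>b\<close>.\<close>

lemma cost_ex:
  assumes L: "length_fun L" and r: "retr r1" "retr r2"
  obtains c where "0 \<le> c" "cost L r1 r2 c"
proof -
  note LD = length_funD[OF L]
  obtain b where b: "\<And>g. g \<in> carrier (Homeo X) \<Longrightarrow> intertwines g base base \<Longrightarrow> L g \<le> b"
    using length_bounded_stab[OF L] by blast
  have refl: "cost L s s b" if "retr s" for s
    unfolding cost_def
    using b intertwines_comp[OF _ retr_base _ intertwines_inv[OF _ retr_base]] by simp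
  obtain g h where g: "g \<in> carrier (Homeo X)" "intertwines g base r1"
    and h: "h \<in> carrier (Homeo X)" "intertwines h base r2"
    using intertwines_ex[OF retr_base] r by metis
  have "L (inv\<^bsub>Homeo X\<^esub> g' \<otimes>\<^bsub>Homeo X\<^esub> h') \<le> b + (L (inv\<^bsub>Homeo X\<^esub> g \<otimes>\<^bsub>Homeo X\<^esub> h) + b)"
    if g': "g' \<in> carrier (Homeo X)" "intertwines g' base r1"
      and h': "h' \<in> carrier (Homeo X)" "intertwines h' base r2" for g' h'
  proof -
    have "L (inv\<^bsub>Homeo X\<^esub> g' \<otimes>\<^bsub>Homeo X\<^esub> g) \<le> b" "L (inv\<^bsub>Homeo X\<^esub> h \<otimes>\<^bsub>Homeo X\<^esub> h') \<le> b"
      using costD[OF refl[OF r(1)] g'(1) g(1) g'(2) g(2)] costD[OF refl[OF r(2)] h(1) h'(1) h(2) h'(2)] .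
    moreover have "inv\<^bsub>Homeo X\<^esub> g' \<otimes>\<^bsub>Homeo X\<^esub> h' = (inv\<^bsub>Homeo X\<^esub> g' \<otimes>\<^bsub>Homeo X\<^esub> g) \<otimes>\<^bsub>Homeo X\<^esub>
      ((inv\<^bsub>Homeo X\<^esub> g \<otimes>\<^bsub>Homeo X\<^esub> h) \<otimes>\<^bsub>Homeo X\<^esub> (inv\<^bsub>Homeo X\<^esub> h \<otimes>\<^bsub>Homeo X\<^esub> h'))"
      using g g' h h' by (simp add: Homeo.m_assoc Homeo_cancel)
    ultimately show ?thesis
      using LD(1)[of "inv\<^bsub>Homeo X\<^esub> g' \<otimes>\<^bsub>Homeo X\<^esub> g"
          "(inv\<^bsub>Homeo X\<^esub> g \<otimes>\<^bsub>Homeo X\<^esub> h) \<otimes>\<^bsub>Homeo X\<^esub> (inv\<^bsub>Homeo X\<^esub> h \<otimes>\<^bsub>Homeo X\<^esub> h')"]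
        LD(1)[of "inv\<^bsub>Homeo X\<^esub> g \<otimes>\<^bsub>Homeo X\<^esub> h" "inv\<^bsub>Homeo X\<^esub> h \<otimes>\<^bsub>Homeo X\<^esub> h'"] g g' h h'
      by simp
  qed
  then have "cost L r1 r2 (max 0 (b + (L (inv\<^bsub>Homeo X\<^esub> g \<otimes>\<^bsub>Homeo X\<^esub> h) + b)))"
    unfolding cost_def by (meson max.coboundedI2)
  then show thesis
    using that by (metis max.cobounded1)
qed

text \<open>
  All moves of a cone of rank \<open>\<gamma>\<close> between two given fibres form a single orbit.
\<close>

lemma cost_move_cone:
  assumes L: "length_fun L" and \<gamma>: "\<gamma> < \<alpha>"
  obtains c where "0 \<le> c" "\<And>r p q D d. retr r \<Longrightarrow> p \<in> top_points \<Longrightarrow> q \<in> top_points \<Longrightarrow> cone D d \<Longrightarrow>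
    rk d = \<gamma> \<Longrightarrow> D \<subseteq> {x \<in> topspace X. r x = p} \<Longrightarrow> cost L r (\<lambda>x. if x \<in> D then q else r x) c"
proof -
  have disj: "D \<inter> top_points = {}" if "cone D d" "rk d = \<gamma>" for D d
    using coneD(4)[OF that(1)] that(2) \<gamma> rank_top_points by (metis disjoint_iff leD)
  define Q where "Q p q c \<longleftrightarrow> 0 \<le> c \<and> (\<forall>r D d. retr r \<longrightarrow> cone D d \<longrightarrow> rk d = \<gamma> \<longrightarrow>
    D \<subseteq> {x \<in> topspace X. r x = p} \<longrightarrow> cost L r (\<lambda>x. if x \<in> D then q else r x) c)" for p q c
  have "\<exists>c. Q p q c" if pq: "p \<in> top_points" "q \<in> top_points" for p q
  proof (cases "\<exists>r D d. retr r \<and> cone D d \<and> rk d = \<gamma> \<and> D \<subseteq> {x \<in> topspace X. r x = p}")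
    case False
    then show ?thesis unfolding Q_def by (intro exI[of _ 0]) auto
  next
    case True
    then obtain r1 D1 d1 where 1: "retr r1" "cone D1 d1" "rk d1 = \<gamma>" "D1 \<subseteq> {x \<in> topspace X. r1 x = p}"
      by blast
    have u1: "retr (\<lambda>x. if x \<in> D1 then q else r1 x)"
      using retr_update[OF 1(1) coneD(1)[OF 1(2)] disj[OF 1(2,3)] pq(2)] .
    \<comment> \<open>One model move determines the constant for \<open>p\<close> and
      \<open>q\<close>: every other move is its translate by a homeomorphism that carries
      \<open>D1\<close> to \<open>D\<close> and fixes \<open>q\<close>.\<close>
    obtain c where c: "0 \<le> c" "cost L r1 (\<lambda>x. if x \<in> D1 then q else r1 x) c"
      using cost_ex[OF L 1(1) u1] by blast
    have "cost L r (\<lambda>x. if x \<in> D then q else r x) c"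
      if 2: "retr r" "cone D d" "rk d = \<gamma>" "D \<subseteq> {x \<in> topspace X. r x = p}" for r D d
    proof -
      obtain k where k: "clopen_homeo D1 D k"
        using cone_homeo[OF 1(2) 2(2)] 1(3) 2(3) by auto
      have sub: "D1 \<subseteq> {x \<in> topspace X. r1 x = p} - {p}" "D \<subseteq> {x \<in> topspace X. r x = p} - {p}"
        using 1(4) 2(4) disj[OF 1(2,3)] disj[OF 2(2,3)] pq(1) by auto
      obtain g where g: "g \<in> carrier (Homeo X)" "intertwines g r1 r"
        "\<And>x. x \<in> topspace X \<Longrightarrow> g x \<in> D \<longleftrightarrow> x \<in> D1" "\<And>x. x \<in> topspace X \<Longrightarrow> r (g x) = r1 x"
        by (rule retr_pair_homeo[OF 1(1) 2(1) pq(1) sub k]) (rule that)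
      have "g q = q"
      proof -
        have "r (g q) = g q"
          by (rule retrD(2)[OF 2(1) Homeo_top_points[OF g(1) pq(2)]])
        then show ?thesis
          using g(4)[OF top_points_subset[OF pq(2)]] retrD(2)[OF 1(1) pq(2)] by simp
      qed
      then have "intertwines g (\<lambda>x. if x \<in> D1 then q else r1 x) (\<lambda>x. if x \<in> D then q else r x)"
        using g(2) unfolding intertwines_def by (simp add: g(3))
      then show ?thesis
        by (rule cost_invariant[OF c(2) g(1,2) _ 1(1) u1])
    qed
    then have "Q p q c" unfolding Q_def using c(1) by simp
    then show ?thesis by blast
  qed
  then obtain c where c: "\<And>p q. p \<in> top_points \<Longrightarrow> q \<in> top_points \<Longrightarrow> Q p q (c p q)"
    by metis
  define C where "C = (\<Sum>(p, q)\<in>top_points \<times> top_points. c p q)"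
  have cC: "c p q \<le> C" if "p \<in> top_points" "q \<in> top_points" for p q
    using member_le_sum[of "(p, q)" "top_points \<times> top_points" "\<lambda>(p, q). c p q"] that c finite_top_points
    by (auto simp: C_def Q_def)
  have "0 \<le> C"
    unfolding C_def by (intro sum_nonneg) (use c in \<open>auto simp: Q_def\<close>)
  then show thesis
  proof (rule that)
    fix r p q D d
    assume *: "retr r" "p \<in> top_points" "q \<in> top_points" "cone D d" "rk d = \<gamma>"
      "D \<subseteq> {x \<in> topspace X. r x = p}"
    then have "cost L r (\<lambda>x. if x \<in> D then q else r x) (c p q)"
      using c[OF *(2,3)] unfolding Q_def by simp
    then show "cost L r (\<lambda>x. if x \<in> D then q else r x) C"
      by (rule cost_mono[OF _ cC[OF *(2,3)]])
  qed
qed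

text \<open>Each point of rank \<gamma> in \<open>D\<close> is moved with a cone around it at price
  \<open>c\<close>. What remains has rank below \<gamma> and takes two more moves, whence the
  summand 2.\<close>

lemma cost_move_clopen:
  assumes L: "length_fun L" and \<gamma>: "\<gamma> < \<alpha>"
  obtains c where "0 \<le> c" "\<And>r p q D. retr r \<Longrightarrow> p \<in> top_points \<Longrightarrow> q \<in> top_points \<Longrightarrow> clopen D \<Longrightarrow>
    (\<And>y. y \<in> D \<Longrightarrow> rk y \<le> \<gamma>) \<Longrightarrow> D \<subseteq> {x \<in> topspace X. r x = p} \<Longrightarrow>
    cost L r (\<lambda>x. if x \<in> D then q else r x) (c * (real (card {y \<in> D. rk y = \<gamma>}) + 2))"
proof -
  obtain c where c: "0 \<le> c" "\<And>r p q D d. retr r \<Longrightarrow> p \<in> top_points \<Longrightarrow> q \<in> top_points \<Longrightarrow> cone D d \<Longrightarrow>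
    rk d = \<gamma> \<Longrightarrow> D \<subseteq> {x \<in> topspace X. r x = p} \<Longrightarrow> cost L r (\<lambda>x. if x \<in> D then q else r x) c"
    using cost_move_cone[OF assms] by blast
  have disj: "D \<inter> top_points = {}" if "\<And>y. y \<in> D \<Longrightarrow> rk y \<le> \<gamma>" for D
    using that \<gamma> rank_top_points by (metis disjoint_iff leD)
  have "cost L r (\<lambda>x. if x \<in> D then q else r x) (c * (real (card {y \<in> D. rk y = \<gamma>}) + 2))"
    if "retr r" "p \<in> top_points" "q \<in> top_points" "clopen D"
      "\<And>y. y \<in> D \<Longrightarrow> rk y \<le> \<gamma>" "D \<subseteq> {x \<in> topspace X. r x = p}" for r p q D
    using that
  proof (induction "card {y \<in> D. rk y = \<gamma>}" arbitrary: D r)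
    case 0
    note D = 0(2-)
    note fin = finite_max_rank[OF D(4,5)]
    have lt: "rk y < \<gamma>" if "y \<in> D" for y
      using fin 0(1) D(5)[OF that] that by auto
    let ?F = "{x \<in> topspace X. r x = p} - D"
    have "openin X ?F" "p \<in> ?F"
      using clopen_openin[OF clopen_Diff[OF retr_clopen[OF D(1)] D(4)]] disj[OF D(5)] D(2)
        retrD(2)[OF D(1,2)] top_points_subset by auto
    then obtain e where e: "e \<in> ?F" "rk e = \<gamma>"
      using rk_attained[of ?F p \<gamma>] rank_top_points[OF D(2)] \<gamma> by auto
    obtain E where E: "cone E e" "E \<subseteq> ?F"
      using cone_ex[OF \<open>openin X ?F\<close> e(1)] by blast
    let ?r1 = "\<lambda>x. if x \<in> D \<union> E then q else r x"
    let ?r2 = "\<lambda>x. if x \<in> E then p else ?r1 x"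
    \<comment> \<open>The ranks in \<open>D\<close> are below that of \<open>e\<close>, so
      \<open>D\<close> disappears into a cone: the bound for moving the union is the one for moving
      \<open>E\<close>.\<close>
    have DE: "cone (D \<union> E) e"
      using E D(4) lt e(2) by (auto simp: cone_def)
    have sub: "D \<union> E \<subseteq> {x \<in> topspace X. r x = p}"
      using D(6) E(2) by auto
    have "(D \<union> E) \<inter> top_points = {}"
      by (rule disj) (use D(5) coneD(4)[OF E(1)] e(2) in auto)
    then have r1: "retr ?r1"
      using retr_update[OF D(1) coneD(1)[OF DE] _ D(3)] by simp
    have 1: "cost L r ?r1 c"
      using c(2)[OF D(1-3) DE e(2) sub] .
    have 2: "cost L ?r1 ?r2 c"
      by (rule c(2)[OF r1 D(3,2) E(1) e(2)]) (use sub in auto)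
    have 3: "cost L r (\<lambda>x. if x \<in> D then q else r x) (c + c)"
      by (rule cost_cong[OF cost_trans[OF L 1 2 r1]]) (use E(2) in auto)
    have "c * (real (card {y \<in> D. rk y = \<gamma>}) + 2) = c + c"
      unfolding 0(1)[symmetric] by simp
    then show ?case using 3 by (simp only:)
  next
    case (Suc n)
    note D = Suc(3-)
    note fin = finite_max_rank[OF D(4,5)]
    obtain e where e: "e \<in> D" "rk e = \<gamma>"
      using Suc(2) by (metis (mono_tags, lifting) Collect_empty_eq card.empty nat.distinct(1))
    obtain E where E: "cone E e" "E \<subseteq> D"
      using cone_ex[OF clopen_openin[OF D(4)] e(1)] by blast
    have "rk y \<noteq> \<gamma>" if "y \<in> E" "y \<noteq> e" for y
      using coneD(3)[OF E(1) that] e(2) by simp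
    then have eq: "{y \<in> D. rk y = \<gamma>} = insert e {y \<in> D - E. rk y = \<gamma>}"
      using e E(2) coneD(2)[OF E(1)] by auto
    have card: "card {y \<in> D. rk y = \<gamma>} = Suc (card {y \<in> D - E. rk y = \<gamma>})"
      unfolding eq using finite_subset[OF _ fin, of "{y \<in> D - E. rk y = \<gamma>}"] coneD(2)[OF E(1)]
      by (subst card_insert_disjoint) auto
    have cDE: "clopen (D - E)"
      using D(4) coneD(1)[OF E(1)] by blast
    let ?r1 = "\<lambda>x. if x \<in> D - E then q else r x"
    let ?r2 = "\<lambda>x. if x \<in> E then q else ?r1 x"
    have 1: "cost L r ?r1 (c * (real (card {y \<in> D - E. rk y = \<gamma>}) + 2))"
      by (rule Suc(1)[OF _ D(1-3) cDE]) (use Suc(2) card D(5,6) in auto)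
    have r1: "retr ?r1"
      by (rule retr_update[OF D(1) cDE _ D(3)]) (use disj[OF D(5)] in blast)
    have 2: "cost L ?r1 ?r2 c"
      by (rule c(2)[OF r1 D(2,3) E(1) e(2)]) (use E(2) D(6) in auto)
    have "cost L r (\<lambda>x. if x \<in> D then q else r x) (c * (real (card {y \<in> D - E. rk y = \<gamma>}) + 2) + c)"
      by (rule cost_cong[OF cost_trans[OF L 1 2 r1]]) (use E(2) in auto)
    then show ?case
      by (simp add: card algebra_simps)
  qed
  then show thesis using that c(1) by blast
qed

text \<open>The set where \<open>r\<close> and \<open>base\<close> differ splits according to the
  pair of their values into finitely many clopen pieces, each moved at once. Only the counts of rank
  \<gamma> depend on \<open>r\<close>; the overhead of \<open>2 * c\<close> per pair goes into
  \<open>C\<close>.\<close>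

lemma cost_base:
  assumes L: "length_fun L" and \<gamma>: "\<gamma> < \<alpha>"
  obtains K C where "0 \<le> K" "\<And>r. retr r \<Longrightarrow> (\<And>x. x \<in> topspace X \<Longrightarrow> r x \<noteq> base x \<Longrightarrow> rk x \<le> \<gamma>) \<Longrightarrow>
    cost L base r (K * real (card {x \<in> topspace X. r x \<noteq> base x \<and> rk x = \<gamma>}) + C)"
proof -
  obtain c where c: "0 \<le> c" "\<And>r p q D. retr r \<Longrightarrow> p \<in> top_points \<Longrightarrow> q \<in> top_points \<Longrightarrow> clopen D \<Longrightarrow>
    (\<And>y. y \<in> D \<Longrightarrow> rk y \<le> \<gamma>) \<Longrightarrow> D \<subseteq> {x \<in> topspace X. r x = p} \<Longrightarrow>
    cost L r (\<lambda>x. if x \<in> D then q else r x) (c * (real (card {y \<in> D. rk y = \<gamma>}) + 2))"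
    using cost_move_clopen[OF assms] by blast
  \<comment> \<open>Distinct elements may represent \<open>base\<close>, so even the trivial move
    has a price.\<close>
  obtain c0 where c0: "0 \<le> c0" "cost L base base c0"
    using cost_ex[OF L retr_base retr_base] by blast
  define P where "P = {(s, t) \<in> top_points \<times> top_points. s \<noteq> t}"
  have finP: "finite P"
    unfolding P_def by (rule finite_subset[OF _ finite_cartesian_product[OF finite_top_points finite_top_points]]) auto
  have "cost L base r (c * real (card {x \<in> topspace X. r x \<noteq> base x \<and> rk x = \<gamma>}) + (2 * c * real (card P) + c0))"
    if r: "retr r" and rank: "\<And>x. x \<in> topspace X \<Longrightarrow> r x \<noteq> base x \<Longrightarrow> rk x \<le> \<gamma>" for r
  proof -
    \<comment> \<open>The retraction after the pieces with index in \<open>Q\<close> have been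
      moved.\<close>
    let ?r = "\<lambda>Q x. if (base x, r x) \<in> Q then r x else base x"
    let ?W = "\<lambda>Q. {x \<in> topspace X. (base x, r x) \<in> Q \<and> rk x = \<gamma>}"
    have clW: "clopen {x \<in> topspace X. base x = s \<and> r x = t}" for s t
      by (rule retr_clopen2[OF retr_base r])
    have "retr (?r Q) \<and> cost L base (?r Q) (c * (real (card (?W Q)) + 2 * real (card Q)) + c0)"
      if "finite Q" "Q \<subseteq> P" for Q
      using that
    proof (induction Q rule: finite_induct)
      case empty
      then show ?case using c0(2) retr_base by simp
    next
      case (insert pq Q)
      obtain p q where pq: "pq = (p, q)" by (cases pq)
      then have pq': "p \<in> top_points" "q \<in> top_points" "p \<noteq> q"
        using insert.prems by (auto simp: P_def)
      let ?D = "{x \<in> topspace X. base x = p \<and> r x = q}"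
      have IH: "retr (?r Q)" "cost L base (?r Q) (c * (real (card (?W Q)) + 2 * real (card Q)) + c0)"
        using insert by auto
      have rD: "rk y \<le> \<gamma>" if "y \<in> ?D" for y
        using that rank pq'(3) by auto
      have D: "?D \<inter> top_points = {}"
        using rD \<gamma> rank_top_points by (metis (lifting) disjoint_iff leD)
      have e: "(if x \<in> ?D then q else ?r Q x) = ?r (insert pq Q) x" if "x \<in> topspace X" for x
        using that by (auto simp: pq)
      have 1: "retr (\<lambda>x. if x \<in> ?D then q else ?r Q x)"
        using retr_update[OF IH(1) clW D pq'(2)] .
      have 2: "cost L (?r Q) (\<lambda>x. if x \<in> ?D then q else ?r Q x) (c * (real (card {y \<in> ?D. rk y = \<gamma>}) + 2))"
        by (rule c(2)[OF IH(1) pq'(1,2) clW rD]) (use insert.hyps(2) in \<open>auto simp: pq\<close>)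
      have finW: "finite (?W R)" if "R \<subseteq> P" for R
      proof -
        have "?W R \<subseteq> (\<Union>(s, t)\<in>P. {x \<in> {x \<in> topspace X. base x = s \<and> r x = t}. rk x = \<gamma>})"
          using that by auto
        moreover have "finite {x \<in> {x \<in> topspace X. base x = s \<and> r x = t}. rk x = \<gamma>}" if "(s, t) \<in> P" for s t
          by (rule finite_max_rank[OF clW]) (use rank that in \<open>auto simp: P_def\<close>)
        then have "finite (\<Union>(s, t)\<in>P. {x \<in> {x \<in> topspace X. base x = s \<and> r x = t}. rk x = \<gamma>})"
          by (intro finite_UN_I[OF finP]) (auto split: prod.splits)
        ultimately show ?thesis
          by (rule finite_subset)
      qed
      have "?W (insert pq Q) = ?W Q \<union> {y \<in> ?D. rk y = \<gamma>}"
        by (auto simp: pq)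
      moreover have "?W Q \<inter> {y \<in> ?D. rk y = \<gamma>} = {}"
        using insert.hyps(2) by (auto simp: pq)
      moreover have "finite {y \<in> ?D. rk y = \<gamma>}"
        by (rule finite_max_rank[OF clW rD])
      ultimately have "card (?W (insert pq Q)) = card (?W Q) + card {y \<in> ?D. rk y = \<gamma>}"
        using finW[of Q] insert.prems by (simp add: card_Un_disjoint)
      then have 3: "c * (real (card (?W Q)) + 2 * real (card Q)) + c0 + c * (real (card {y \<in> ?D. rk y = \<gamma>}) + 2) =
        c * (real (card (?W (insert pq Q))) + 2 * real (card (insert pq Q))) + c0"
        using insert.hyps by (simp add: algebra_simps)
      have "cost L base (?r (insert pq Q)) (c * (real (card (?W (insert pq Q))) + 2 * real (card (insert pq Q))) + c0)"
        unfolding 3[symmetric] by (rule cost_cong[OF cost_trans[OF L IH(2) 2 IH(1)] e])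
      moreover have "retr (?r (insert pq Q))"
        using 1 e by (auto simp: retr_def pq top_points_subset cong: conj_cong)
      ultimately show ?case by blast
    qed
    from this[OF finP order_refl]
    have "cost L base (?r P) (c * (real (card (?W P)) + 2 * real (card P)) + c0)" by blast
    moreover have "?W P = {x \<in> topspace X. r x \<noteq> base x \<and> rk x = \<gamma>}"
      using baseD(1) retrD(1)[OF r] by (auto simp: P_def)
    ultimately have "cost L base (?r P) (c * real (card {x \<in> topspace X. r x \<noteq> base x \<and> rk x = \<gamma>}) + (2 * c * real (card P) + c0))"
      by (simp add: algebra_simps)
    then show ?thesis
      by (rule cost_cong) (use baseD(1) retrD(1)[OF r] in \<open>auto simp: P_def\<close>)
  qed
  then show thesis using that c(1) by blast
qed

text \<open>The preimage under \<open>g\<close> of the set where \<open>base\<close> differs from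
  its conjugate by \<open>g\<close>.\<close>

definition defect :: "('a \<Rightarrow> 'a) \<Rightarrow> 'a set" where
  "defect g = {x \<in> topspace X. base (g x) \<noteq> g (base x)}"

text \<open>\<open>base\<close> is represented by the identity and its conjugate by
  \<open>g\<close>, so the cost from one to the other bounds \<open>L g\<close>. The free \<gamma>
  serves two uses: for a successor \<alpha> it is the predecessor, where the condition on ranks
  always holds; for a limit it is chosen above all ranks that occur, so that the count is 0.\<close>

theorem length_bound:
  assumes L: "length_fun L" and \<gamma>: "\<gamma> < \<alpha>"
  shows "\<exists>K C. \<forall>g\<in>carrier (Homeo X). (\<forall>x\<in>defect g. rk x \<le> \<gamma>) \<longrightarrow>
    L g \<le> K * real (card {x \<in> defect g. rk x = \<gamma>}) + C"
proof -
  obtain K C where KC: "0 \<le> K" "\<And>r. retr r \<Longrightarrow> (\<And>x. x \<in> topspace X \<Longrightarrow> r x \<noteq> base x \<Longrightarrow> rk x \<le> \<gamma>) \<Longrightarrow>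
    cost L base r (K * real (card {x \<in> topspace X. r x \<noteq> base x \<and> rk x = \<gamma>}) + C)"
    using cost_base[OF assms] by blast
  have "L g \<le> K * real (card {x \<in> defect g. rk x = \<gamma>}) + C"
    if g: "g \<in> carrier (Homeo X)" and rank: "\<And>x. x \<in> defect g \<Longrightarrow> rk x \<le> \<gamma>" for g
  proof -
    obtain r where r: "retr r" "intertwines g base r"
      using intertwines_retr_ex[OF g retr_base] by blast
    have img: "\<exists>x\<in>topspace X. y = g x" if "y \<in> topspace X" for y
      using that g Homeo_inv2[OF g that] by (metis Homeo.inv_closed Homeo_mem)
    have rg: "r (g x) = g (base x)" if "x \<in> topspace X" for x
      using r(2) that by (simp add: intertwines_def)
    have "rk y \<le> \<gamma>" if "y \<in> topspace X" "r y \<noteq> base y" for y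
      using img[OF that(1)] that rg rank g by (auto simp: defect_def)
    then have "cost L base r (K * real (card {x \<in> topspace X. r x \<noteq> base x \<and> rk x = \<gamma>}) + C)"
      using KC(2)[OF r(1)] by blast
    moreover have "{x \<in> topspace X. r x \<noteq> base x \<and> rk x = \<gamma>} = g ` {x \<in> defect g. rk x = \<gamma>}"
      using img rg g by (fastforce simp: defect_def)
    moreover have "card (g ` {x \<in> defect g. rk x = \<gamma>}) = card {x \<in> defect g. rk x = \<gamma>}"
      using Homeo_inj[OF g] by (intro card_image inj_onI) (auto simp: defect_def)
    ultimately have "cost L base r (K * real (card {x \<in> defect g. rk x = \<gamma>}) + C)"
      by simp
    then have "L (inv\<^bsub>Homeo X\<^esub> \<one>\<^bsub>Homeo X\<^esub> \<otimes>\<^bsub>Homeo X\<^esub> g) \<le> K * real (card {x \<in> defect g. rk x = \<gamma>}) + C"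
      using costD[OF _ Homeo.one_closed g intertwines_one[OF retr_base] r(2)] by blast
    then show ?thesis using g by simp
  qed
  then have "\<forall>g\<in>carrier (Homeo X). (\<forall>x\<in>defect g. rk x \<le> \<gamma>) \<longrightarrow>
      L g \<le> K * real (card {x \<in> defect g. rk x = \<gamma>}) + C"
    by simp
  then show ?thesis by (intro exI)
qed

end

subsection \<open>The compact-open topology and continuous pseudometrics\<close>

context ranked_space
begin

lemma topspace_Homeo_topology [simp]: "topspace (Homeo_topology X) = carrier (Homeo X)"
proof -
  \<comment> \<open>The subbasic set with \<open>K\<close> and \<open>U\<close> empty is the whole
    group.\<close>
  have "{f \<in> carrier (Homeo X). f ` {} \<subseteq> {}} \<in>
    {{f \<in> carrier (Homeo X). f ` K \<subseteq> U} | K U. compactin X K \<and> openin X U}"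
    by (rule CollectI, rule exI[of _ "{}"], rule exI[of _ "{}"]) simp
  then show ?thesis
    unfolding compact_open_topology_def topology_generated_by_topspace by auto
qed

lemma openin_compact_open:
  "compactin X K \<Longrightarrow> openin X U \<Longrightarrow> openin (Homeo_topology X) {f \<in> carrier (Homeo X). f ` K \<subseteq> U}"
  unfolding compact_open_topology_def by (rule topology_generated_by_Basis) blast

lemma one_in_pure: "\<one>\<^bsub>Homeo X\<^esub> \<in> pure"
  by (rule pureI) simp_all

text \<open>Each top point \<open>p\<close> gets a clopen \<open>W p\<close> inside its fibre, and
  inside \<open>U\<close> or off \<open>K\<close> according to whether \<open>p\<close> is in
  \<open>K\<close>. A pure \<open>s\<close> fixing the complement \<open>A\<close> of their union
  maps the union to itself and respects fibres, so it maps each \<open>W p\<close> to itself; points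
  of \<open>K\<close> in \<open>A\<close> do not move, and the others stay in some
  \<open>W p\<close> contained in \<open>U\<close>.\<close>

lemma basic_nbhd_one:
  assumes K: "compactin X K" and U: "openin X U" and KU: "K \<subseteq> U"
  shows "\<exists>A. clopen A \<and> A \<inter> top_points = {} \<and>
    (\<forall>s\<in>pure. (\<forall>x\<in>A. s x = x) \<longrightarrow> s ` K \<subseteq> U)"
proof -
  have Kc: "closedin X K"
    using K hausdorff compactin_imp_closedin by blast
  let ?V = "\<lambda>p. {x \<in> topspace X. base x = p} \<inter> (if p \<in> K then U else topspace X - K)"
  have "\<forall>p\<in>top_points. \<exists>W. clopen W \<and> p \<in> W \<and> W \<subseteq> ?V p"
  proof
    fix p assume p: "p \<in> top_points"
    have o: "openin X (?V p)"
      using openin_Int[OF baseD(3) U] openin_Int[OF baseD(3) openin_diff[OF openin_topspace Kc]] by simp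
    have "p \<in> ?V p"
      using KU by (simp add: p baseD(2) top_points_subset subset_iff)
    then obtain C where "clopen C" "p \<in> C" "C \<subseteq> ?V p"
      by (rule clopen_nbhd[OF o])
    then show "\<exists>W. clopen W \<and> p \<in> W \<and> W \<subseteq> ?V p" by blast
  qed
  from bchoice[OF this] obtain W where "\<forall>p\<in>top_points. clopen (W p) \<and> p \<in> W p \<and> W p \<subseteq> ?V p" ..
  then have W: "\<And>p. p \<in> top_points \<Longrightarrow> clopen (W p)" "\<And>p. p \<in> top_points \<Longrightarrow> p \<in> W p"
    "\<And>p. p \<in> top_points \<Longrightarrow> W p \<subseteq> ?V p"
    by simp_all
  let ?A = "topspace X - (\<Union>p\<in>top_points. W p)"
  have "clopen ?A"
    by (intro clopen_Diff clopen_topspace clopen_UN finite_top_points W(1))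
  moreover have "?A \<inter> top_points = {}"
    using W(2) by blast
  moreover have "s x \<in> U" if s: "s \<in> pure" "\<And>x. x \<in> ?A \<Longrightarrow> s x = x" and x: "x \<in> K" for s x
  proof (cases "x \<in> ?A")
    case True
    then show ?thesis using s(2) x KU by auto
  next
    case False
    have xX: "x \<in> topspace X"
      using x Kc closedin_subset by blast
    have sx: "s x \<in> topspace X"
      using s(1) xX by simp
    have "s x \<notin> ?A"
    proof
      assume a: "s x \<in> ?A"
      then have "s (s x) = s x" by (rule s(2))
      then have "s x = x"
        using Homeo_inj[OF pure_carrier[OF s(1)] sx xX] by simp
      then show False using a False by simp
    qed
    then obtain p where p: "p \<in> top_points" "x \<in> W p" using False xX by auto
    obtain q where q: "q \<in> top_points" "s x \<in> W q" using \<open>s x \<notin> ?A\<close> sx by auto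
    have "base x = p" "base (s x) = q"
      using subsetD[OF W(3)[OF p(1)] p(2)] subsetD[OF W(3)[OF q(1)] q(2)] by simp_all
    then have "q = p" using pure_base[OF s(1) xX] by simp
    have "p \<in> K"
      using subsetD[OF W(3)[OF p(1)] p(2)] x by (simp split: if_splits)
    then show ?thesis
      using subsetD[OF W(3)[OF q(1)] q(2)] \<open>q = p\<close> by simp
  qed
  ultimately show ?thesis
    by (intro exI[of _ ?A]) blast
qed

lemma nbhd_one:
  assumes "openin (Homeo_topology X) V" "\<one>\<^bsub>Homeo X\<^esub> \<in> V"
  shows "\<exists>A. clopen A \<and> A \<inter> top_points = {} \<and> (\<forall>s\<in>pure. (\<forall>x\<in>A. s x = x) \<longrightarrow> s \<in> V)"
proof -
  have "generate_topology_on {{f \<in> carrier (Homeo X). f ` K \<subseteq> U} | K U. compactin X K \<and> openin X U} V"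
    using assms(1) unfolding compact_open_topology_def openin_topology_generated_by_iff .
  then show ?thesis
    using assms(2)
  proof (induction V rule: generate_topology_on.induct)
    case (Int a b)
    then obtain A B where AB: "clopen A" "A \<inter> top_points = {}" "\<forall>s\<in>pure. (\<forall>x\<in>A. s x = x) \<longrightarrow> s \<in> a"
      "clopen B" "B \<inter> top_points = {}" "\<forall>s\<in>pure. (\<forall>x\<in>B. s x = x) \<longrightarrow> s \<in> b"
      by auto
    show ?case
      by (rule exI[of _ "A \<union> B"]) (use AB in auto)
  next
    case (UN \<K>)
    then obtain k where k: "k \<in> \<K>" "\<one>\<^bsub>Homeo X\<^esub> \<in> k" by blast
    obtain A where "clopen A" "A \<inter> top_points = {}" "\<forall>s\<in>pure. (\<forall>x\<in>A. s x = x) \<longrightarrow> s \<in> k"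
      using UN.IH[OF k] by (elim exE conjE)
    then show ?case using k(1) by (intro exI[of _ A]) blast
  next
    case (Basis s)
    then obtain K U where KU: "s = {f \<in> carrier (Homeo X). f ` K \<subseteq> U}" "compactin X K" "openin X U"
      by blast
    have "\<one>\<^bsub>Homeo X\<^esub> x = x" if "x \<in> K" for x
      using that compactin_subset_topspace[OF KU(2)] by auto
    then have "K \<subseteq> U"
      using Basis(2) KU(1) by force
    from basic_nbhd_one[OF KU(2,3) this] show ?case
      by (elim exE) (rule exI, use KU(1) in auto)
  qed simp
qed

lemma length_fun_pseudometric:
  assumes d: "cont_left_inv_pseudometric (Homeo X) (Homeo_topology X) d"
  shows "length_fun (d \<one>\<^bsub>Homeo X\<^esub>)"
    and "g \<in> carrier (Homeo X) \<Longrightarrow> h \<in> carrier (Homeo X) \<Longrightarrow>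
      d g h = d \<one>\<^bsub>Homeo X\<^esub> (inv\<^bsub>Homeo X\<^esub> g \<otimes>\<^bsub>Homeo X\<^esub> h)"
proof -
  have nonneg: "0 \<le> d x y" and refl: "d x x = 0" and sym: "d x y = d y x"
    if "x \<in> carrier (Homeo X)" "y \<in> carrier (Homeo X)" for x y
    using d that unfolding cont_left_inv_pseudometric_def by blast+
  have tri: "d x z \<le> d x y + d y z"
    if "x \<in> carrier (Homeo X)" "y \<in> carrier (Homeo X)" "z \<in> carrier (Homeo X)" for x y z
    using d that unfolding cont_left_inv_pseudometric_def by blast
  have left: "d (g \<otimes>\<^bsub>Homeo X\<^esub> x) (g \<otimes>\<^bsub>Homeo X\<^esub> y) = d x y"
    if "g \<in> carrier (Homeo X)" "x \<in> carrier (Homeo X)" "y \<in> carrier (Homeo X)" for g x y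
    using d that unfolding cont_left_inv_pseudometric_def by blast
  have cont: "continuous_map (prod_topology (Homeo_topology X) (Homeo_topology X)) euclideanreal (\<lambda>(x, y). d x y)"
    using d unfolding cont_left_inv_pseudometric_def by blast
  show "d g h = d \<one>\<^bsub>Homeo X\<^esub> (inv\<^bsub>Homeo X\<^esub> g \<otimes>\<^bsub>Homeo X\<^esub> h)"
    if "g \<in> carrier (Homeo X)" "h \<in> carrier (Homeo X)"
    using left[of "inv\<^bsub>Homeo X\<^esub> g" g h] that by simp
  show "length_fun (d \<one>\<^bsub>Homeo X\<^esub>)"
    unfolding length_fun_def
  proof (intro conjI ballI)
    fix g h assume gh: "g \<in> carrier (Homeo X)" "h \<in> carrier (Homeo X)"
    show "d \<one>\<^bsub>Homeo X\<^esub> (g \<otimes>\<^bsub>Homeo X\<^esub> h) \<le> d \<one>\<^bsub>Homeo X\<^esub> g + d \<one>\<^bsub>Homeo X\<^esub> h"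
      using tri[of "\<one>\<^bsub>Homeo X\<^esub>" g "g \<otimes>\<^bsub>Homeo X\<^esub> h"] left[of g "\<one>\<^bsub>Homeo X\<^esub>" h] gh by simp
  next
    fix g assume g: "g \<in> carrier (Homeo X)"
    show "0 \<le> d \<one>\<^bsub>Homeo X\<^esub> g" using nonneg g by simp
    show "d \<one>\<^bsub>Homeo X\<^esub> (inv\<^bsub>Homeo X\<^esub> g) = d \<one>\<^bsub>Homeo X\<^esub> g"
      using left[of g "\<one>\<^bsub>Homeo X\<^esub>" "inv\<^bsub>Homeo X\<^esub> g"] sym[of g "\<one>\<^bsub>Homeo X\<^esub>"] g by simp
  next
    let ?V = "{g \<in> carrier (Homeo X). d \<one>\<^bsub>Homeo X\<^esub> g \<in> {..<1}}"
    have "continuous_map (Homeo_topology X) (prod_topology (Homeo_topology X) (Homeo_topology X))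
        (\<lambda>g. (\<one>\<^bsub>Homeo X\<^esub>, g))"
      by (intro continuous_map_pairedI) auto
    from continuous_map_compose[OF this cont]
    have "continuous_map (Homeo_topology X) euclideanreal (d \<one>\<^bsub>Homeo X\<^esub>)"
      by (simp add: o_def)
    then have "openin (Homeo_topology X) ?V"
      using openin_continuous_map_preimage[of "Homeo_topology X" euclideanreal "d \<one>\<^bsub>Homeo X\<^esub>" "{..<1}"]
      by simp
    moreover have "\<one>\<^bsub>Homeo X\<^esub> \<in> ?V"
      using refl[OF Homeo.one_closed Homeo.one_closed] by simp
    ultimately have "\<exists>A. clopen A \<and> A \<inter> top_points = {} \<and> (\<forall>s\<in>pure. (\<forall>x\<in>A. s x = x) \<longrightarrow> s \<in> ?V)"
      by (rule nbhd_one)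
    then show "\<exists>A. clopen A \<and> A \<inter> top_points = {} \<and>
        (\<forall>s\<in>pure. (\<forall>x\<in>A. s x = x) \<longrightarrow> d \<one>\<^bsub>Homeo X\<^esub> s \<le> 1)"
      by (elim exE) (rule exI, auto intro: less_imp_le)
  qed
qed

text \<open>
  A function vanishing on the open subgroup \<open>pure\<close> gives a locally constant pseudometric.
\<close>

lemma cont_left_inv_pseudometric_length:
  assumes nonneg: "\<And>g. g \<in> carrier (Homeo X) \<Longrightarrow> 0 \<le> N g"
    and sub: "\<And>g h. g \<in> carrier (Homeo X) \<Longrightarrow> h \<in> carrier (Homeo X) \<Longrightarrow> N (g \<otimes>\<^bsub>Homeo X\<^esub> h) \<le> N g + N h"
    and inv: "\<And>g. g \<in> carrier (Homeo X) \<Longrightarrow> N (inv\<^bsub>Homeo X\<^esub> g) = N g"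
    and pure0: "\<And>g. g \<in> pure \<Longrightarrow> N g = (0::real)"
  shows "cont_left_inv_pseudometric (Homeo X) (Homeo_topology X) (\<lambda>g h. N (inv\<^bsub>Homeo X\<^esub> g \<otimes>\<^bsub>Homeo X\<^esub> h))"
    (is "cont_left_inv_pseudometric _ _ ?d")
  unfolding cont_left_inv_pseudometric_def
proof (intro conjI ballI)
  show "0 \<le> ?d x y" if "x \<in> carrier (Homeo X)" "y \<in> carrier (Homeo X)" for x y
    using that nonneg by simp
  show "?d x x = 0" if "x \<in> carrier (Homeo X)" for x
    using that pure0[OF one_in_pure] by simp
  have sym: "?d x y = ?d y x" if "x \<in> carrier (Homeo X)" "y \<in> carrier (Homeo X)" for x y
  proof -
    have "inv\<^bsub>Homeo X\<^esub> (inv\<^bsub>Homeo X\<^esub> x \<otimes>\<^bsub>Homeo X\<^esub> y) = inv\<^bsub>Homeo X\<^esub> y \<otimes>\<^bsub>Homeo X\<^esub> x"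
      using that by (simp add: Homeo.inv_mult_group)
    then show ?thesis
      using that inv[of "inv\<^bsub>Homeo X\<^esub> x \<otimes>\<^bsub>Homeo X\<^esub> y"] by simp
  qed
  then show "?d x y = ?d y x" if "x \<in> carrier (Homeo X)" "y \<in> carrier (Homeo X)" for x y
    using that by simp
  have tri: "?d x z \<le> ?d x y + ?d y z"
    if "x \<in> carrier (Homeo X)" "y \<in> carrier (Homeo X)" "z \<in> carrier (Homeo X)" for x y z
  proof -
    have "inv\<^bsub>Homeo X\<^esub> x \<otimes>\<^bsub>Homeo X\<^esub> z = (inv\<^bsub>Homeo X\<^esub> x \<otimes>\<^bsub>Homeo X\<^esub> y) \<otimes>\<^bsub>Homeo X\<^esub> (inv\<^bsub>Homeo X\<^esub> y \<otimes>\<^bsub>Homeo X\<^esub> z)"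
      using that by (simp add: Homeo.m_assoc Homeo_cancel)
    then show ?thesis
      using that sub[of "inv\<^bsub>Homeo X\<^esub> x \<otimes>\<^bsub>Homeo X\<^esub> y" "inv\<^bsub>Homeo X\<^esub> y \<otimes>\<^bsub>Homeo X\<^esub> z"] by simp
  qed
  then show "?d x z \<le> ?d x y + ?d y z"
    if "x \<in> carrier (Homeo X)" "y \<in> carrier (Homeo X)" "z \<in> carrier (Homeo X)" for x y z
    using that by simp
  show "?d (g \<otimes>\<^bsub>Homeo X\<^esub> x) (g \<otimes>\<^bsub>Homeo X\<^esub> y) = ?d x y"
    if "g \<in> carrier (Homeo X)" "x \<in> carrier (Homeo X)" "y \<in> carrier (Homeo X)" for g x y
  proof -
    have "inv\<^bsub>Homeo X\<^esub> (g \<otimes>\<^bsub>Homeo X\<^esub> x) \<otimes>\<^bsub>Homeo X\<^esub> (g \<otimes>\<^bsub>Homeo X\<^esub> y) = inv\<^bsub>Homeo X\<^esub> x \<otimes>\<^bsub>Homeo X\<^esub> y"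
      using that by (simp add: Homeo.inv_mult_group Homeo.m_assoc Homeo_cancel)
    then show ?thesis by simp
  qed
  \<comment> \<open>This is the left coset of \<open>g\<close> by \<open>pure\<close>, cut out by
    finitely many subbasic conditions: the clopen fibres are compact and their images under
    \<open>g\<close> are open.\<close>
  define nb where "nb g = {f \<in> carrier (Homeo X). \<forall>p\<in>top_points.
    f ` {x \<in> topspace X. base x = p} \<subseteq> g ` {x \<in> topspace X. base x = p}}" for g
  have nb_open: "openin (Homeo_topology X) (nb g)" if g: "g \<in> carrier (Homeo X)" for g
  proof -
    have "nb g = (\<Inter>p\<in>top_points. {f \<in> carrier (Homeo X).
        f ` {x \<in> topspace X. base x = p} \<subseteq> g ` {x \<in> topspace X. base x = p}})"
      using top_points_nonempty by (auto simp: nb_def)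
    moreover have "openin (Homeo_topology X) {f \<in> carrier (Homeo X).
        f ` {x \<in> topspace X. base x = p} \<subseteq> g ` {x \<in> topspace X. base x = p}}" for p
      using retr_clopen[OF retr_base]
      by (intro openin_compact_open clopen_compactin clopen_openin Homeo_image_clopen g)
    ultimately show ?thesis
      using finite_top_points top_points_nonempty by (auto intro!: openin_Inter)
  qed
  have d0: "?d g f = 0" if g: "g \<in> carrier (Homeo X)" and f: "f \<in> nb g" for g f
  proof (rule pure0, rule pureI)
    have fc: "f \<in> carrier (Homeo X)" using f by (simp add: nb_def)
    then show "inv\<^bsub>Homeo X\<^esub> g \<otimes>\<^bsub>Homeo X\<^esub> f \<in> carrier (Homeo X)" using g by simp
    fix x assume x: "x \<in> topspace X"
    then have "f x \<in> g ` {y \<in> topspace X. base y = base x}"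
      using f baseD(1)[OF x] by (auto simp: nb_def)
    then obtain y where "y \<in> topspace X" "base y = base x" "f x = g y" by auto
    then show "base ((inv\<^bsub>Homeo X\<^esub> g \<otimes>\<^bsub>Homeo X\<^esub> f) x) = base x"
      using x g by simp
  qed
  have self: "g \<in> nb g" if "g \<in> carrier (Homeo X)" for g
    using that by (simp add: nb_def)
  have const: "?d g' h' = ?d g h"
    if "g \<in> carrier (Homeo X)" "h \<in> carrier (Homeo X)" "g' \<in> nb g" "h' \<in> nb h" for g h g' h'
  proof -
    have c: "g' \<in> carrier (Homeo X)" "h' \<in> carrier (Homeo X)"
      using that(3,4) by (auto simp: nb_def)
    have z: "?d g g' = 0" "?d g' g = 0" "?d h h' = 0" "?d h' h = 0"
      using d0[OF that(1,3)] d0[OF that(2,4)] sym[OF that(1) c(1)] sym[OF that(2) c(2)] by simp_all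
    show ?thesis
      using tri[OF c(1) that(1) c(2)] tri[OF that(1,2) c(2)] tri[OF that(1) c(1) that(2)] tri[OF c that(2)] z
      by simp
  qed
  show "continuous_map (prod_topology (Homeo_topology X) (Homeo_topology X)) euclideanreal (\<lambda>(x, y). ?d x y)"
    unfolding continuous_map_def
  proof (intro conjI allI impI)
    fix U :: "real set"
    let ?P = "{x \<in> topspace (prod_topology (Homeo_topology X) (Homeo_topology X)). (case x of (x, y) \<Rightarrow> ?d x y) \<in> U}"
    show "openin (prod_topology (Homeo_topology X) (Homeo_topology X)) ?P"
    proof (subst openin_subopen, intro ballI)
      fix z assume z: "z \<in> ?P"
      obtain g h where gh: "z = (g, h)" by (cases z)
      then have c: "g \<in> carrier (Homeo X)" "h \<in> carrier (Homeo X)" "?d g h \<in> U"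
        using z by auto
      have "openin (prod_topology (Homeo_topology X) (Homeo_topology X)) (nb g \<times> nb h)"
        using nb_open c by (simp add: openin_prod_Times_iff)
      moreover have "nb g \<times> nb h \<subseteq> ?P"
        using const[OF c(1,2)] c(3) by (auto simp: nb_def)
      ultimately show "\<exists>T. openin (prod_topology (Homeo_topology X) (Homeo_topology X)) T \<and> z \<in> T \<and> T \<subseteq> ?P"
        using self c gh by blast
    qed
  qed simp
qed

subsection \<open>The defect of a homeomorphism\<close>

text \<open>If \<open>h\<close> commutes with \<open>base\<close> at \<open>x\<close>, and
  \<open>g\<close> does at \<open>h x\<close>, then so does the product at \<open>x\<close>. This
  makes the count of defects subadditive.\<close>

lemma defect_mult:
  assumes "g \<in> carrier (Homeo X)" "h \<in> carrier (Homeo X)"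
  shows "defect (g \<otimes>\<^bsub>Homeo X\<^esub> h) \<subseteq> defect h \<union> {x \<in> topspace X. h x \<in> defect g}"
  using assms retr_in_topspace[OF retr_base] by (auto simp: defect_def)

lemma defect_inv:
  assumes g: "g \<in> carrier (Homeo X)"
  shows "defect (inv\<^bsub>Homeo X\<^esub> g) = g ` defect g"
proof (intro equalityI subsetI)
  let ?i = "inv\<^bsub>Homeo X\<^esub> g"
  fix x assume "x \<in> defect ?i"
  then have x: "x \<in> topspace X" "base (?i x) \<noteq> ?i (base x)" by (auto simp: defect_def)
  have i: "?i x \<in> topspace X" using x(1) g by simp
  have "?i x \<in> defect g"
  proof -
    have "base (g (?i x)) \<noteq> g (base (?i x))"
    proof
      assume "base (g (?i x)) = g (base (?i x))"
      then have "?i (base x) = ?i (g (base (?i x)))" using g x(1) by simp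
      then show False using x(2) g retr_in_topspace[OF retr_base i] by simp
    qed
    then show ?thesis using i by (simp add: defect_def)
  qed
  then show "x \<in> g ` defect g"
    using Homeo_inv2[OF g x(1)] by (metis imageI)
next
  let ?i = "inv\<^bsub>Homeo X\<^esub> g"
  fix x assume "x \<in> g ` defect g"
  then obtain y where y: "x = g y" "y \<in> topspace X" "base (g y) \<noteq> g (base y)" by (auto simp: defect_def)
  have "base y \<noteq> ?i (base (g y))"
  proof
    assume "base y = ?i (base (g y))"
    then have "g (base y) = g (?i (base (g y)))" by simp
    then show False using y g retr_in_topspace[OF retr_base] by simp
  qed
  then show "x \<in> defect ?i" using y g by (simp add: defect_def)
qed

lemma defect_pure:
  assumes "g \<in> pure"
  shows "defect g = {}"
  using pure_base[OF assms] pure_top_points[OF assms] baseD(1) by (simp add: defect_def)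

lemma defect_top_points: "g \<in> carrier (Homeo X) \<Longrightarrow> x \<in> defect g \<Longrightarrow> x \<notin> top_points"
  by (auto simp: defect_def baseD(2))

lemma defect_rank: "g \<in> carrier (Homeo X) \<Longrightarrow> x \<in> defect g \<Longrightarrow> rk x < \<alpha>"
  using defect_top_points rank_less by (auto simp: defect_def)

lemma clopen_retr_diff:
  assumes "retr r1" "retr r2"
  shows "clopen {x \<in> topspace X. r1 x \<noteq> r2 x}"
proof -
  have "{x \<in> topspace X. r1 x \<noteq> r2 x} =
    (\<Union>(s, t)\<in>{(s, t) \<in> top_points \<times> top_points. s \<noteq> t}. {x \<in> topspace X. r1 x = s \<and> r2 x = t})"
    using retrD(1)[OF assms(1)] retrD(1)[OF assms(2)] by auto
  moreover have "finite {(s, t) \<in> top_points \<times> top_points. s \<noteq> t}"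
    by (rule finite_subset[OF _ finite_cartesian_product[OF finite_top_points finite_top_points]]) auto
  then have "clopen (\<Union>(s, t)\<in>{(s, t) \<in> top_points \<times> top_points. s \<noteq> t}. {x \<in> topspace X. r1 x = s \<and> r2 x = t})"
    by (rule clopen_UN) (use retr_clopen2[OF assms] in auto)
  ultimately show ?thesis by simp
qed

text \<open>The defect is where \<open>base\<close> differs from its conjugate by the inverse of
  \<open>g\<close>, again a retraction.\<close>

lemma clopen_defect:
  assumes g: "g \<in> carrier (Homeo X)"
  shows "clopen (defect g)"
proof -
  obtain r where r: "retr r" "intertwines g r base"
  proof -
    obtain r where r: "retr r" "intertwines (inv\<^bsub>Homeo X\<^esub> g) base r"
      using intertwines_retr_ex[OF _ retr_base] g by (metis Homeo.inv_closed)
    from intertwines_inv[OF _ retr_base this(2)] have "intertwines g r base"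
      using g by simp
    then show thesis using r(1) that by blast
  qed
  have "defect g = {x \<in> topspace X. r x \<noteq> base x}"
    using r g Homeo_inj[OF g] retr_in_topspace[OF r(1)] retr_in_topspace[OF retr_base]
    by (auto simp: defect_def intertwines_def)
  then show ?thesis
    using clopen_retr_diff[OF r(1) retr_base] by simp
qed

section \<open>The maximal pseudometric for a successor ordinal\<close>

text \<open>Used for the predecessor \<beta> of \<alpha>, the largest rank a defect can contain, so
  that the set is finite. For smaller ranks it can be infinite, and \<open>card\<close> is then
  0.\<close>

definition defect_card :: "'o \<Rightarrow> ('a \<Rightarrow> 'a) \<Rightarrow> real" where
  "defect_card \<beta> g = real (card {x \<in> defect g. rk x = \<beta>})"

lemma defect_card_pseudometric:
  assumes \<beta>: "is_succ_of \<beta> \<alpha>"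
  shows "cont_left_inv_pseudometric (Homeo X) (Homeo_topology X)
    (\<lambda>g h. defect_card \<beta> (inv\<^bsub>Homeo X\<^esub> g \<otimes>\<^bsub>Homeo X\<^esub> h))"
proof (rule cont_left_inv_pseudometric_length)
  have le: "rk x \<le> \<beta>" if "g \<in> carrier (Homeo X)" "x \<in> defect g" for g x
    using defect_rank[OF that] \<beta> by (simp add: is_succ_of_def)
  have fin: "finite {x \<in> defect g. rk x = \<beta>}" if "g \<in> carrier (Homeo X)" for g
    by (rule finite_max_rank[OF clopen_defect[OF that] le[OF that]])
  fix g assume g: "g \<in> carrier (Homeo X)"
  show "0 \<le> defect_card \<beta> g" by (simp add: defect_card_def)
  have "{x \<in> defect (inv\<^bsub>Homeo X\<^esub> g). rk x = \<beta>} = g ` {x \<in> defect g. rk x = \<beta>}"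
    unfolding defect_inv[OF g] using g by (auto simp: defect_def)
  moreover have "card (g ` {x \<in> defect g. rk x = \<beta>}) = card {x \<in> defect g. rk x = \<beta>}"
    using Homeo_inj[OF g] by (intro card_image inj_onI) (auto simp: defect_def)
  ultimately show "defect_card \<beta> (inv\<^bsub>Homeo X\<^esub> g) = defect_card \<beta> g"
    by (simp add: defect_card_def)
  fix h assume h: "h \<in> carrier (Homeo X)"
  let ?Q = "{x \<in> topspace X. h x \<in> defect g \<and> rk x = \<beta>}"
  have Q: "?Q = (inv\<^bsub>Homeo X\<^esub> h) ` {x \<in> defect g. rk x = \<beta>}"
  proof (intro equalityI subsetI)
    fix x assume "x \<in> ?Q"
    then have "x = (inv\<^bsub>Homeo X\<^esub> h) (h x)" "h x \<in> {x \<in> defect g. rk x = \<beta>}"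
      using h by auto
    then show "x \<in> (inv\<^bsub>Homeo X\<^esub> h) ` {x \<in> defect g. rk x = \<beta>}" by (rule image_eqI)
  qed (use h in \<open>auto simp: defect_def\<close>)
  have finQ: "finite ?Q" "card ?Q \<le> card {x \<in> defect g. rk x = \<beta>}"
    unfolding Q using fin[OF g] by (auto intro: card_image_le)
  have "card {x \<in> defect (g \<otimes>\<^bsub>Homeo X\<^esub> h). rk x = \<beta>} \<le> card ({x \<in> defect h. rk x = \<beta>} \<union> ?Q)"
    using defect_mult[OF g h] fin[OF h] finQ(1) by (intro card_mono) auto
  also have "\<dots> \<le> card {x \<in> defect h. rk x = \<beta>} + card {x \<in> defect g. rk x = \<beta>}"
    using card_Un_le[of "{x \<in> defect h. rk x = \<beta>}" ?Q] finQ(2) by simp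
  finally show "defect_card \<beta> (g \<otimes>\<^bsub>Homeo X\<^esub> h) \<le> defect_card \<beta> g + defect_card \<beta> h"
    by (simp add: defect_card_def)
qed (simp add: defect_card_def defect_pure)

lemma defect_card_maximal:
  assumes \<beta>: "is_succ_of \<beta> \<alpha>"
  shows "maximal_pseudometric (Homeo X) (Homeo_topology X)
    (\<lambda>g h. defect_card \<beta> (inv\<^bsub>Homeo X\<^esub> g \<otimes>\<^bsub>Homeo X\<^esub> h))"
  unfolding maximal_pseudometric_def
proof (intro conjI allI impI)
  fix d assume d: "cont_left_inv_pseudometric (Homeo X) (Homeo_topology X) d"
  have "\<beta> < \<alpha>" using \<beta> by (simp add: is_succ_of_def)
  from length_bound[OF length_fun_pseudometric(1)[OF d] this]
  obtain K C where KC: "\<forall>g\<in>carrier (Homeo X). (\<forall>x\<in>defect g. rk x \<le> \<beta>) \<longrightarrow>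
      d \<one>\<^bsub>Homeo X\<^esub> g \<le> K * real (card {x \<in> defect g. rk x = \<beta>}) + C"
    by blast
  have "d x y \<le> K * defect_card \<beta> (inv\<^bsub>Homeo X\<^esub> x \<otimes>\<^bsub>Homeo X\<^esub> y) + C"
    if xy: "x \<in> carrier (Homeo X)" "y \<in> carrier (Homeo X)" for x y
    unfolding length_fun_pseudometric(2)[OF d xy] defect_card_def
  proof (rule KC[rule_format])
    show w: "inv\<^bsub>Homeo X\<^esub> x \<otimes>\<^bsub>Homeo X\<^esub> y \<in> carrier (Homeo X)" using xy by simp
    show "rk z \<le> \<beta>" if "z \<in> defect (inv\<^bsub>Homeo X\<^esub> x \<otimes>\<^bsub>Homeo X\<^esub> y)" for z
      using defect_rank[OF w that] \<beta> by (simp add: is_succ_of_def)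
  qed
  then show "\<exists>K C. \<forall>x\<in>carrier (Homeo X). \<forall>y\<in>carrier (Homeo X).
      d x y \<le> K * defect_card \<beta> (inv\<^bsub>Homeo X\<^esub> x \<otimes>\<^bsub>Homeo X\<^esub> y) + C"
    by blast
qed (rule defect_card_pseudometric[OF \<beta>])

text \<open>\<open>h\<close> maps the defect bijectively onto the set where \<open>r1\<close> and
  \<open>r2\<close> differ, so the pseudometric is the Hamming distance of the retractions on the
  points of rank \<beta>.\<close>

lemma defect_card_intertwines:
  assumes g: "g \<in> carrier (Homeo X)" "intertwines g base r1"
    and h: "h \<in> carrier (Homeo X)" "intertwines h base r2"
  shows "defect_card \<beta> (inv\<^bsub>Homeo X\<^esub> g \<otimes>\<^bsub>Homeo X\<^esub> h) = real (card {w \<in> topspace X. r1 w \<noteq> r2 w \<and> rk w = \<beta>})"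
proof -
  let ?i = "inv\<^bsub>Homeo X\<^esub> g"
  have eq: "x \<in> defect (?i \<otimes>\<^bsub>Homeo X\<^esub> h) \<longleftrightarrow> r1 (h x) \<noteq> r2 (h x)" if x: "x \<in> topspace X" for x
  proof -
    have hx: "h x \<in> topspace X" "base x \<in> topspace X" "h (base x) \<in> topspace X" "?i (h x) \<in> topspace X"
      using x h g retr_in_topspace[OF retr_base] by simp_all
    have "base (?i (h x)) = ?i (h (base x)) \<longleftrightarrow> g (base (?i (h x))) = h (base x)"
      using Homeo_inv1[OF g(1) retr_in_topspace[OF retr_base hx(4)]] Homeo_inv2[OF g(1) hx(3)] by metis
    moreover have "g (base (?i (h x))) = r1 (h x)"
      using bspec[OF g(2)[unfolded intertwines_def] hx(4)]
      unfolding Homeo_inv2[OF g(1) hx(1)] by (rule sym)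
    moreover have "h (base x) = r2 (h x)"
      using h(2) x by (simp add: intertwines_def)
    ultimately show ?thesis
      using x hx(2) by (simp add: defect_def)
  qed
  have "{w \<in> topspace X. r1 w \<noteq> r2 w \<and> rk w = \<beta>} = h ` {x \<in> defect (?i \<otimes>\<^bsub>Homeo X\<^esub> h). rk x = \<beta>}"
  proof (intro equalityI subsetI)
    fix w assume w: "w \<in> {w \<in> topspace X. r1 w \<noteq> r2 w \<and> rk w = \<beta>}"
    let ?x = "(inv\<^bsub>Homeo X\<^esub> h) w"
    have x: "?x \<in> topspace X" "h ?x = w" using w h(1) by simp_all
    then have "rk ?x = \<beta>" using w rank_Homeo[OF h(1) x(1)] by simp
    then show "w \<in> h ` {x \<in> defect (?i \<otimes>\<^bsub>Homeo X\<^esub> h). rk x = \<beta>}"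
      using eq[OF x(1)] x w by (intro image_eqI[of _ _ ?x]) auto
  next
    fix w assume "w \<in> h ` {x \<in> defect (?i \<otimes>\<^bsub>Homeo X\<^esub> h). rk x = \<beta>}"
    then obtain x where x: "w = h x" "x \<in> defect (?i \<otimes>\<^bsub>Homeo X\<^esub> h)" "rk x = \<beta>" by auto
    have "x \<in> topspace X" using x(2) by (simp add: defect_def)
    then show "w \<in> {w \<in> topspace X. r1 w \<noteq> r2 w \<and> rk w = \<beta>}"
      using eq x h(1) by simp
  qed
  moreover have "card (h ` {x \<in> defect (?i \<otimes>\<^bsub>Homeo X\<^esub> h). rk x = \<beta>}) = card {x \<in> defect (?i \<otimes>\<^bsub>Homeo X\<^esub> h). rk x = \<beta>}"
    using Homeo_inj[OF h(1)] by (intro card_image inj_onI) (auto simp: defect_def)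
  ultimately show ?thesis by (simp add: defect_card_def)
qed

end

section \<open>Integer lattices in the group\<close>

context ranked_space
begin

text \<open>
  An integer \<open>k\<close> is encoded by the integers between 0 and \<open>k\<close>; moving the points indexed by them from
  one fibre of \<open>base\<close> to another one turns the word metric of \<open>\<int>\<close> into the size of a symmetric difference.
\<close>

definition segment :: "int \<Rightarrow> int set" where
  "segment k = {1..k} \<union> {k + 1..0}"

lemma segment_diff: "{j. (j \<in> segment k) \<noteq> (j \<in> segment l)} = {min k l + 1..max k l}"
  by (auto simp: segment_def)

text \<open>Infinitely many points of rank \<beta> lie in the fibre over \<open>p\<close>, since
  they accumulate at \<open>p\<close>. They are indexed by a coordinate and an integer, and
  \<open>x\<close> becomes the retraction that moves the cones around the points encoding
  \<open>x\<close> to the fibre over \<open>q\<close>. The embedding is isometric.\<close>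

lemma int_lattice_embedding:
  assumes \<beta>: "is_succ_of \<beta> \<alpha>" and pq: "p \<in> top_points" "q \<in> top_points" "p \<noteq> q"
  obtains \<phi> where "\<And>x. \<phi> x \<in> carrier (Homeo X)"
    "\<And>x y. defect_card \<beta> (inv\<^bsub>Homeo X\<^esub> (\<phi> x) \<otimes>\<^bsub>Homeo X\<^esub> \<phi> y) = int_lattice_dist m x y"
proof -
  have "\<beta> < \<alpha>" using \<beta> by (simp add: is_succ_of_def)
  define Z where "Z = {z \<in> topspace X. base z = p \<and> rk z = \<beta>}"
  have "infinite Z"
  proof
    assume "finite Z"
    then have "closedin X Z"
      using hausdorff closedin_Hausdorff_finite by (metis (no_types, lifting) Z_def mem_Collect_eq subsetI)
    then have o: "openin X ({x \<in> topspace X. base x = p} - Z)"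
      using baseD(3) by blast
    have "p \<in> {x \<in> topspace X. base x = p} - Z" "\<beta> < rk p"
      using pq(1) baseD(2) top_points_subset rank_top_points \<open>\<beta> < \<alpha>\<close> by (auto simp: Z_def)
    then obtain y where "y \<in> {x \<in> topspace X. base x = p} - Z" "rk y = \<beta>"
      using rk_attained[OF o] by blast
    then show False by (auto simp: Z_def)
  qed
  then obtain f :: "nat \<Rightarrow> 'a" where f: "inj f" "range f \<subseteq> Z"
    using infinite_countable_subset by blast
  define z :: "nat \<times> int \<Rightarrow> 'a" where "z ij = f (to_nat ij)" for ij
  have inj: "z a = z b \<longleftrightarrow> a = b" for a b
    using f(1) by (auto simp: z_def inj_eq)
  have z: "z ij \<in> topspace X" "base (z ij) = p" "rk (z ij) = \<beta>" for ij
    using f(2) by (auto simp: z_def Z_def)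
  have "\<exists>C. cone C (z ij) \<and> C \<subseteq> {x \<in> topspace X. base x = p}" for ij
  proof -
    have "z ij \<in> {x \<in> topspace X. base x = p}" using z by simp
    then obtain C where "cone C (z ij)" "C \<subseteq> {x \<in> topspace X. base x = p}"
      by (rule cone_ex[OF baseD(3)])
    then show ?thesis by blast
  qed
  \<comment> \<open>These cones may overlap. Each contains only one point of rank \<beta>, so a
    union of them still shows which points were chosen.\<close>
  then obtain C where C: "\<And>ij. cone (C ij) (z ij)" "\<And>ij. C ij \<subseteq> {x \<in> topspace X. base x = p}"
    by metis
  have Crk: "rk y \<le> \<beta>" if "y \<in> C ij" for y ij
    using coneD(4)[OF C(1) that] z(3) by simp
  have Cb: "y = z ij" if "y \<in> C ij" "rk y = \<beta>" for y ij
    using coneD(3)[OF C(1) that(1)] z(3) that(2) by auto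
  define J where "J x = (SIGMA i:{..<m}. segment (x i))" for x :: "nat \<Rightarrow> int"
  have finJ: "finite (J x)" for x
    by (simp add: J_def segment_def)
  define D where "D x = (\<Union>ij\<in>J x. C ij)" for x
  have D: "clopen (D x)" "D x \<subseteq> {x \<in> topspace X. base x = p}" for x
    unfolding D_def by (rule clopen_UN[OF finJ coneD(1)[OF C(1)]], rule UN_least[OF C(2)])
  have Dt: "D x \<inter> top_points = {}" for x
  proof -
    have "y \<notin> top_points" if "y \<in> C ij" for y ij
      using Crk[OF that] rank_top_points[of y] \<open>\<beta> < \<alpha>\<close> by auto
    then show ?thesis by (auto simp: D_def)
  qed
  define r where "r x = (\<lambda>w. if w \<in> D x then q else base w)" for x
  have r: "retr (r x)" for x
    unfolding r_def by (rule retr_update[OF retr_base D(1) Dt pq(2)])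
  have "\<exists>g. g \<in> carrier (Homeo X) \<and> intertwines g base (r x)" for x
    using intertwines_ex[OF retr_base r] by metis
  then obtain \<phi> where \<phi>: "\<And>x. \<phi> x \<in> carrier (Homeo X)" "\<And>x. intertwines (\<phi> x) base (r x)"
    by metis
  have "defect_card \<beta> (inv\<^bsub>Homeo X\<^esub> (\<phi> x) \<otimes>\<^bsub>Homeo X\<^esub> \<phi> y) = int_lattice_dist m x y" for x y
  proof -
    let ?S = "SIGMA i:{..<m}. {min (x i) (y i) + 1..max (x i) (y i)}"
    have in_D: "z ij \<in> D v \<longleftrightarrow> ij \<in> J v" for ij v
      unfolding D_def UN_iff using Cb[OF _ z(3)] coneD(2)[OF C(1)] inj by metis
    have J: "{ij. (ij \<in> J x) \<noteq> (ij \<in> J y)} = ?S"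
      using segment_diff[of "x i" "y i" for i] by (auto simp: J_def set_eq_iff)
    have rr: "r x w \<noteq> r y w \<longleftrightarrow> (w \<in> D x) \<noteq> (w \<in> D y)" for w
      using D(2) pq(3) by (auto simp: r_def)
    have "{w \<in> topspace X. r x w \<noteq> r y w \<and> rk w = \<beta>} = z ` ?S"
    proof (intro equalityI subsetI)
      fix w assume w: "w \<in> {w \<in> topspace X. r x w \<noteq> r y w \<and> rk w = \<beta>}"
      then have w': "rk w = \<beta>" "(w \<in> D x) \<noteq> (w \<in> D y)" using rr by auto
      then obtain v where "w \<in> D v" by blast
      then obtain ij where "w \<in> C ij" unfolding D_def by blast
      then have "w = z ij" using Cb w'(1) by blast
      then show "w \<in> z ` ?S"
        using w'(2) unfolding J[symmetric] by (simp add: in_D)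
    next
      fix w assume "w \<in> z ` ?S"
      then obtain ij where "w = z ij" "ij \<in> ?S" by blast
      then show "w \<in> {w \<in> topspace X. r x w \<noteq> r y w \<and> rk w = \<beta>}"
        unfolding J[symmetric] using z in_D rr by simp
    qed
    moreover have "card (z ` ?S) = card ?S"
      by (intro card_image inj_onI) (simp add: inj)
    moreover have "card ?S = (\<Sum>i<m. nat \<bar>x i - y i\<bar>)"
      by (subst card_SigmaI) (auto intro!: sum.cong simp: max_def min_def)
    ultimately show ?thesis
      using defect_card_intertwines[OF \<phi>(1,2) \<phi>(1,2)] by (simp add: int_lattice_dist_def)
  qed
  then show thesis using that \<phi>(1) by blast
qed

lemma infinite_coarse_rank_Homeo:
  assumes \<beta>: "is_succ_of \<beta> \<alpha>" and "card top_points > 1"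
  shows "infinite_coarse_rank (Homeo X) (Homeo_topology X)"
proof -
  obtain p q where pq: "p \<in> top_points" "q \<in> top_points" "p \<noteq> q"
    using assms(2) by (metis One_nat_def card_le_Suc0_iff_eq finite_top_points not_less)
  have "\<exists>\<phi>. quasi_isometric_embedding (int_lattice m) (int_lattice_dist m) (carrier (Homeo X))
      (\<lambda>g h. defect_card \<beta> (inv\<^bsub>Homeo X\<^esub> g \<otimes>\<^bsub>Homeo X\<^esub> h)) \<phi>" for m
  proof -
    obtain \<phi> where \<phi>: "\<And>x. \<phi> x \<in> carrier (Homeo X)"
      "\<And>x y. defect_card \<beta> (inv\<^bsub>Homeo X\<^esub> (\<phi> x) \<otimes>\<^bsub>Homeo X\<^esub> \<phi> y) = int_lattice_dist m x y"
      by (rule int_lattice_embedding[OF \<beta> pq, where m = m]) (rule that)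
    show ?thesis
      unfolding quasi_isometric_embedding_def
      by (rule exI[of _ \<phi>], intro conjI, use \<phi> in blast, rule exI[of _ 1], simp,
          rule exI[of _ 0]) (simp add: \<phi>(2))
  qed
  then show ?thesis
    unfolding infinite_coarse_rank_def using defect_card_maximal[OF \<beta>] by blast
qed

end

subsection \<open>Asymptotic dimension zero\<close>

text \<open>The left cosets of \<open>H\<close> form a single family: \<open>H\<close> is bounded,
  so they are uniformly bounded, and elements related by \<open>E\<close> share a coset, so
  different cosets are disjoint with respect to \<open>E\<close>.\<close>

lemma (in group) asdim_0I:
  assumes "\<And>E. E \<in> group_entourages G T \<Longrightarrow> \<exists>H. H \<subseteq> carrier G \<and> \<one> \<in> H \<and>
    (\<forall>g\<in>H. \<forall>h\<in>H. g \<otimes> h \<in> H) \<and> (\<forall>g\<in>H. inv g \<in> H) \<and> (\<forall>g h. (g, h) \<in> E \<longrightarrow> inv g \<otimes> h \<in> H) \<and>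
    (\<forall>d. cont_left_inv_pseudometric G T d \<longrightarrow> (\<exists>c. \<forall>g\<in>H. d \<one> g \<le> c))"
  shows "group_asdim G T = 0"
proof -
  have "\<exists>\<U> :: nat \<Rightarrow> 'a set set.
        (\<Union>i\<le>0. \<Union>(\<U> i)) = carrier G \<and>
        (\<Union>i\<le>0. \<Union>U\<in>\<U> i. U \<times> U) \<in> group_entourages G T \<and>
        (\<forall>i\<le>0. \<forall>U\<in>\<U> i. \<forall>V\<in>\<U> i. U \<noteq> V \<longrightarrow> (U \<times> V) \<inter> E = {})"
    if E: "E \<in> group_entourages G T" for E
  proof -
    from assms[OF E] obtain H where "H \<subseteq> carrier G \<and> \<one> \<in> H \<and>
      (\<forall>g\<in>H. \<forall>h\<in>H. g \<otimes> h \<in> H) \<and> (\<forall>g\<in>H. inv g \<in> H) \<and> (\<forall>g h. (g, h) \<in> E \<longrightarrow> inv g \<otimes> h \<in> H) \<and>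
      (\<forall>d. cont_left_inv_pseudometric G T d \<longrightarrow> (\<exists>c. \<forall>g\<in>H. d \<one> g \<le> c))" ..
    then have H: "\<one> \<in> H" "\<And>g h. g \<in> H \<Longrightarrow> h \<in> H \<Longrightarrow> g \<otimes> h \<in> H"
      "\<And>g. g \<in> H \<Longrightarrow> inv g \<in> H" "\<And>g h. (g, h) \<in> E \<Longrightarrow> inv g \<otimes> h \<in> H"
      "\<And>d. cont_left_inv_pseudometric G T d \<Longrightarrow> \<exists>c. \<forall>g\<in>H. d \<one> g \<le> c"
      by simp_all
    define R where "R = {(g, h) \<in> carrier G \<times> carrier G. inv g \<otimes> h \<in> H}"
    have "equiv (carrier G) R"
    proof (rule equivI)
      show "R \<subseteq> carrier G \<times> carrier G" by (auto simp: R_def)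
      show "refl_on (carrier G) R"
        using H(1) by (auto simp: R_def refl_on_def)
      show "sym R"
      proof (rule symI)
        fix x y assume "(x, y) \<in> R"
        then have xy: "x \<in> carrier G" "y \<in> carrier G" "inv x \<otimes> y \<in> H" by (auto simp: R_def)
        then have "inv y \<otimes> x \<in> H" using H(3)[OF xy(3)] by (simp add: inv_mult_group)
        then show "(y, x) \<in> R" using xy by (simp add: R_def)
      qed
      show "trans R"
      proof (rule transI)
        fix x y z assume "(x, y) \<in> R" "(y, z) \<in> R"
        then have xyz: "x \<in> carrier G" "y \<in> carrier G" "z \<in> carrier G" "inv x \<otimes> y \<in> H" "inv y \<otimes> z \<in> H"
          by (auto simp: R_def)
        have "y \<otimes> (inv y \<otimes> z) = z" using xyz by (simp flip: m_assoc)
        then have "(inv x \<otimes> y) \<otimes> (inv y \<otimes> z) = inv x \<otimes> z" using xyz by (simp add: m_assoc)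
        then show "(x, z) \<in> R" using H(2)[OF xyz(4,5)] xyz by (simp add: R_def)
      qed
    qed
    note eq = this
    have ent: "R \<in> group_entourages G T"
      unfolding group_entourages_def
    proof (intro CollectI conjI allI impI)
      show "R \<subseteq> carrier G \<times> carrier G" by (auto simp: R_def)
      fix d assume d: "cont_left_inv_pseudometric G T d"
      then obtain c where c: "\<And>g. g \<in> H \<Longrightarrow> d \<one> g \<le> c" using H(5) by blast
      have "d g h \<le> c" if "(g, h) \<in> R" for g h
      proof -
        have gh: "g \<in> carrier G" "h \<in> carrier G" "inv g \<otimes> h \<in> H" using that by (auto simp: R_def)
        have "d (inv g \<otimes> g) (inv g \<otimes> h) = d g h"
          using d gh(1,2) inv_closed unfolding cont_left_inv_pseudometric_def by blast
        then show ?thesis using c[OF gh(3)] gh by simp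
      qed
      then show "bdd_above ((\<lambda>(g, h). d g h) ` R)"
        by (intro bdd_aboveI[of _ c]) auto
    qed
    have un: "(\<Union>U\<in>carrier G // R. U \<times> U) = R"
    proof (intro equalityI subsetI)
      fix p assume "p \<in> (\<Union>U\<in>carrier G // R. U \<times> U)"
      then obtain U where "U \<in> carrier G // R" "p \<in> U \<times> U" by blast
      then show "p \<in> R" using quotient_eq_iff[OF eq, of U U] by (cases p) auto
    next
      fix p assume "p \<in> R"
      then have "fst p \<in> carrier G" "p \<in> R `` {fst p} \<times> R `` {fst p}"
        using eq by (cases p; auto simp: R_def H(1))+
      then show "p \<in> (\<Union>U\<in>carrier G // R. U \<times> U)" using quotientI by fast
    qed
    have dis: "(U \<times> V) \<inter> E = {}" if "U \<in> carrier G // R" "V \<in> carrier G // R" "U \<noteq> V" for U V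
    proof -
      have "(g, h) \<in> R" if "(g, h) \<in> E" for g h
        using H(4)[OF that] that E by (auto simp: R_def group_entourages_def)
      then show ?thesis
        using quotient_eqI[OF eq that(1,2)] that(3) by blast
    qed
    show ?thesis
    proof (rule exI[of _ "\<lambda>_. carrier G // R"], intro conjI)
      show "(\<Union>i\<le>0::nat. \<Union> (carrier G // R)) = carrier G"
        by (simp add: Union_quotient[OF eq])
      show "(\<Union>i\<le>0::nat. \<Union>U\<in>carrier G // R. U \<times> U) \<in> group_entourages G T"
        using ent by (simp add: un)
    qed (use dis in simp)
  qed
  then have "asdim_le (carrier G) (group_entourages G T) 0"
    unfolding asdim_le_def by blast
  then have "asdim (carrier G) (group_entourages G T) \<le> enat 0"
    unfolding asdim_def by (intro Inf_lower) blast
  then show ?thesis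
    by (simp add: group_asdim_def flip: zero_enat_def)
qed

context ranked_space
begin

lemma asdim_0_bounded:
  assumes "\<And>g. g \<in> carrier (Homeo X) \<Longrightarrow> intertwines g base base"
  shows "group_asdim (Homeo X) (Homeo_topology X) = 0"
proof (rule Homeo.asdim_0I, rule exI[of _ "carrier (Homeo X)"], intro conjI)
  fix E assume "E \<in> group_entourages (Homeo X) (Homeo_topology X)"
  then show "\<forall>g h. (g, h) \<in> E \<longrightarrow> inv\<^bsub>Homeo X\<^esub> g \<otimes>\<^bsub>Homeo X\<^esub> h \<in> carrier (Homeo X)"
    by (auto simp: group_entourages_def)
  show "\<forall>d. cont_left_inv_pseudometric (Homeo X) (Homeo_topology X) d \<longrightarrow>
      (\<exists>c. \<forall>g\<in>carrier (Homeo X). d \<one>\<^bsub>Homeo X\<^esub> g \<le> c)"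
  proof (intro allI impI)
    fix d assume "cont_left_inv_pseudometric (Homeo X) (Homeo_topology X) d"
    then obtain c where "\<And>g. g \<in> carrier (Homeo X) \<Longrightarrow> intertwines g base base \<Longrightarrow> d \<one>\<^bsub>Homeo X\<^esub> g \<le> c"
      using length_bounded_stab[OF length_fun_pseudometric(1)] by metis
    then show "\<exists>c. \<forall>g\<in>carrier (Homeo X). d \<one>\<^bsub>Homeo X\<^esub> g \<le> c"
      using assms by blast
  qed
qed simp_all

text \<open>
  For a limit ordinal the group is an increasing union of the bounded open subgroups of homeomorphisms
  whose defect has rank below \<open>e k\<close>, and the index of the first one containing \<open>g\<close> is a length function.
\<close>

lemma asdim_0_limit:
  assumes ctbl: "countable {..<\<alpha>}" and lim: "\<And>\<gamma>. \<gamma> < \<alpha> \<Longrightarrow> \<exists>\<delta>. \<gamma> < \<delta> \<and> \<delta> < \<alpha>" and ne: "\<gamma>0 < \<alpha>"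
  shows "group_asdim (Homeo X) (Homeo_topology X) = 0"
proof -
  define e where "e = from_nat_into {..<\<alpha>}"
  have e: "e k < \<alpha>" for k
    using from_nat_into[of "{..<\<alpha>}" k] ne by (auto simp: e_def)
  have e_surj: "\<exists>k. e k = \<delta>" if "\<delta> < \<alpha>" for \<delta>
    using that ctbl from_nat_into_surj[of "{..<\<alpha>}" \<delta>] by (auto simp: e_def)
  \<comment> \<open>The enumeration need not be increasing; admitting all \<open>j \<le> k\<close>
    makes the condition monotone in \<open>k\<close>.\<close>
  define P where "P k g \<longleftrightarrow> (\<forall>x\<in>defect g. \<exists>j\<le>k. rk x < e j)" for k :: nat and g
  define N where "N g = (LEAST k. P k g)" for g
  have P_mono: "P l g" if "P k g" "k \<le> l" for k l g
    using that unfolding P_def by (meson le_trans)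
  have P_ex: "\<exists>k. P k g" if g: "g \<in> carrier (Homeo X)" for g
  proof (cases "defect g = {}")
    case True
    then show ?thesis by (simp add: P_def)
  next
    case False
    then obtain a where a: "a \<in> defect g" "\<And>y. y \<in> defect g \<Longrightarrow> rk y \<le> rk a"
      using max_rank_ex[OF clopen_defect[OF g]] by metis
    obtain \<delta> where "rk a < \<delta>" "\<delta> < \<alpha>" using lim[OF defect_rank[OF g a(1)]] by blast
    moreover obtain k where "e k = \<delta>" using e_surj calculation(2) by blast
    ultimately show ?thesis
      using a(2) unfolding P_def by (metis le_less_trans order_refl)
  qed
  have PN: "P (N g) g" if "g \<in> carrier (Homeo X)" for g
    unfolding N_def by (rule LeastI_ex[OF P_ex[OF that]])
  have N_le: "N g \<le> k" if "P k g" for k g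
    unfolding N_def by (rule Least_le[of "\<lambda>k. P k g", OF that])
  have P_mult: "P k (g \<otimes>\<^bsub>Homeo X\<^esub> h)"
    if gh: "g \<in> carrier (Homeo X)" "h \<in> carrier (Homeo X)" "P k g" "P k h" for k g h
    unfolding P_def
  proof
    fix x assume "x \<in> defect (g \<otimes>\<^bsub>Homeo X\<^esub> h)"
    then consider "x \<in> defect h" | "x \<in> topspace X" "h x \<in> defect g"
      using defect_mult[OF gh(1,2)] by blast
    then show "\<exists>j\<le>k. rk x < e j"
    proof cases
      case 2
      then show ?thesis using gh(3) rank_Homeo[OF gh(2) 2(1)] unfolding P_def by fastforce
    qed (use gh(4) in \<open>simp add: P_def\<close>)
  qed
  have P_inv: "P k (inv\<^bsub>Homeo X\<^esub> g)" if g: "g \<in> carrier (Homeo X)" "P k g" for k g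
    unfolding P_def defect_inv[OF g(1)]
  proof
    fix x assume "x \<in> g ` defect g"
    then obtain y where "x = g y" "y \<in> defect g" "y \<in> topspace X" by (auto simp: defect_def)
    then show "\<exists>j\<le>k. rk x < e j" using g by (simp add: P_def)
  qed
  have dN: "cont_left_inv_pseudometric (Homeo X) (Homeo_topology X)
      (\<lambda>g h. real (N (inv\<^bsub>Homeo X\<^esub> g \<otimes>\<^bsub>Homeo X\<^esub> h)))"
  proof (rule cont_left_inv_pseudometric_length)
    fix g h assume g: "g \<in> carrier (Homeo X)" and h: "h \<in> carrier (Homeo X)"
    have "P (N g + N h) (g \<otimes>\<^bsub>Homeo X\<^esub> h)"
      by (rule P_mult[OF g h P_mono[OF PN[OF g]] P_mono[OF PN[OF h]]]) simp_all
    then show "real (N (g \<otimes>\<^bsub>Homeo X\<^esub> h)) \<le> real (N g) + real (N h)"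
      using N_le by fastforce
  next
    fix g assume g: "g \<in> carrier (Homeo X)"
    have "N (inv\<^bsub>Homeo X\<^esub> g) \<le> N g" "N g \<le> N (inv\<^bsub>Homeo X\<^esub> g)"
      using N_le[OF P_inv[OF g PN[OF g]]] N_le[OF P_inv[OF _ PN], of "inv\<^bsub>Homeo X\<^esub> g"] g by simp_all
    then show "real (N (inv\<^bsub>Homeo X\<^esub> g)) = real (N g)" by simp
  next
    fix g assume "g \<in> pure"
    then have "P 0 g" by (simp add: P_def defect_pure)
    then show "real (N g) = 0" using N_le by fastforce
  qed simp
  show ?thesis
  proof (rule Homeo.asdim_0I)
    fix E assume E: "E \<in> group_entourages (Homeo X) (Homeo_topology X)"
    then have sub: "E \<subseteq> carrier (Homeo X) \<times> carrier (Homeo X)"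
      and "bdd_above ((\<lambda>(g, h). real (N (inv\<^bsub>Homeo X\<^esub> g \<otimes>\<^bsub>Homeo X\<^esub> h))) ` E)"
      using dN unfolding group_entourages_def by auto
    then obtain M where M: "\<forall>r\<in>(\<lambda>(g, h). real (N (inv\<^bsub>Homeo X\<^esub> g \<otimes>\<^bsub>Homeo X\<^esub> h))) ` E. r \<le> M"
      unfolding bdd_above_def by (elim exE)
    define k where "k = nat \<lceil>M\<rceil>"
    define H where "H = {g \<in> carrier (Homeo X). P k g}"
    have EH: "inv\<^bsub>Homeo X\<^esub> g \<otimes>\<^bsub>Homeo X\<^esub> h \<in> H" if "(g, h) \<in> E" for g h
    proof -
      have c: "inv\<^bsub>Homeo X\<^esub> g \<otimes>\<^bsub>Homeo X\<^esub> h \<in> carrier (Homeo X)" using sub that by auto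
      have "real (N (inv\<^bsub>Homeo X\<^esub> g \<otimes>\<^bsub>Homeo X\<^esub> h)) \<le> M" using bspec[OF M imageI[OF that]] by simp
      then have "N (inv\<^bsub>Homeo X\<^esub> g \<otimes>\<^bsub>Homeo X\<^esub> h) \<le> k" unfolding k_def by linarith
      then show ?thesis using P_mono[OF PN[OF c]] c by (simp add: H_def)
    qed
    have "\<exists>c. \<forall>g\<in>H. d \<one>\<^bsub>Homeo X\<^esub> g \<le> c" if d: "cont_left_inv_pseudometric (Homeo X) (Homeo_topology X) d" for d
    proof -
      \<comment> \<open>Every rank in a defect of an element of \<open>H\<close> is strictly below
        this \<gamma>, so the bound on the length loses its counting term.\<close>
      define \<gamma> where "\<gamma> = Max (e ` {..k})"
      have \<gamma>: "\<gamma> < \<alpha>" using e by (simp add: \<gamma>_def)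
      have lt: "rk x < \<gamma>" if gx: "g \<in> H" "x \<in> defect g" for g x
      proof -
        obtain j where j: "j \<le> k" "rk x < e j" using gx by (auto simp: H_def P_def)
        have "e j \<le> \<gamma>" using j(1) by (simp add: \<gamma>_def)
        then show ?thesis using j(2) by simp
      qed
      from length_bound[OF length_fun_pseudometric(1)[OF d] \<gamma>]
      obtain K C where KC: "\<forall>g\<in>carrier (Homeo X). (\<forall>x\<in>defect g. rk x \<le> \<gamma>) \<longrightarrow>
          d \<one>\<^bsub>Homeo X\<^esub> g \<le> K * real (card {x \<in> defect g. rk x = \<gamma>}) + C"
        by blast
      have "d \<one>\<^bsub>Homeo X\<^esub> g \<le> C" if g: "g \<in> H" for g
      proof -
        have "d \<one>\<^bsub>Homeo X\<^esub> g \<le> K * real (card {x \<in> defect g. rk x = \<gamma>}) + C"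
          by (rule KC[rule_format]) (use g lt[OF g] in \<open>auto simp: H_def intro: less_imp_le\<close>)
        moreover have "{x \<in> defect g. rk x = \<gamma>} = {}" using lt[OF g] by auto
        ultimately show ?thesis by simp
      qed
      then show ?thesis by blast
    qed
    then show "\<exists>H. H \<subseteq> carrier (Homeo X) \<and> \<one>\<^bsub>Homeo X\<^esub> \<in> H \<and>
      (\<forall>g\<in>H. \<forall>h\<in>H. g \<otimes>\<^bsub>Homeo X\<^esub> h \<in> H) \<and> (\<forall>g\<in>H. inv\<^bsub>Homeo X\<^esub> g \<in> H) \<and>
      (\<forall>g h. (g, h) \<in> E \<longrightarrow> inv\<^bsub>Homeo X\<^esub> g \<otimes>\<^bsub>Homeo X\<^esub> h \<in> H) \<and>
      (\<forall>d. cont_left_inv_pseudometric (Homeo X) (Homeo_topology X) d \<longrightarrow> (\<exists>c. \<forall>g\<in>H. d \<one>\<^bsub>Homeo X\<^esub> g \<le> c))"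
      using P_mult P_inv EH defect_pure[OF one_in_pure]
      by (intro exI[of _ H] conjI) (auto simp: H_def P_def[of _ "\<one>\<^bsub>Homeo X\<^esub>"])
  qed
qed

end

subsection \<open>Lattices of every rank force infinite asymptotic dimension\<close>

text \<open>
  A cover of a large cube in \<open>\<int>\<^sup>m\<close> by \<open>m\<close> families, each consisting of small sets that are far apart,
  is impossible: the neighbourhoods of those members of the \<open>i\<close>-th family that come close to the lower \<open>i\<close>-th
  face separate it from the upper one, and Kuhn's lemma yields a unit cube on which all
  \<open>m\<close> separations change. Such a cube does not meet any member of any family.
\<close>

lemma no_small_separated_cover:
  fixes \<U> :: "nat \<Rightarrow> 's set" and mem :: "'s \<Rightarrow> (nat \<Rightarrow> nat) \<Rightarrow> bool"
  assumes p: "p > 0"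
    and cover: "\<And>x. (\<forall>i<m. x i \<le> p) \<Longrightarrow> \<exists>i<m. \<exists>U\<in>\<U> i. mem U x"
    and sep: "\<And>i U V x y. i < m \<Longrightarrow> U \<in> \<U> i \<Longrightarrow> V \<in> \<U> i \<Longrightarrow> mem U x \<Longrightarrow> mem V y \<Longrightarrow>
      (\<forall>i<m. x i \<le> p) \<Longrightarrow> (\<forall>i<m. y i \<le> p) \<Longrightarrow> (\<forall>i<m. \<bar>int (x i) - int (y i)\<bar> \<le> 2) \<Longrightarrow> U = V"
    and small: "\<And>i U x y. i < m \<Longrightarrow> U \<in> \<U> i \<Longrightarrow> mem U x \<Longrightarrow> mem U y \<Longrightarrow>
      (\<forall>i<m. x i \<le> p) \<Longrightarrow> (\<forall>i<m. y i \<le> p) \<Longrightarrow> \<forall>i<m. \<bar>int (x i) - int (y i)\<bar> + 3 \<le> int p"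
  shows False
proof -
  define box where "box x \<longleftrightarrow> (\<forall>i<m. x i \<le> p)" for x :: "nat \<Rightarrow> nat"
  define adj where "adj x y \<longleftrightarrow> (\<forall>i<m. \<bar>int (x i) - int (y i)\<bar> \<le> 1)" for x y :: "nat \<Rightarrow> nat"
  \<comment> \<open>Level 1 and not 0: if a neighbour of \<open>q\<close> lies on the lower face,
    \<open>q\<close> itself need only satisfy \<open>q i \<le> 1\<close>.\<close>
  define low where "low i U \<longleftrightarrow> (\<exists>y. box y \<and> mem U y \<and> y i \<le> 1)" for i U
  \<comment> \<open>Label 0 marks the lower face and the 1-neighbourhood of the low members.\<close>
  define lab where "lab x i = (if x i = 0 \<or> (\<exists>U\<in>\<U> i. low i U \<and> (\<exists>y. box y \<and> mem U y \<and> adj x y)) then 0 else (1::nat))"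
    for x :: "nat \<Rightarrow> nat" and i :: nat
  obtain q where q: "\<forall>i<m. q i < p"
    "\<forall>i<m. \<exists>r s. (\<forall>j<m. q j \<le> r j \<and> r j \<le> q j + 1) \<and> (\<forall>j<m. q j \<le> s j \<and> s j \<le> q j + 1) \<and>
      lab r i \<noteq> lab s i"
  proof (rule kuhn_lemma[of p m lab])
    show "\<forall>x. (\<forall>i<m. x i \<le> p) \<longrightarrow> (\<forall>i<m. x i = p \<longrightarrow> lab x i = 1)"
    proof (intro allI impI)
      fix x i assume x: "\<forall>i<m. x i \<le> p" and i: "i < m" "x i = p"
      \<comment> \<open>The low member reaches level 1, its extent is at most \<open>p - 3\<close>
        and its neighbourhood adds 1, so the neighbourhood ends below level
        \<open>p\<close>.\<close>
      have False if U: "U \<in> \<U> i" "low i U" "box y" "mem U y" "adj x y" for U y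
      proof -
        obtain w where w: "box w" "mem U w" "w i \<le> 1" using U(2) by (auto simp: low_def)
        have "\<bar>int (y i) - int (w i)\<bar> + 3 \<le> int p"
          using small[OF i(1) U(1,4) w(2)] U(3) w(1) i(1) by (simp add: box_def)
        moreover have "\<bar>int (x i) - int (y i)\<bar> \<le> 1" using U(5) i(1) by (simp add: adj_def)
        ultimately show False using i(2) w(3) by linarith
      qed
      then show "lab x i = 1" using i(2) p by (auto simp: lab_def)
    qed
  qed (use p in \<open>auto simp: lab_def\<close>)
  have qb: "box q" using q(1) by (auto simp: box_def less_imp_le)
  \<comment> \<open>\<open>q\<close> lies in some \<open>U\<close> of the \<open>i\<close>-th
    family. All corners of the cube at \<open>q\<close> are adjacent to \<open>q\<close>, so whether
    \<open>U\<close> is low decides their label in direction \<open>i\<close>, contrary to the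
    choice of \<open>q\<close>.\<close>
  obtain i U where iU: "i < m" "U \<in> \<U> i" "mem U q"
    using cover[of q] qb by (auto simp: box_def)
  obtain r s where rs: "\<forall>j<m. q j \<le> r j \<and> r j \<le> q j + 1" "\<forall>j<m. q j \<le> s j \<and> s j \<le> q j + 1" "lab r i \<noteq> lab s i"
    using q(2) iU(1) by blast
  have adj: "adj r q" "adj s q"
    using rs(1,2) by (auto simp: adj_def)
  show False
  proof (cases "low i U")
    case True
    then have "lab r i = 0" "lab s i = 0"
      using iU qb adj by (auto simp: lab_def)
    then show False using rs(3) by simp
  next
    case False
    have "lab t i = 1" if t: "adj t q" for t
    proof (rule ccontr)
      assume "lab t i \<noteq> 1"
      then consider "t i = 0" | V y where "V \<in> \<U> i" "low i V" "box y" "mem V y" "adj t y"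
        by (auto simp: lab_def split: if_splits)
      then show False
      proof cases
        case 1
        then have "q i \<le> 1" using t iU(1) by (force simp: adj_def)
        then show False using False qb iU(3) by (auto simp: low_def)
      next
        case 2
        \<comment> \<open>\<open>q\<close> and \<open>y\<close> are joined by two unit steps through
          \<open>t\<close>, hence the separation at distance 2.\<close>
        have "\<forall>i<m. \<bar>int (q i) - int (y i)\<bar> \<le> 2"
        proof (intro allI impI)
          fix j assume "j < m"
          then have "\<bar>int (t j) - int (q j)\<bar> \<le> 1" "\<bar>int (t j) - int (y j)\<bar> \<le> 1"
            using t 2(5) by (auto simp: adj_def)
          then show "\<bar>int (q j) - int (y j)\<bar> \<le> 2" by linarith
        qed
        then have "U = V"
          using sep[OF iU(1,2) 2(1) iU(3) 2(4)] qb 2(3) by (simp add: box_def)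
        then show False using False 2(2) by simp
      qed
    qed
    then show False using adj rs(3) by simp
  qed
qed

text \<open>Families and coordinates are equal in number when \<open>m = n + 1\<close>, so a cover
  witnessing dimension \<open>n\<close>, pulled back to a cube in the lattice, contradicts
  \<open>no_small_separated_cover\<close>. By maximality of \<open>d\<close>, relations bounded for
  \<open>d\<close> are bounded for every other pseudometric, so \<open>E\<close> is an
  entourage.\<close>

lemma infinite_coarse_rank_imp_asdim:
  assumes "infinite_coarse_rank G T"
  shows "group_asdim G T = \<infinity>"
proof -
  obtain d where d: "maximal_pseudometric G T d"
    and emb: "\<And>m. m \<ge> 1 \<Longrightarrow> \<exists>\<phi>. quasi_isometric_embedding (int_lattice m) (int_lattice_dist m) (carrier G) d \<phi>"
    using assms unfolding infinite_coarse_rank_def by blast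
  have "\<not> asdim_le (carrier G) (group_entourages G T) n" for n
  proof
    assume n: "asdim_le (carrier G) (group_entourages G T) n"
    define m where "m = Suc n"
    obtain \<phi> where "quasi_isometric_embedding (int_lattice m) (int_lattice_dist m) (carrier G) d \<phi>"
      using emb[of m] by (auto simp: m_def)
    then obtain K C where \<phi>: "\<phi> \<in> int_lattice m \<rightarrow> carrier G" and KC: "K \<ge> 1" "C \<ge> 0"
      and qi: "\<forall>x\<in>int_lattice m. \<forall>y\<in>int_lattice m.
        int_lattice_dist m x y / K - C \<le> d (\<phi> x) (\<phi> y) \<and> d (\<phi> x) (\<phi> y) \<le> K * int_lattice_dist m x y + C"
      unfolding quasi_isometric_embedding_def by (elim conjE exE)
    \<comment> \<open>Lattice points whose coordinates differ by at most 2 are at distance at most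
      \<open>2 * m\<close>, so \<open>E\<close> relates their images.\<close>
    define E where "E = {(g, h) \<in> carrier G \<times> carrier G. d g h \<le> K * (2 * real m) + C}"
    have "E \<in> group_entourages G T"
      unfolding group_entourages_def
    proof (intro CollectI conjI allI impI)
      show "E \<subseteq> carrier G \<times> carrier G" by (auto simp: E_def)
      fix d' assume "cont_left_inv_pseudometric G T d'"
      then obtain K' C' where "\<forall>x\<in>carrier G. \<forall>y\<in>carrier G. d' x y \<le> K' * d x y + C'"
        using d unfolding maximal_pseudometric_def by blast
      moreover have "0 \<le> d x y" if "x \<in> carrier G" "y \<in> carrier G" for x y
        using d that unfolding maximal_pseudometric_def cont_left_inv_pseudometric_def by blast
      ultimately have "d' x y \<le> \<bar>K'\<bar> * (K * (2 * real m) + C) + C'" if "(x, y) \<in> E" for x y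
      proof -
        have xy: "x \<in> carrier G" "y \<in> carrier G" "d x y \<le> K * (2 * real m) + C"
          using that by (auto simp: E_def)
        have "K' * d x y \<le> \<bar>K'\<bar> * d x y"
          using \<open>x \<in> carrier G \<Longrightarrow> y \<in> carrier G \<Longrightarrow> 0 \<le> d x y\<close> xy by (intro mult_right_mono) auto
        also have "\<dots> \<le> \<bar>K'\<bar> * (K * (2 * real m) + C)"
          using xy(3) by (intro mult_left_mono) auto
        finally show ?thesis
          using \<open>\<forall>x\<in>carrier G. \<forall>y\<in>carrier G. d' x y \<le> K' * d x y + C'\<close> xy by force
      qed
      then show "bdd_above ((\<lambda>(g, h). d' g h) ` E)"
        by (intro bdd_aboveI[of _ "\<bar>K'\<bar> * (K * (2 * real m) + C) + C'"]) auto
    qed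
    from bspec[OF n[unfolded asdim_le_def] this]
    obtain \<U> where \<U>: "(\<Union>i\<le>n. \<Union>(\<U> i)) = carrier G"
      "(\<Union>i\<le>n. \<Union>U\<in>\<U> i. U \<times> U) \<in> group_entourages G T"
      "\<forall>i\<le>n. \<forall>U\<in>\<U> i. \<forall>V\<in>\<U> i. U \<noteq> V \<longrightarrow> (U \<times> V) \<inter> E = {}"
      by (elim exE conjE)
    have "cont_left_inv_pseudometric G T d"
      using d unfolding maximal_pseudometric_def by (rule conjunct1)
    then have "bdd_above ((\<lambda>(g, h). d g h) ` (\<Union>i\<le>n. \<Union>U\<in>\<U> i. U \<times> U))"
      by (rule conjunct2[OF \<U>(2)[unfolded group_entourages_def, THEN CollectD], rule_format])
    then obtain R where R: "\<forall>r\<in>(\<lambda>(g, h). d g h) ` (\<Union>i\<le>n. \<Union>U\<in>\<U> i. U \<times> U). r \<le> R"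
      unfolding bdd_above_def by (elim exE)
    have Rd: "d g h \<le> R" if "i < m" "U \<in> \<U> i" "g \<in> U" "h \<in> U" for i U g h
    proof -
      have "(g, h) \<in> (\<Union>i\<le>n. \<Union>U\<in>\<U> i. U \<times> U)" using that by (auto simp: m_def)
      from bspec[OF R imageI[OF this]] show ?thesis by simp
    qed
    define em where "em x = (\<lambda>i. if i < m then int (x i) else 0)" for x :: "nat \<Rightarrow> nat"
    have em: "em x \<in> int_lattice m" for x
      by (simp add: em_def int_lattice_def)
    have dist: "int_lattice_dist m (em x) (em y) = (\<Sum>i<m. real_of_int \<bar>int (x i) - int (y i)\<bar>)" for x y
      by (simp add: em_def int_lattice_dist_def)
    \<comment> \<open>\<open>K * (R + C)\<close> bounds the lattice diameter of the preimage of a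
      member; the summand 4 covers the required margin of 3.\<close>
    define p where "p = nat \<lceil>K * (R + C)\<rceil> + 4"
    define mem where "mem U x \<longleftrightarrow> \<phi> (em x) \<in> U" for U x
    show False
    proof (rule no_small_separated_cover[of p m \<U> mem])
      show "p > 0" by (simp add: p_def)
      show "\<exists>i<m. \<exists>U\<in>\<U> i. mem U x" for x
      proof -
        have "\<phi> (em x) \<in> (\<Union>i\<le>n. \<Union>(\<U> i))"
          unfolding \<U>(1) by (rule funcset_mem[OF \<phi> em])
        then show ?thesis by (auto simp: mem_def m_def less_Suc_eq_le)
      qed
    next
      fix i U V x y
      assume i: "i < m" "U \<in> \<U> i" "V \<in> \<U> i" "mem U x" "mem V y" "\<forall>i<m. \<bar>int (x i) - int (y i)\<bar> \<le> 2"
      have "real_of_int \<bar>int (x j) - int (y j)\<bar> \<le> 2" if "j < m" for j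
        using i(6)[rule_format, OF that] by linarith
      then have "int_lattice_dist m (em x) (em y) \<le> (\<Sum>j<m. 2)"
        unfolding dist by (intro sum_mono) simp
      then have "int_lattice_dist m (em x) (em y) \<le> 2 * real m" by simp
      then have "K * int_lattice_dist m (em x) (em y) \<le> K * (2 * real m)"
        using KC(1) by (intro mult_left_mono) auto
      then have "d (\<phi> (em x)) (\<phi> (em y)) \<le> K * (2 * real m) + C"
        using bspec[OF bspec[OF qi em] em, of x y] by linarith
      then have "(\<phi> (em x), \<phi> (em y)) \<in> (U \<times> V) \<inter> E"
        using funcset_mem[OF \<phi> em] i(4,5) by (simp add: E_def mem_def)
      moreover have "i \<le> n" using i(1) by (simp add: m_def)
      ultimately show "U = V"
        using \<U>(3)[rule_format, of i U V] i(2,3) by (metis empty_iff)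
    next
      fix i U x y
      assume i: "i < m" "U \<in> \<U> i" "mem U x" "mem U y"
      have "d (\<phi> (em x)) (\<phi> (em y)) \<le> R"
        using Rd[OF i(1,2)] i(3,4) by (simp add: mem_def)
      moreover have "int_lattice_dist m (em x) (em y) / K - C \<le> d (\<phi> (em x)) (\<phi> (em y))"
        using bspec[OF bspec[OF qi em] em, of x y] by (rule conjunct1)
      ultimately have "int_lattice_dist m (em x) (em y) / K \<le> R + C" by linarith
      then have D: "int_lattice_dist m (em x) (em y) \<le> K * (R + C)"
        using KC(1) by (simp add: divide_le_eq mult.commute)
      show "\<forall>j<m. \<bar>int (x j) - int (y j)\<bar> + 3 \<le> int p"
      proof (intro allI impI)
        fix j assume "j < m"
        then have "real_of_int \<bar>int (x j) - int (y j)\<bar> \<le> int_lattice_dist m (em x) (em y)"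
          unfolding dist by (intro member_le_sum) auto
        then have "real_of_int \<bar>int (x j) - int (y j)\<bar> \<le> K * (R + C)" using D by linarith
        then have "\<bar>int (x j) - int (y j)\<bar> \<le> \<lceil>K * (R + C)\<rceil>" by linarith
        moreover have "\<lceil>K * (R + C)\<rceil> \<le> int (nat \<lceil>K * (R + C)\<rceil>)" by simp
        ultimately show "\<bar>int (x j) - int (y j)\<bar> + 3 \<le> int p"
          by (simp only: p_def of_nat_add of_nat_numeral)
      qed
    qed
  qed
  then show ?thesis
    by (simp add: group_asdim_def asdim_def top_enat_def)
qed

subsection \<open>The Cantor--Bendixson rank\<close>

lemma wellorder_trichotomy:
  fixes \<alpha> :: "'o::wellorder"
  obtains "\<And>\<beta>. \<alpha> \<le> \<beta>" | \<beta> where "is_succ_of \<beta> \<alpha>" | \<beta> where "\<beta> < \<alpha>" "\<not> successor_ordinal \<alpha>"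
  unfolding successor_ordinal_def by (meson not_le)

lemma cb_derivative_antimono:
  fixes \<gamma> \<delta> :: "'o::wellorder"
  assumes "\<gamma> \<le> \<delta>"
  shows "cb_derivative X \<delta> \<subseteq> cb_derivative X \<gamma>"
  using assms
proof (induction \<delta> arbitrary: \<gamma> rule: less_induct)
  case (less \<delta>)
  show ?case
  proof (cases "\<gamma> = \<delta>")
    case False
    then have lt: "\<gamma> < \<delta>" using less.prems by simp
    show ?thesis
    proof (cases \<delta> rule: wellorder_trichotomy)
      case 1
      then show ?thesis using lt leD by blast
    next
      case (2 \<beta>)
      then have "\<beta> < \<delta>" "\<gamma> \<le> \<beta>" using lt by (auto simp: is_succ_of_def)
      then have "cb_derivative X \<beta> \<subseteq> cb_derivative X \<gamma>" by (rule less.IH)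
      then show ?thesis
        unfolding cb_derivative_succ[OF 2] derived_subset_def by blast
    next
      case (3 \<beta>)
      then show ?thesis
        unfolding cb_derivative_limit[OF 3] using lt by blast
    qed
  qed simp
qed

lemma is_succ_ex:
  fixes \<beta> \<delta> :: "'o::wellorder"
  assumes "\<beta> < \<delta>"
  obtains \<gamma> where "is_succ_of \<beta> \<gamma>" "\<gamma> \<le> \<delta>"
proof
  let ?\<gamma> = "LEAST \<gamma>. \<beta> < \<gamma>"
  have "\<beta> < ?\<gamma>" using assms by (rule LeastI)
  moreover have "\<mu> \<le> \<beta>" if "\<mu> < ?\<gamma>" for \<mu>
    using not_less_Least[OF that] by simp
  ultimately show "is_succ_of \<beta> ?\<gamma>" by (simp add: is_succ_of_def)
  show "?\<gamma> \<le> \<delta>" using assms by (rule Least_le)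
qed

text \<open>The first derivative that omits \<open>x\<close> cannot have index 0, nor a limit index,
  where the derivative is the intersection of the earlier ones; so its index has a predecessor,
  which is the rank. A point of the \<alpha>-th derivative gets rank \<alpha>.\<close>

lemma cb_rank_ex:
  fixes \<alpha> :: "'o::wellorder"
  assumes "x \<in> topspace X"
  shows "\<exists>\<delta>\<le>\<alpha>. \<forall>\<gamma>\<le>\<alpha>. x \<in> cb_derivative X \<gamma> \<longleftrightarrow> \<gamma> \<le> \<delta>"
proof (cases "x \<in> cb_derivative X \<alpha>")
  case True
  then have "x \<in> cb_derivative X \<gamma>" if "\<gamma> \<le> \<alpha>" for \<gamma>
    using cb_derivative_antimono[OF that, of X] by auto
  then show ?thesis
    by (intro exI[of _ \<alpha>]) simp
next
  case False
  define \<mu> :: 'o where "\<mu> = (LEAST \<gamma>. x \<notin> cb_derivative X \<gamma>)"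
  have \<mu>: "x \<notin> cb_derivative X \<mu>" "\<mu> \<le> \<alpha>"
    using LeastI[of "\<lambda>\<gamma>. x \<notin> cb_derivative X \<gamma>", OF False]
      Least_le[of "\<lambda>\<gamma>. x \<notin> cb_derivative X \<gamma>", OF False] by (simp_all add: \<mu>_def)
  have below: "x \<in> cb_derivative X \<gamma>" if "\<gamma> < \<mu>" for \<gamma>
    using not_less_Least[of \<gamma> "\<lambda>\<gamma>. x \<notin> cb_derivative X \<gamma>"] that by (simp add: \<mu>_def)
  show ?thesis
  proof (cases \<mu> rule: wellorder_trichotomy)
    case 1
    then show ?thesis using \<mu>(1) assms cb_derivative_zero[of \<mu> X] by simp
  next
    case (2 \<beta>)
    then have "\<beta> < \<mu>" "\<And>\<gamma>. \<gamma> < \<mu> \<Longrightarrow> \<gamma> \<le> \<beta>" by (auto simp: is_succ_of_def)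
    moreover have "x \<notin> cb_derivative X \<gamma>" if "\<mu> \<le> \<gamma>" for \<gamma>
      using cb_derivative_antimono[OF that, of X] \<mu>(1) by auto
    ultimately have "x \<in> cb_derivative X \<gamma> \<longleftrightarrow> \<gamma> \<le> \<beta>" for \<gamma>
      using below by (metis le_less_trans not_le)
    then show ?thesis
      using \<open>\<beta> < \<mu>\<close> \<mu>(2) by (intro exI[of _ \<beta>]) auto
  next
    case (3 \<beta>)
    then show ?thesis
      using \<mu>(1) below unfolding cb_derivative_limit[OF 3] by blast
  qed
qed

text \<open>A point of rank below \<alpha> is isolated in the derivative indexed by its rank,
  because the next one omits it; at rank \<alpha> the finiteness of the derivative does the
  same.\<close>

lemma Stone_ranked_space:
  fixes X :: "'a topology" and \<alpha> :: "'o::wellorder"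
  assumes type: "countable_Stone_space_type X \<alpha> n" and n: "n \<ge> 1"
  obtains rk :: "'a \<Rightarrow> 'o" where "ranked_space X rk \<alpha>" "{x \<in> topspace X. rk x = \<alpha>} = cb_derivative X \<alpha>"
proof -
  have X: "compact_space X" "Hausdorff_space X" "countable (topspace X)"
    and top: "finite (cb_derivative X \<alpha>)" "card (cb_derivative X \<alpha>) = n"
    using type by (auto simp: countable_Stone_space_type_def Stone_space_def)
  obtain rk :: "'a \<Rightarrow> 'o" where rk: "\<And>x. x \<in> topspace X \<Longrightarrow> rk x \<le> \<alpha>"
    "\<And>x \<gamma>. x \<in> topspace X \<Longrightarrow> \<gamma> \<le> \<alpha> \<Longrightarrow> x \<in> cb_derivative X \<gamma> \<longleftrightarrow> \<gamma> \<le> rk x"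
    using cb_rank_ex[of _ X \<alpha>] by metis
  have cb_sub: "cb_derivative X \<gamma> \<subseteq> topspace X" for \<gamma> :: 'o
  proof -
    have "cb_derivative X (LEAST \<gamma>::'o. True) = topspace X"
      by (rule cb_derivative_zero) (simp add: Least_le)
    then show ?thesis
      using cb_derivative_antimono[of "LEAST \<gamma>::'o. True" \<gamma> X] by (simp add: Least_le)
  qed
  have top_eq: "{x \<in> topspace X. rk x = \<alpha>} = cb_derivative X \<alpha>"
    using rk cb_sub by (force intro: antisym)
  have nbhd: "\<exists>U. openin X U \<and> x \<in> U \<and> (\<forall>y\<in>U - {x}. rk y < rk x)" if x: "x \<in> topspace X" for x
  proof -
    have "\<exists>U. openin X U \<and> U \<inter> cb_derivative X (rk x) = {x}"
    proof (cases "rk x = \<alpha>")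
      case True
      have "closedin X (cb_derivative X \<alpha> - {x})"
        using top(1) cb_sub X(2) by (intro closedin_Hausdorff_finite) auto
      then have "openin X (topspace X - (cb_derivative X \<alpha> - {x}))" by blast
      moreover have "x \<in> cb_derivative X \<alpha>" using True x top_eq by blast
      ultimately show ?thesis
        using True cb_sub x by (intro exI[of _ "topspace X - (cb_derivative X \<alpha> - {x})"]) auto
    next
      case False
      then have "rk x < \<alpha>" using rk(1)[OF x] by simp
      then obtain \<gamma> where \<gamma>: "is_succ_of (rk x) \<gamma>" "\<gamma> \<le> \<alpha>" by (rule is_succ_ex)
      then have "\<not> \<gamma> \<le> rk x" by (simp add: is_succ_of_def not_le)
      then have "x \<notin> derived_subset X (cb_derivative X (rk x))"
        using rk(2)[OF x \<gamma>(2)] unfolding cb_derivative_succ[OF \<gamma>(1), symmetric] by simp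
      moreover have "x \<in> cb_derivative X (rk x)" using rk(2)[OF x rk(1)[OF x]] by simp
      ultimately have "openin (subtopology X (cb_derivative X (rk x))) {x}"
        by (simp add: derived_subset_def)
      then show ?thesis unfolding openin_subtopology by blast
    qed
    then obtain U where U: "openin X U" "U \<inter> cb_derivative X (rk x) = {x}" by blast
    have "rk y < rk x" if "y \<in> U - {x}" for y
    proof -
      have "y \<in> topspace X" "y \<notin> cb_derivative X (rk x)"
        using that U openin_subset by auto
      then show ?thesis using rk(2)[of y "rk x"] rk(1)[OF x] by simp
    qed
    then show ?thesis using U by blast
  qed
  have attained: "\<exists>y\<in>U. rk y = \<gamma>" if U: "openin X U" "x \<in> U" "\<gamma> < rk x" for U x \<gamma>
  proof (rule ccontr)
    assume none: "\<not> (\<exists>y\<in>U. rk y = \<gamma>)"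
    have UX: "y \<in> topspace X" if "y \<in> U" for y using that U(1) openin_subset by blast
    \<comment> \<open>A point of least rank above \<gamma> in \<open>U\<close> is isolated in the
      \<gamma>-th derivative as long as \<open>U\<close> has no point of rank \<gamma>; then the
      next derivative omits it, contrary to its rank.\<close>
    define \<delta> where "\<delta> = (LEAST \<delta>. \<gamma> < \<delta> \<and> (\<exists>y\<in>U. rk y = \<delta>))"
    have "\<gamma> < \<delta> \<and> (\<exists>y\<in>U. rk y = \<delta>)"
      unfolding \<delta>_def by (rule LeastI[of _ "rk x"]) (use U in auto)
    then obtain y where y: "y \<in> U" "rk y = \<delta>" "\<gamma> < \<delta>" by blast
    have least: "\<delta> \<le> rk z" if "z \<in> U" "\<gamma> < rk z" for z
      unfolding \<delta>_def by (rule Least_le) (use that in blast)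
    obtain V where V: "openin X V" "y \<in> V" "\<forall>z\<in>V - {y}. rk z < rk y"
      using nbhd[OF UX[OF y(1)]] by blast
    have "\<gamma> < \<alpha>" using y rk(1)[OF UX[OF y(1)]] by simp
    then obtain \<epsilon> where \<epsilon>: "is_succ_of \<gamma> \<epsilon>" "\<epsilon> \<le> \<delta>" using y(3) by (meson is_succ_ex)
    have ya: "\<epsilon> \<le> \<alpha>" "\<epsilon> \<le> rk y" using \<epsilon>(2) y(2) rk(1)[OF UX[OF y(1)]] by auto
    have yc: "y \<in> cb_derivative X \<gamma>" using rk(2)[OF UX[OF y(1)], of \<gamma>] y(2,3) \<open>\<gamma> < \<alpha>\<close> by simp
    have "U \<inter> V \<inter> cb_derivative X \<gamma> = {y}"
    proof (intro equalityI subsetI)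
      fix z assume z: "z \<in> U \<inter> V \<inter> cb_derivative X \<gamma>"
      then have "\<gamma> \<le> rk z" using rk(2)[OF UX, of z \<gamma>] \<open>\<gamma> < \<alpha>\<close> by simp
      moreover have "rk z \<noteq> \<gamma>" using none z by blast
      ultimately have "rk y \<le> rk z" using least[of z] z y(2) by simp
      then show "z \<in> {y}" using V(3) z by (meson Diff_iff IntD1 IntD2 leD)
    qed (use y(1) V(2) yc in auto)
    then have "openin (subtopology X (cb_derivative X \<gamma>)) {y}"
      using openin_Int[OF U(1) V(1)] unfolding openin_subtopology by blast
    then have "y \<notin> cb_derivative X \<epsilon>"
      by (simp add: cb_derivative_succ[OF \<epsilon>(1)] derived_subset_def)
    then show False using rk(2)[OF UX[OF y(1)] ya(1)] ya(2) by simp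
  qed
  have "cb_derivative X \<alpha> \<noteq> {}" using top n by auto
  then have "\<exists>x\<in>topspace X. rk x = \<alpha>" using top_eq by blast
  then have "ranked_space X rk \<alpha>"
    using X rk(1) nbhd attained by unfold_locales
  then show thesis using that top_eq by blast
qed

text \<open>Dimension 0 has three sources. For \<open>n = 1\<close>, and for \<alpha> = 0, where
  every point is a top point and \<open>base\<close> is the identity, all homeomorphisms commute
  with \<open>base\<close> and the group is bounded; otherwise \<alpha> is a limit. Infinite
  dimension is read off from the coarse rank.\<close>

theorem corollaryB:
  fixes X :: "'a topology" and \<alpha> :: "'o::wellorder" and n :: nat
  assumes "countable {..<\<alpha>}"
    and "n \<ge> 1"
    and "countable_Stone_space_type X \<alpha> n"
  shows "(successor_ordinal \<alpha> \<and> n > 1 \<longrightarrow>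
            group_asdim (Homeo X) (Homeo_topology X) = \<infinity>) \<and>
         (\<not> (successor_ordinal \<alpha> \<and> n > 1) \<longrightarrow>
            group_asdim (Homeo X) (Homeo_topology X) = 0) \<and>
         (successor_ordinal \<alpha> \<and> n > 1 \<longrightarrow>
            infinite_coarse_rank (Homeo X) (Homeo_topology X))"
proof -
  obtain rk :: "'a \<Rightarrow> 'o" where rk: "ranked_space X rk \<alpha>"
    and top: "{x \<in> topspace X. rk x = \<alpha>} = cb_derivative X \<alpha>"
    by (rule Stone_ranked_space[OF assms(3,2)])
  interpret ranked_space X rk \<alpha> by (rule rk)
  have card: "card top_points = n"
    using assms(3) top by (simp add: countable_Stone_space_type_def top_points_def)
  have rank: "infinite_coarse_rank (Homeo X) (Homeo_topology X)" if "successor_ordinal \<alpha>" "n > 1"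
    using that infinite_coarse_rank_Homeo card unfolding successor_ordinal_def by blast
  moreover have "group_asdim (Homeo X) (Homeo_topology X) = 0" if *: "\<not> (successor_ordinal \<alpha> \<and> n > 1)"
  proof (cases "n > 1 \<and> (\<exists>\<gamma>. \<gamma> < \<alpha>)")
    case True
    then obtain \<gamma> where \<gamma>: "\<gamma> < \<alpha>" by blast
    have "\<exists>\<delta>. \<gamma> < \<delta> \<and> \<delta> < \<alpha>" if "\<gamma> < \<alpha>" for \<gamma>
      using * True that unfolding successor_ordinal_def is_succ_of_def by (meson not_le)
    then show ?thesis
      by (rule asdim_0_limit[OF assms(1) _ \<gamma>])
  next
    case False
    have "base (g x) = g (base x)" if g: "g \<in> carrier (Homeo X)" and x: "x \<in> topspace X" for g x
    proof (cases "n > 1")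
      case True
      then have "rk y = \<alpha>" if "y \<in> topspace X" for y
        using False rk_le[OF that] by (metis le_less)
      then have "x \<in> top_points" "g x \<in> top_points"
        using g x by (simp_all add: top_points_def)
      then show ?thesis using baseD(2) by simp
    next
      case False
      then have "card top_points = 1" using assms(2) card by simp
      then obtain p where p: "top_points = {p}" by (rule card_1_singletonE)
      have "base (g x) \<in> {p}" "g (base x) \<in> {p}"
        unfolding p[symmetric] using g x baseD(1) by simp_all
      then show ?thesis by simp
    qed
    then show ?thesis
      by (intro asdim_0_bounded) (simp add: intertwines_def)
  qed
  ultimately show ?thesis
    using infinite_coarse_rank_imp_asdim by blast
qed

end
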